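(* Let $G$ be a chordless plane near-triangulation with outer cycle $C(G)$ on vertices $v_1,\dots,v_i$, $i\in\{3,4,5\}$, and interior vertices $u_1,\dots,u_j$. Suppose that when $i=5$ no interior vertex is adjacent to all vertices of $C(G)$. Then for every monomial $\eta v_1^{\alpha_1}\cdots v_i^{\alpha_i}$ with $\eta\neq0$ in $P(C(G))$, there is a monomial $$\eta'\, v_1^{\alpha_1}\cdots v_i^{\alpha_i}u_1^{\beta_1}\cdots u_j^{\beta_j}$$ in $P(G)$ with $\eta'\neq 0$ and $\beta_k\le 4$ for all $1\le k\le j$.
   Context: For a graph $G$, its vertices are also used as variables, and $P(G)=\prod_{uv\in E(G),\,u<v}(u-v)$ for an arbitrarily fixed orientation $<$ (which only affects the overall sign). "$P(G)$ contains the monomial $\eta M$" means the coefficient of $M$ in the expansion of $P(G)$ is $\eta$. A plane near-triangulation is a plane graph whose outer face is bounded by a cycle $C(G)$ and all of whose other faces are triangles; it is chordless if no edge joins two non-consecutive vertices of $C(G)$. $P(C(G))$ is the polynomial of the cycle $C(G)$ as a graph. *)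

theory Defs
  imports "HOL-Analysis.Analysis" "HOL-Library.Poly_Mapping"
begin

section \<open>Graphs and cycles\<close>

definition simple_graph :: "'v set \<Rightarrow> 'v set set \<Rightarrow> bool" where
  "simple_graph V E \<longleftrightarrow> finite V \<and> (\<forall>e\<in>E. e \<subseteq> V \<and> card e = 2)"

definition cycle_edges :: "'v list \<Rightarrow> 'v set set" where
  "cycle_edges vs = {{vs ! k, vs ! (Suc k mod length vs)} | k. k < length vs}"

definition is_cycle :: "'v set set \<Rightarrow> 'v list \<Rightarrow> bool" where
  "is_cycle E vs \<longleftrightarrow> 3 \<le> length vs \<and> distinct vs \<and> cycle_edges vs \<subseteq> E"

definition chordless :: "'v set set \<Rightarrow> 'v list \<Rightarrow> bool" where
  "chordless E vs \<longleftrightarrow>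
     (\<forall>u\<in>set vs. \<forall>v\<in>set vs. {u, v} \<in> E \<longrightarrow> {u, v} \<in> cycle_edges vs)"


section \<open>Plane graphs and near-triangulations\<close>

text \<open>
  A plane graph is a finite simple graph drawn in the plane \<^typ>\<open>complex\<close>: the vertex \<open>v\<close> is
  the point \<open>pos v\<close> and the edge \<open>e\<close> is the arc \<open>\<gamma> e\<close> joining its two ends. An arc contains no
  vertex except its ends, and two distinct arcs meet only in common ends.
\<close>

definition plane_graph ::
    "'v set \<Rightarrow> 'v set set \<Rightarrow> ('v \<Rightarrow> complex) \<Rightarrow> ('v set \<Rightarrow> real \<Rightarrow> complex) \<Rightarrow> bool" where
  "plane_graph V E pos \<gamma> \<longleftrightarrow>
     simple_graph V E \<and>
     inj_on pos V \<and>
     (\<forall>e\<in>E. arc (\<gamma> e) \<and> {pathstart (\<gamma> e), pathfinish (\<gamma> e)} = pos ` e) \<and>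
     (\<forall>e\<in>E. path_image (\<gamma> e) \<inter> pos ` V = pos ` e) \<and>
     (\<forall>e\<in>E. \<forall>f\<in>E. e \<noteq> f \<longrightarrow> path_image (\<gamma> e) \<inter> path_image (\<gamma> f) = pos ` (e \<inter> f))"

definition edges_image :: "('v set \<Rightarrow> real \<Rightarrow> complex) \<Rightarrow> 'v set set \<Rightarrow> complex set" where
  "edges_image \<gamma> E = (\<Union>e\<in>E. path_image (\<gamma> e))"

definition faces ::
    "'v set \<Rightarrow> 'v set set \<Rightarrow> ('v \<Rightarrow> complex) \<Rightarrow> ('v set \<Rightarrow> real \<Rightarrow> complex) \<Rightarrow> complex set set" where
  "faces V E pos \<gamma> = components (- (pos ` V \<union> edges_image \<gamma> E))"

text \<open>
  The drawing is compact, so exactly one face is unbounded: the outer face. A face is bounded by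
  a cycle if its frontier is the point set of that cycle. The list \<open>vs\<close> gives the vertices of
  the outer cycle in cyclic order.
\<close>

definition plane_near_triangulation ::
    "'v set \<Rightarrow> 'v set set \<Rightarrow> ('v \<Rightarrow> complex) \<Rightarrow> ('v set \<Rightarrow> real \<Rightarrow> complex) \<Rightarrow> 'v list \<Rightarrow> bool" where
  "plane_near_triangulation V E pos \<gamma> vs \<longleftrightarrow>
     plane_graph V E pos \<gamma> \<and>
     is_cycle E vs \<and>
     (\<forall>F\<in>faces V E pos \<gamma>. \<not> bounded F \<longrightarrow> frontier F = edges_image \<gamma> (cycle_edges vs)) \<and>
     (\<forall>F\<in>faces V E pos \<gamma>. bounded F \<longrightarrow>
        (\<exists>ts. is_cycle E ts \<and> length ts = 3 \<and> frontier F = edges_image \<gamma> (cycle_edges ts)))"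


section \<open>The graph polynomial\<close>

text \<open>
  Monomials in the vertices are exponent maps \<open>'v \<Rightarrow>\<^sub>0 nat\<close>, and \<open>('v \<Rightarrow>\<^sub>0 nat) \<Rightarrow>\<^sub>0 int\<close> is the
  ring of integer polynomials in the vertices: \<open>Poly_Mapping.lookup p m\<close> is the coefficient of \<open>m\<close> in \<open>p\<close>,
  and the product of two monomials is the sum of their exponent maps.
\<close>

definition Var :: "'v \<Rightarrow> ('v \<Rightarrow>\<^sub>0 nat) \<Rightarrow>\<^sub>0 int" where
  "Var v = Poly_Mapping.single (Poly_Mapping.single v 1) 1"

definition orientation :: "'v set set \<Rightarrow> ('v \<Rightarrow> 'v \<Rightarrow> bool) \<Rightarrow> bool" where
  "orientation E lt \<longleftrightarrow> (\<forall>u v. {u, v} \<in> E \<longrightarrow> (lt u v \<longleftrightarrow> \<not> lt v u))"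

definition graph_poly :: "('v \<Rightarrow> 'v \<Rightarrow> bool) \<Rightarrow> 'v set set \<Rightarrow> ('v \<Rightarrow>\<^sub>0 nat) \<Rightarrow>\<^sub>0 int" where
  "graph_poly lt E = (\<Prod>(u, v) | {u, v} \<in> E \<and> lt u v. Var u - Var v)"

end

theory Submission
  imports Defs "HOL-Complex_Analysis.Winding_Numbers"
begin

text \<open>
  All exponents of \<open>\<alpha>\<close> are used up by the edges of the outer cycle, so \<open>\<alpha>\<close> is irrelevant: by homogeneity
  it suffices to find in the polynomial of the remaining edges a monomial free of outer vertices
  with all exponents at most 4. The engine is Zhu's polynomial analogue of Thomassen's
  5-choosability argument: after deleting an edge \<open>ab\<close> of the outer cycle of any near-triangulation,
  there is a monomial with exponent 0 at \<open>a\<close> and \<open>b\<close>, at most 2 on the outer cycle and at most 4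
  elsewhere. For an outer cycle of length at most 5 one deletes all outer vertices but two
  consecutive ones, cutting off the parts behind chords on the way. Each deletion costs one unit at
  every neighbour, and a neighbour can exceed 4 only if it is adjacent to all three deleted vertices,
  which can be avoided by rotating the outer cycle.

  Planarity enters only through mod 2 homology: every edge lies on at most two bounded faces, every
  cycle is the boundary of a set of bounded faces, and no nonempty set of bounded faces has empty
  boundary.
\<close>

section \<open>Monomials of graph polynomials\<close>

text \<open>The obstacle is cancellation: a product of nonvanishing monomials may still have
  coefficient 0. Two devices control it. An edge with one end of exponent 0 can always be charged to
  its other end; and when a charge does cancel, the cancelling term is itself a nonvanishing
  monomial and can be used instead.

  The bound 2 on the outer cycle is what lets the engine's induction run. Interior neighbours of a
  deleted outer vertex lie on the next outer cycle, so they start with at most 2 there, and they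
  gain at most 2: one for their edge and one by a trade. When the outer vertices of a short cycle
  are deleted, nothing is traded. The room between 2 and 4 then suffices for two deletions, whereas
  three could reach 5; this is why length 5 carries an extra hypothesis.

  Every piece that occurs on the way is a set of triangles of one fixed complex, so no piece ever
  has to be drawn again.\<close>

definition has_monom :: "('v \<Rightarrow> 'v \<Rightarrow> bool) \<Rightarrow> 'v set set \<Rightarrow> ('v \<Rightarrow>\<^sub>0 nat) \<Rightarrow> bool" where
  "has_monom lt E m \<longleftrightarrow> Poly_Mapping.lookup (graph_poly lt E) m \<noteq> 0"

abbreviation (input) "lookup \<equiv> Poly_Mapping.lookup"

abbreviation X :: "'v \<Rightarrow> ('v \<Rightarrow>\<^sub>0 nat)" where
  "X v \<equiv> Poly_Mapping.single v (Suc 0)"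

text \<open>The convolution sum runs over all ways to write the exponent as a sum. When only one of
  them can have both coefficients nonzero, it collapses to a single product and nothing can
  cancel.\<close>

lemma lookup_mult_unique:
  fixes p q :: "('v \<Rightarrow>\<^sub>0 nat) \<Rightarrow>\<^sub>0 int"
  assumes uniq: "\<And>a b. lookup p a \<noteq> 0 \<Longrightarrow> lookup q b \<noteq> 0 \<Longrightarrow> a + b = m + n \<Longrightarrow> a = m \<and> b = n"
  shows "lookup (p * q) (m + n) = lookup p m * lookup q n"
proof -
  have "lookup (p * q) (m + n) = Sum_any (\<lambda>(a, b). (lookup p a * lookup q b when m + n = a + b))"
    by (simp add: times_poly_mapping.rep_eq prod_fun_unfold_prod)
  also have "\<dots> = Sum_any (\<lambda>ab. (lookup p m * lookup q n when ab = (m, n)))"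
    by (intro Sum_any.cong) (use uniq in \<open>force simp: when_def\<close>)
  also have "\<dots> = lookup p m * lookup q n"
    by simp
  finally show ?thesis .
qed

lemma lookup_mult_zero:
  fixes p q :: "('v \<Rightarrow>\<^sub>0 nat) \<Rightarrow>\<^sub>0 int"
  assumes "\<And>a b. lookup p a \<noteq> 0 \<Longrightarrow> lookup q b \<noteq> 0 \<Longrightarrow> k \<noteq> a + b"
  shows "lookup (p * q) k = 0"
proof -
  have "lookup (p * q) k = Sum_any (\<lambda>(a, b). (lookup p a * lookup q b when k = a + b))"
    by (simp add: times_poly_mapping.rep_eq prod_fun_unfold_prod)
  also have "\<dots> = Sum_any (\<lambda>ab::('v \<Rightarrow>\<^sub>0 nat) \<times> ('v \<Rightarrow>\<^sub>0 nat). 0)"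
    by (intro Sum_any.cong) (use assms in \<open>force simp: when_def\<close>)
  finally show ?thesis by simp
qed

lemma lookup_Var_times: "lookup (Var x * p) (m + X x) = lookup p m"
proof -
  have "lookup (Var x * p) (X x + m) = lookup (Var x) (X x) * lookup p m"
  proof (rule lookup_mult_unique)
    fix a b assume "lookup (Var x :: _ \<Rightarrow>\<^sub>0 int) a \<noteq> 0" and ab: "a + b = X x + m"
    then have "a = X x" by (auto simp: Var_def lookup_single when_def split: if_splits)
    then show "a = X x \<and> b = m" using ab by simp
  qed
  then show ?thesis
    by (simp add: Var_def add.commute)
qed

lemma lookup_Var_times_zero:
  assumes "\<And>m'. m \<noteq> m' + X x"
  shows "lookup (Var x * p) m = 0"
proof (rule lookup_mult_zero)
  fix a b assume "lookup (Var x :: _ \<Rightarrow>\<^sub>0 int) a \<noteq> 0"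
  then have "a = X x" by (auto simp: Var_def lookup_single when_def split: if_splits)
  then show "m \<noteq> a + b" using assms[of b] by (simp add: add.commute)
qed

section \<open>Adding one edge to a graph polynomial\<close>

lemma orientation_subset: "orientation E lt \<Longrightarrow> F \<subseteq> E \<Longrightarrow> orientation F lt"
  by (auto simp: orientation_def)

lemma orientation_irrefl: "orientation E lt \<Longrightarrow> {x, y} \<in> E \<Longrightarrow> x \<noteq> y"
  by (auto simp: orientation_def)

lemma finite_arcs: "finite E \<Longrightarrow> finite {(u, v). {u, v} \<in> E \<and> lt u v}"
proof -
  assume "finite E"
  then have "finite (\<Union>{e \<in> E. finite e})" by auto
  moreover have "{(u, v). {u, v} \<in> E \<and> lt u v} \<subseteq> \<Union>{e \<in> E. finite e} \<times> \<Union>{e \<in> E. finite e}"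
  proof (rule subrelI)
    fix u v assume "(u, v) \<in> {(u, v). {u, v} \<in> E \<and> lt u v}"
    then have "{u, v} \<in> {e \<in> E. finite e}" by simp
    then show "(u, v) \<in> \<Union>{e \<in> E. finite e} \<times> \<Union>{e \<in> E. finite e}" by blast
  qed
  ultimately show ?thesis
    by (meson finite_SigmaI finite_subset)
qed

lemma graph_poly_Un:
  assumes "finite E" "finite F" "E \<inter> F = {}"
  shows "graph_poly lt (E \<union> F) = graph_poly lt E * graph_poly lt F"
proof -
  have "{(u, v). {u, v} \<in> E \<union> F \<and> lt u v} =
      {(u, v). {u, v} \<in> E \<and> lt u v} \<union> {(u, v). {u, v} \<in> F \<and> lt u v}"
    by auto
  moreover have "{(u, v). {u, v} \<in> E \<and> lt u v} \<inter> {(u, v). {u, v} \<in> F \<and> lt u v} = {}"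
    using assms(3) by auto
  ultimately show ?thesis
    unfolding graph_poly_def using assms(1,2)
    by (simp add: prod.union_disjoint[OF finite_arcs finite_arcs])
qed

lemma graph_poly_arc:
 assumes "lt a b" "\<not> lt b a" 
  shows "graph_poly lt {{a, b}} = Var a - Var b"
proof -
    have eq: "{(u, v). {u, v} \<in> {{a, b}} \<and> lt u v} = {(a, b)}"
      unfolding singleton_iff doubleton_eq_iff using assms by blast
    show ?thesis
      unfolding graph_poly_def eq by simp
qed
lemma graph_poly_edge:
  assumes "orientation {{x, y}} lt"
  shows "graph_poly lt {{x, y}} = Var x - Var y \<or> graph_poly lt {{x, y}} = Var y - Var x"
proof -
  have or: "lt x y \<longleftrightarrow> \<not> lt y x"
    using assms unfolding orientation_def by blast
  have c: "{{x, y}} = {{y, x}}" by blast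
  show ?thesis
  proof (cases "lt x y")
    case True
    show ?thesis by (rule disjI1, rule graph_poly_arc) (use True or in blast)+
  next
    case False
    have "graph_poly lt {{y, x}} = Var y - Var x"
      by (rule graph_poly_arc) (use False or in blast)+
    then show ?thesis by (rule disjI2[OF trans[OF arg_cong[OF c]]])
  qed
qed

text \<open>The scalar \<open>s\<close> is 1 or -1, according to the orientation of the new edge.
  Keeping it abstract lets later arguments call either end \<open>x\<close>.\<close>

lemma graph_poly_insert:
  assumes "finite E" "{x, y} \<notin> E" "orientation (insert {x, y} E) lt"
  obtains s :: int where "s \<noteq> 0"
    "\<And>m. lookup (graph_poly lt (insert {x, y} E)) m =
      s * (lookup (Var x * graph_poly lt E) m - lookup (Var y * graph_poly lt E) m)"
proof -
  have eq: "graph_poly lt (insert {x, y} E) = graph_poly lt {{x, y}} * graph_poly lt E"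
    using graph_poly_Un[of "{{x, y}}" E lt] assms by simp
  have "orientation {{x, y}} lt"
    by (rule orientation_subset[OF assms(3)]) simp
  from graph_poly_edge[OF this] show thesis
  proof
    assume "graph_poly lt {{x, y}} = Var x - Var y"
    then show thesis
      by (intro that[of 1]) (auto simp: eq left_diff_distrib lookup_minus)
  next
    assume "graph_poly lt {{x, y}} = Var y - Var x"
    then show thesis
      by (intro that[of "-1"]) (auto simp: eq left_diff_distrib lookup_minus)
  qed
qed

lemma has_monom_insertD:
  assumes "finite E" "{x, y} \<notin> E" "orientation (insert {x, y} E) lt"
    and "has_monom lt (insert {x, y} E) m"
  shows "\<exists>m'. has_monom lt E m' \<and> (m = m' + X x \<or> m = m' + X y)"
proof (rule ccontr)
  assume neg: "\<not> ?thesis"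
  have z: "lookup (Var w * graph_poly lt E) m = 0" if "w = x \<or> w = y" for w
  proof (cases "\<exists>m'. m = m' + X w")
    case True
    then obtain m' where m': "m = m' + X w" by blast
    with neg that have "\<not> has_monom lt E m'" by blast
    then show ?thesis by (simp only: m' lookup_Var_times) (simp add: has_monom_def)
  next
    case False
    then show ?thesis by (intro lookup_Var_times_zero) auto
  qed
  obtain s :: int where "s \<noteq> 0"
    "\<And>m. lookup (graph_poly lt (insert {x, y} E)) m =
      s * (lookup (Var x * graph_poly lt E) m - lookup (Var y * graph_poly lt E) m)"
    using graph_poly_insert[OF assms(1-3)] by blast
  then show False
    using z[of x] z[of y] assms(4) by (simp add: has_monom_def)
qed

text \<open>Up to sign the coefficient of \<open>m + X x\<close> is a difference whose first term is
  nonzero. It vanishes only if the second term is nonzero too, and that term is the monomial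
  \<open>m'\<close>.\<close>

lemma has_monom_insertI:
  assumes "finite E" "{x, y} \<notin> E" "orientation (insert {x, y} E) lt" "has_monom lt E m"
  shows "has_monom lt (insert {x, y} E) (m + X x) \<or> (\<exists>m'. has_monom lt E m' \<and> m + X x = m' + X y)"
proof (rule disjCI)
  assume neg: "\<not> (\<exists>m'. has_monom lt E m' \<and> m + X x = m' + X y)"
  have z: "lookup (Var y * graph_poly lt E) (m + X x) = 0"
  proof (cases "\<exists>m'. m + X x = m' + X y")
    case True
    then obtain m' where m': "m + X x = m' + X y" by blast
    with neg have "\<not> has_monom lt E m'" by blast
    then show ?thesis by (simp only: m' lookup_Var_times) (simp add: has_monom_def)
  next
    case False
    then show ?thesis by (intro lookup_Var_times_zero) auto
  qed
  obtain s :: int where "s \<noteq> 0"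
    "\<And>m. lookup (graph_poly lt (insert {x, y} E)) m =
      s * (lookup (Var x * graph_poly lt E) m - lookup (Var y * graph_poly lt E) m)"
    using graph_poly_insert[OF assms(1-3)] by blast
  then show "has_monom lt (insert {x, y} E) (m + X x)"
    using assms(4) by (simp add: has_monom_def z lookup_Var_times)
qed

text \<open>A cancelling term would be divisible by \<open>y\<close>, but \<open>m + X x\<close> has
  exponent 0 there.\<close>

lemma has_monom_insertI_zero:
  assumes "finite E" "{x, y} \<notin> E" "orientation (insert {x, y} E) lt" "has_monom lt E m" "lookup m y = 0"
  shows "has_monom lt (insert {x, y} E) (m + X x)"
proof -
  have "x \<noteq> y" using orientation_irrefl[OF assms(3)] by blast
  then have "m + X x \<noteq> m' + X y" for m'
    using assms(5) by (auto dest!: arg_cong[where f = "\<lambda>m. lookup m y"] simp: lookup_add lookup_single)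
  then show ?thesis
    using has_monom_insertI[OF assms(1-4)] by blast
qed

lemma has_monom_empty: "has_monom lt {} 0"
  by (simp add: has_monom_def graph_poly_def)

lemma has_monom_empty_iff: "has_monom lt {} m \<longleftrightarrow> m = 0"
  by (auto simp: has_monom_def graph_poly_def lookup_one when_def)

text \<open>Every edge contributes exactly one of its ends. The degree is summed over an arbitrary
  finite \<open>W\<close> containing all ends, so that the induction step need not ask whether the
  ends of the new edge are new.\<close>

lemma has_monom_homogeneous:
  assumes "finite E" "orientation E lt" "\<forall>e\<in>E. card e = 2" "has_monom lt E m"
  shows "Poly_Mapping.keys m \<subseteq> \<Union>E"
    and "finite W \<Longrightarrow> \<Union>E \<subseteq> W \<Longrightarrow> sum (lookup m) W = card E"
proof -
  have "Poly_Mapping.keys m \<subseteq> \<Union>E \<and> (\<forall>W. finite W \<longrightarrow> \<Union>E \<subseteq> W \<longrightarrow> sum (lookup m) W = card E)"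
    using assms
  proof (induction E arbitrary: m rule: finite_induct)
    case empty
    then show ?case by (simp add: has_monom_empty_iff)
  next
    case (insert e E)
    then obtain x y where e: "e = {x, y}" by (metis card_2_iff insertI1)
    obtain m' where m': "has_monom lt E m'" "m = m' + X x \<or> m = m' + X y"
      using has_monom_insertD[of E x y lt m] insert.hyps insert.prems e by blast
    have IH: "Poly_Mapping.keys m' \<subseteq> \<Union>E" "\<And>W. finite W \<Longrightarrow> \<Union>E \<subseteq> W \<Longrightarrow> sum (lookup m') W = card E"
      using insert.IH[OF orientation_subset[OF insert.prems(1)] _ m'(1)] insert.prems(2) by auto
    have kX: "Poly_Mapping.keys (m' + X w) \<subseteq> insert w (\<Union>E)" for w
      using keys_add[of m' "X w"] IH(1) by auto
    have "Poly_Mapping.keys m \<subseteq> \<Union>(insert e E)"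
      using kX[of x] kX[of y] m'(2) unfolding e by blast
    moreover have "sum (lookup m) W = card (insert e E)" if "finite W" "\<Union>(insert e E) \<subseteq> W" for W
    proof -
      have *: "sum (lookup (m' + X w)) W = card E + 1" if "w \<in> W" for w
        using IH(2)[OF \<open>finite W\<close>] \<open>\<Union>(insert e E) \<subseteq> W\<close> that \<open>finite W\<close>
        by (simp add: lookup_add sum.distrib lookup_single when_def)
      show ?thesis
        using *[of x] *[of y] m'(2) that(2) insert.hyps e by auto
    qed
    ultimately show ?case by blast
  qed
  then show "Poly_Mapping.keys m \<subseteq> \<Union>E"
    and "finite W \<Longrightarrow> \<Union>E \<subseteq> W \<Longrightarrow> sum (lookup m) W = card E" by auto
qed

text \<open>By homogeneity, a factor \<open>F\<close> cannot contribute any degree outside the vertices where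
  \<open>n\<close> lives, so no cancellation is possible.\<close>

lemma has_monom_Un:
  assumes fin: "finite E" "finite F" and disj: "E \<inter> F = {}" and or: "orientation (E \<union> F) lt"
    and card2: "\<forall>e\<in>E \<union> F. card e = 2"
    and m: "has_monom lt E m" and n: "has_monom lt F n"
    and zero: "\<And>x. x \<in> \<Union>E \<Longrightarrow> x \<in> \<Union>F \<Longrightarrow> lookup n x = 0"
  shows "has_monom lt (E \<union> F) (m + n)"
proof -
  have orE: "orientation E lt" and orF: "orientation F lt"
    using or orientation_subset by blast+
  have cE: "\<forall>e\<in>E. card e = 2" and cF: "\<forall>e\<in>F. card e = 2" using card2 by auto
  have finF: "finite (\<Union>F)"
    using fin(2) cF by (metis card.infinite finite_Union zero_neq_numeral)
  have "a = m \<and> b = n" if a: "has_monom lt E a" and b: "has_monom lt F b" and ab: "a + b = m + n" for a b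
  proof -
    note kb = has_monom_homogeneous[OF fin(2) orF cF b] and kn = has_monom_homogeneous[OF fin(2) orF cF n]
      and ka = has_monom_homogeneous[OF fin(1) orE cE a] and km = has_monom_homogeneous[OF fin(1) orE cE m]
    \<comment> \<open>At a vertex of \<open>F\<close> off \<open>E\<close> neither \<open>a\<close>
      nor \<open>m\<close> has any degree, so \<open>b\<close> and \<open>n\<close> agree; at all
      other vertices \<open>n\<close> is 0.\<close>
    have le: "lookup n x \<le> lookup b x" for x
    proof (cases "x \<in> \<Union>F \<and> x \<notin> \<Union>E")
      case True
      then have "lookup a x = 0" "lookup m x = 0"
        using ka(1) km(1) by (auto simp: in_keys_iff subset_eq)
      then show ?thesis
        using arg_cong[OF ab, of "\<lambda>m. lookup m x"] by (simp add: lookup_add)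
    next
      case False
      then have "lookup n x = 0"
        using zero[of x] kn(1) by (metis in_keys_iff subsetD)
      then show ?thesis by simp
    qed
    \<comment> \<open>Both monomials have total degree \<open>card F\<close>, so the pointwise
      inequality cannot be strict anywhere.\<close>
    have "lookup n x = lookup b x" if "x \<in> \<Union>F" for x
    proof (rule ccontr)
      assume "lookup n x \<noteq> lookup b x"
      with le[of x] have "lookup n x < lookup b x" by simp
      then have "sum (lookup n) (\<Union>F) < sum (lookup b) (\<Union>F)"
        using finF le that by (intro sum_strict_mono_ex1) auto
      then show False using kb(2) kn(2) finF by simp
    qed
    then have "b = n"
      using kb(1) kn(1) by (intro poly_mapping_eqI) (metis in_keys_iff subsetD)
    then show ?thesis using ab by simp
  qed
  then have "lookup (graph_poly lt E * graph_poly lt F) (m + n)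
      = lookup (graph_poly lt E) m * lookup (graph_poly lt F) n"
    by (intro lookup_mult_unique) (auto simp: has_monom_def)
  then show ?thesis
    using m n graph_poly_Un[OF fin disj] by (simp add: has_monom_def)
qed

section \<open>Adding a vertex with all its edges\<close>

definition star :: "'v \<Rightarrow> 'v set \<Rightarrow> 'v set set" where
  "star v U = (\<lambda>u. {v, u}) ` U"

lemma star_simps [simp]:
  "star v {} = {}" "star v (insert u U) = insert {v, u} (star v U)"
  by (auto simp: star_def)

lemma finite_star [simp]: "finite U \<Longrightarrow> finite (star v U)"
  by (simp add: star_def)

lemma edge_in_star_iff: "v \<notin> U \<Longrightarrow> {v, u} \<in> star v U \<longleftrightarrow> u \<in> U"
  by (auto simp: star_def doubleton_eq_iff)

lemma lookup_sum_X: "finite U \<Longrightarrow> lookup (\<Sum>u\<in>U. X u) x = (if x \<in> U then 1 else 0)"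
  by (auto simp: lookup_sum lookup_single when_def)

lemma has_monom_vertices:
  assumes "finite E" "orientation E lt" "\<forall>e\<in>E. card e = 2" "has_monom lt E m" "x \<notin> \<Union>E"
  shows "lookup m x = 0"
  using has_monom_homogeneous(1)[OF assms(1-4)] assms(5) by (auto simp: in_keys_iff subset_eq)

text \<open>Each new edge is charged to its end in \<open>U\<close>. The exponent of
  \<open>v\<close> stays 0 throughout, so none of these charges can cancel.\<close>

lemma has_monom_star_zero:
  assumes "finite U" "finite E" "v \<notin> U" "v \<notin> \<Union>E" "has_monom lt E m" "lookup m v = 0"
    and "orientation (E \<union> star v U) lt"
  shows "has_monom lt (E \<union> star v U) (m + (\<Sum>u\<in>U. X u))"
  using assms(1,3,7)
proof (induction U rule: finite_induct)
  case empty
  then show ?case using assms by simp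
next
  case (insert u U)
  have eq: "E \<union> star v (insert u U) = insert {u, v} (E \<union> star v U)"
    by (auto simp: insert_commute)
  have "has_monom lt (E \<union> star v U) (m + (\<Sum>u\<in>U. X u))"
    using insert by (auto intro: orientation_subset)
  moreover have "{u, v} \<notin> E \<union> star v U"
    using insert.hyps insert.prems assms(4) edge_in_star_iff[of v U u] by (auto simp: insert_commute)
  moreover have "lookup (m + (\<Sum>u\<in>U. X u)) v = 0"
    using insert assms(6) by (simp add: lookup_add lookup_sum_X)
  ultimately have "has_monom lt (insert {u, v} (E \<union> star v U)) (m + (\<Sum>u\<in>U. X u) + X u)"
    using insert.hyps insert.prems(2) assms(2) unfolding eq by (intro has_monom_insertI_zero) auto
  then show ?case
    unfolding eq using insert.hyps by (simp add: ac_simps)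
qed

text \<open>\<open>J\<close> collects the other ends of those star edges that are charged to
  \<open>v\<close>.\<close>

lemma has_monom_starD:
  assumes "finite U" "finite E" "v \<notin> U" "v \<notin> \<Union>E" "orientation (E \<union> star v U) lt"
    and "has_monom lt (E \<union> star v U) q"
  shows "\<exists>m J. J \<subseteq> U \<and> has_monom lt E m \<and> q = m + (\<Sum>u\<in>U - J. X u) + (\<Sum>u\<in>J. X v)"
  using assms(1,3,5,6)
proof (induction U arbitrary: q rule: finite_induct)
  case empty
  then show ?case by auto
next
  case (insert u U)
  have eq: "E \<union> star v (insert u U) = insert {u, v} (E \<union> star v U)"
    by (auto simp: insert_commute)
  have "{u, v} \<notin> E \<union> star v U"
    using insert.hyps insert.prems assms(4) edge_in_star_iff[of v U u] by (auto simp: insert_commute)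
  then obtain q' where q': "has_monom lt (E \<union> star v U) q'" "q = q' + X u \<or> q = q' + X v"
    using has_monom_insertD[of "E \<union> star v U" u v lt q] insert.prems insert.hyps assms(2) unfolding eq by auto
  then obtain m J where mJ: "J \<subseteq> U" "has_monom lt E m"
      "q' = m + (\<Sum>u\<in>U - J. X u) + (\<Sum>u\<in>J. X v)"
    using insert.IH[of q'] insert.prems orientation_subset[OF insert.prems(2), of "E \<union> star v U"]
    by auto
  have "finite J" "u \<notin> J" using mJ(1) insert.hyps finite_subset by auto
  from q'(2) show ?case
  proof
    assume q: "q = q' + X u"
    have "insert u U - J = insert u (U - J)" using \<open>u \<notin> J\<close> by auto
    then have "q = m + (\<Sum>u\<in>insert u U - J. X u) + (\<Sum>u\<in>J. X v)"
      using q mJ(3) insert.hyps by (simp add: ac_simps)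
    then show ?thesis using mJ by blast
  next
    assume q: "q = q' + X v"
    have "insert u U - insert u J = U - J" using insert.hyps by auto
    then have "q = m + (\<Sum>u\<in>insert u U - insert u J. X u) + (\<Sum>u\<in>insert u J. X v)"
      using q mJ(3) insert.hyps \<open>finite J\<close> \<open>u \<notin> J\<close> by (simp add: ac_simps)
    then show ?thesis using mJ by blast
  qed
qed

text \<open>Either \<open>v\<close> can absorb both edges to \<open>a\<close> and \<open>b\<close>, or the coefficient cancels; in the latter
  case the cancelling term exhibits another nonvanishing monomial of \<open>E\<close>, in which one unit of
  \<open>b\<close> has been traded for one unit of some \<open>u\<close>.\<close>

lemma has_monom_star:
  assumes "finite U" "finite E" "\<forall>e\<in>E. card e = 2" and v: "v \<notin> U" "v \<notin> \<Union>E" "v \<noteq> a" "v \<noteq> b"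
    and ab: "a \<noteq> b" "a \<notin> U" "b \<notin> U"
    and m: "has_monom lt E m" "lookup m a = 0"
    and or: "orientation (E \<union> star v (insert a (insert b U))) lt"
  obtains m' where "has_monom lt (E \<union> star v (insert a (insert b U))) m'" "lookup m' v \<le> 2"
    "\<And>x. x \<noteq> v \<Longrightarrow> x \<notin> U \<Longrightarrow> lookup m' x \<le> lookup m x"
    "\<And>u. u \<in> U \<Longrightarrow> lookup m' u \<le> lookup m u + 2"
proof -
  define E2 where "E2 = E \<union> star v U"
  have eq: "E \<union> star v (insert a (insert b U)) = insert {v, a} (insert {v, b} E2)"
    by (auto simp: E2_def)
  note or' = or[unfolded eq]
  have orE: "orientation E lt" and or2: "orientation E2 lt" and or3: "orientation (insert {v, b} E2) lt"
    and or3': "orientation (insert {b, v} E2) lt"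
    by (rule orientation_subset[OF or'], auto simp: E2_def insert_commute)+
  have fin2: "finite E2" using assms by (simp add: E2_def)
  have b2: "{v, b} \<notin> E2" and b2': "{b, v} \<notin> E2" and a2: "{v, a} \<notin> insert {v, b} E2"
    and a2': "{v, a} \<notin> insert {b, v} E2"
    using v ab edge_in_star_iff[OF v(1)] by (auto simp: E2_def doubleton_eq_iff insert_commute)
  have v0: "lookup n v = 0" if "has_monom lt E n" for n
    using has_monom_vertices[OF assms(2) orE assms(3) that v(2)] .
  let ?S = "\<Sum>u\<in>U. X u"
  have lS: "lookup ?S x = (if x \<in> U then 1 else 0)" for x
    using assms(1) by (rule lookup_sum_X)
  have n: "has_monom lt E2 (n + ?S)" if "has_monom lt E n" for n
    unfolding E2_def using has_monom_star_zero[OF assms(1,2) v(1,2) that v0[OF that]] or2 by (simp add: E2_def)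
  from has_monom_insertI[OF fin2 b2 or3 n[OF m(1)]]
  show thesis
  proof
    \<comment> \<open>The edge to \<open>b\<close> is charged to \<open>v\<close>. As
      \<open>a\<close> still has exponent 0, the edge to \<open>a\<close> can be charged to
      \<open>v\<close> as well.\<close>
    assume *: "has_monom lt (insert {v, b} E2) (m + ?S + X v)"
    have "lookup (m + ?S + X v) a = 0"
      using m(2) ab v by (simp add: lookup_add lS lookup_single)
    then have "has_monom lt (E \<union> star v (insert a (insert b U))) (m + ?S + X v + X v)"
      unfolding eq using fin2 by (intro has_monom_insertI_zero[OF _ a2 or' *]) simp
    then show thesis
      by (intro that[of "m + ?S + X v + X v"])
        (use v v0[OF m(1)] in \<open>auto simp: lookup_add lS lookup_single when_def\<close>)
  next
    assume "\<exists>n. has_monom lt E2 n \<and> m + ?S + X v = n + X b"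
    then obtain n' where n': "has_monom lt E2 n'" "m + ?S + X v = n' + X b" by blast
    then obtain m'' J where J: "J \<subseteq> U" "has_monom lt E m''" "n' = m'' + (\<Sum>u\<in>U - J. X u) + (\<Sum>u\<in>J. X v)"
      using has_monom_starD[OF assms(1,2) v(1,2)] or2 unfolding E2_def by blast
    have finJ: "finite J" using J(1) assms(1) finite_subset by blast
    \<comment> \<open>No edge of \<open>E\<close> contains \<open>v\<close>, so the units of
      \<open>v\<close> in \<open>n'\<close> come from the star; a single unit means that exactly one
      edge, the one to \<open>u\<close>, is charged to \<open>v\<close>.\<close>
    have "lookup n' v = 1"
      using arg_cong[OF n'(2), of "\<lambda>m. lookup m v"] v v0[OF m(1)]
      by (simp add: lookup_add lS lookup_single)
    then have "card J = 1"
      using J(3) v v0[OF J(2)] assms(1) finJ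
      by (simp add: lookup_add lookup_sum_X) (simp add: lookup_sum)
    then obtain u where u: "J = {u}" by (auto simp: card_1_singleton_iff)
    with J have uU: "u \<in> U" by auto
    have nu: "n' + X u = m'' + ?S + X v"
      using J(3) u uU assms(1) by (simp add: sum.remove[of U u X] ac_simps)
    \<comment> \<open>After cancelling common terms this reads \<open>m'' + X b = m + X u\<close>:
      compared with \<open>m\<close>, the monomial \<open>m''\<close> has one unit of
      \<open>b\<close> less and one unit of \<open>u\<close> more.\<close>
    have eqm: "m'' + ?S + X b + X v = m + ?S + X v + X u"
    proof -
      have "m'' + ?S + X b + X v = (m'' + ?S + X v) + X b"
        by (simp add: ac_simps)
      also have "\<dots> = (n' + X b) + X u"
        unfolding nu[symmetric] by (simp add: ac_simps)
      finally show ?thesis unfolding n'(2) .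
    qed
    \<comment> \<open>Charging the edge \<open>vb\<close> to \<open>b\<close> returns the unit that
      \<open>m''\<close> lacks, so \<open>b\<close> ends with its exponent in
      \<open>m\<close>.\<close>
    have b3: "has_monom lt (insert {b, v} E2) (m'' + ?S + X b)"
      using fin2 b2' or3' n[OF J(2)] v v0[OF J(2)] by (intro has_monom_insertI_zero) (auto simp: lookup_add lS)
    have "lookup (m + ?S + X v + X u) a = 0"
      using m(2) ab v uU by (auto simp: lookup_add lS lookup_single when_def)
    then have "lookup (m'' + ?S + X b) a = 0"
      unfolding eqm[symmetric] by (simp add: lookup_add)
    then have "has_monom lt (insert {v, a} (insert {b, v} E2)) (m'' + ?S + X b + X v)"
      using fin2 or' by (intro has_monom_insertI_zero[OF _ a2' _ b3]) (simp_all add: insert_commute)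
    then have "has_monom lt (E \<union> star v (insert a (insert b U))) (m + ?S + X v + X u)"
      unfolding eqm eq by (simp add: insert_commute)
    then show thesis
      by (intro that[of "m + ?S + X v + X u"])
        (use v uU v0[OF m(1)] in \<open>auto simp: lookup_add lS lookup_single when_def\<close>)
  qed
qed

section \<open>Paths, cycles and boundaries modulo 2\<close>

text \<open>A recursive counterpart of the index-based \<open>cycle_edges\<close>, without the
  closing edge, so that cycles can be cut and joined by list operations.\<close>

fun path_edges :: "'v list \<Rightarrow> 'v set set" where
  "path_edges (x # y # zs) = insert {x, y} (path_edges (y # zs))"
| "path_edges _ = {}"

lemma path_edges_append:
  "xs \<noteq> [] \<Longrightarrow> ys \<noteq> [] \<Longrightarrow>
    path_edges (xs @ ys) = path_edges xs \<union> insert {last xs, hd ys} (path_edges ys)"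
proof (induction xs rule: path_edges.induct)
  case ("2_2" v)
  then show ?case by (cases ys) auto
qed auto

lemma path_edges_Cons: "ys \<noteq> [] \<Longrightarrow> path_edges (x # ys) = insert {x, hd ys} (path_edges ys)"
  by (cases ys) auto

lemma path_edges_rev: "path_edges (rev xs) = path_edges xs"
proof (induction xs)
  case (Cons a xs)
  then show ?case
    by (cases "xs = []") (auto simp: path_edges_append path_edges_Cons last_rev insert_commute)
qed auto

lemma path_edges_nth: "path_edges xs = {{xs ! k, xs ! Suc k} | k. Suc k < length xs}"
proof (induction xs rule: path_edges.induct)
  case (1 x y zs)
  have "{{(x # y # zs) ! k, (x # y # zs) ! Suc k} | k. Suc k < length (x # y # zs)} =
      insert {x, y} {{(y # zs) ! k, (y # zs) ! Suc k} | k. Suc k < length (y # zs)}"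
    (is "?L = insert _ ?R")
  proof (intro equalityI subsetI)
    fix e assume "e \<in> ?L"
    then obtain k where k: "e = {(x # y # zs) ! k, (x # y # zs) ! Suc k}" "Suc k < length (x # y # zs)"
      by blast
    then show "e \<in> insert {x, y} ?R"
      by (cases k) auto
  next
    fix e assume "e \<in> insert {x, y} ?R"
    then show "e \<in> ?L"
    proof
      assume "e = {x, y}"
      then show ?thesis by (intro CollectI exI[of _ 0]) auto
    next
      assume "e \<in> ?R"
      then obtain k where "e = {(y # zs) ! k, (y # zs) ! Suc k}" "Suc k < length (y # zs)"
        by blast
      then show ?thesis by (intro CollectI exI[of _ "Suc k"]) auto
    qed
  qed
  with 1 show ?case by simp
qed auto

lemma path_edges_subset: "e \<in> path_edges xs \<Longrightarrow> e \<subseteq> set xs"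
  by (induction xs rule: path_edges.induct) auto

lemma path_edges_card2: "distinct xs \<Longrightarrow> e \<in> path_edges xs \<Longrightarrow> card e = 2"
  by (induction xs rule: path_edges.induct) auto

lemma cycle_edges_conv:
  assumes "xs \<noteq> []"
  shows "cycle_edges xs = insert {last xs, hd xs} (path_edges xs)"
proof -
  let ?n = "length xs"
  have "cycle_edges xs = {{xs ! k, xs ! (Suc k mod ?n)} | k. k < ?n}"
    by (simp add: cycle_edges_def)
  also have "\<dots> = insert {last xs, hd xs} {{xs ! k, xs ! Suc k} | k. Suc k < ?n}" (is "?L = ?R")
  proof (intro equalityI subsetI)
    fix e assume "e \<in> ?L"
    then obtain k where k: "e = {xs ! k, xs ! (Suc k mod ?n)}" "k < ?n" by blast
    show "e \<in> ?R"
    proof (cases "Suc k = ?n")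
      case True
      then have "k = ?n - 1" by simp
      with k True assms show ?thesis by (simp add: last_conv_nth hd_conv_nth)
    next
      case False
      with k show ?thesis by auto
    qed
  next
    fix e assume "e \<in> ?R"
    then show "e \<in> ?L"
    proof
      assume "e = {last xs, hd xs}"
      with assms show ?thesis
        by (intro CollectI exI[of _ "?n - 1"]) (auto simp: last_conv_nth hd_conv_nth)
    next
      assume "e \<in> {{xs ! k, xs ! Suc k} | k. Suc k < ?n}"
      then obtain k where "e = {xs ! k, xs ! Suc k}" "Suc k < ?n" by blast
      then show ?thesis by (intro CollectI exI[of _ k]) auto
    qed
  qed
  finally show ?thesis by (simp add: path_edges_nth)
qed

lemma cycle_edges_Cons:
  "ys \<noteq> [] \<Longrightarrow> cycle_edges (x # ys) = insert {x, hd ys} (insert {x, last ys} (path_edges ys))"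
  by (simp add: cycle_edges_conv path_edges_Cons insert_commute)

lemma cycle_edges_rotate: "cycle_edges (xs @ ys) = cycle_edges (ys @ xs)"
proof (cases "xs = [] \<or> ys = []")
  case False
  then show ?thesis
    by (auto simp: cycle_edges_conv path_edges_append)
qed auto

lemma cycle_edges_subset: "e \<in> cycle_edges xs \<Longrightarrow> e \<subseteq> set xs"
  by (cases "xs = []") (auto simp: cycle_edges_conv cycle_edges_def dest: path_edges_subset)

lemma Union_cycle_edges: "xs \<noteq> [] \<Longrightarrow> \<Union>(cycle_edges xs) = set xs"
proof -
  assume "xs \<noteq> []"
  moreover have "set xs \<subseteq> \<Union>(cycle_edges xs)"
  proof
    fix x assume "x \<in> set xs"
    then obtain i where "i < length xs" "x = xs ! i" by (auto simp: in_set_conv_nth)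
    then have "x \<in> {xs ! i, xs ! (Suc i mod length xs)}"
      "{xs ! i, xs ! (Suc i mod length xs)} \<in> cycle_edges xs"
      unfolding cycle_edges_def by blast+
    then show "x \<in> \<Union>(cycle_edges xs)" by (rule UnionI[rotated])
  qed
  ultimately show ?thesis using cycle_edges_subset by blast
qed

text \<open>Exactly two edges of the cycle meet at each of its vertices, so evenness makes
  membership in \<open>Z\<close> propagate from every edge to the next one.\<close>

lemma cycle_even_subset:
  assumes d: "distinct vs" "3 \<le> length vs" and Z: "Z \<subseteq> cycle_edges vs"
    and ev: "\<And>w. even (card {e \<in> Z. w \<in> e})"
  shows "Z = {} \<or> Z = cycle_edges vs"
proof -
  let ?n = "length vs"
  define s where "s k = Suc k mod ?n" for k
  define g where "g k = {vs ! k, vs ! s k}" for k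
  have ce: "cycle_edges vs = g ` {..<?n}"
    by (auto simp: cycle_edges_def g_def s_def)
  have s_less: "s k < ?n" for k unfolding s_def by (rule mod_less_divisor) (use d(2) in linarith)
  have eqs: "vs ! i = vs ! j \<longleftrightarrow> i = j" if "i < ?n" "j < ?n" for i j
    using d(1) that by (simp add: nth_eq_iff_index_eq)
  have s_inj: "i = j" if "s i = s j" "i < ?n" "j < ?n" for i j
    using that by (auto simp: s_def mod_Suc split: if_splits)
  have s_neq: "s i \<noteq> i" "s (s i) \<noteq> i" if "i < ?n" for i
    using that d(2) by (auto simp: s_def mod_Suc split: if_splits)
  have step: "g k \<in> Z \<longleftrightarrow> g (s k) \<in> Z" if k: "k < ?n" for k
  proof -
    let ?w = "vs ! s k"
    have sub: "{e \<in> Z. ?w \<in> e} = {e \<in> {g k, g (s k)}. e \<in> Z}"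
    proof (intro equalityI subsetI)
      fix e assume "e \<in> {e \<in> Z. ?w \<in> e}"
      then obtain i where i: "i < ?n" "e = g i" "e \<in> Z" "?w \<in> g i" using Z ce by auto
      then have "s k = i \<or> s k = s i" using eqs s_less by (auto simp: g_def)
      then show "e \<in> {e \<in> {g k, g (s k)}. e \<in> Z}" using i s_inj k by auto
    qed (auto simp: g_def)
    have "g k \<noteq> g (s k)"
      using s_neq[OF k] s_neq[OF s_less[of k]] eqs s_less k by (auto simp: g_def doubleton_eq_iff)
    moreover have "even (card {e \<in> {g k, g (s k)}. e \<in> Z})"
      using ev[of ?w] unfolding sub .
    moreover have "{e \<in> {a, b}. e \<in> Z} = (if a \<in> Z then {a} else {}) \<union> (if b \<in> Z then {b} else {})" for a b
      by auto
    ultimately show ?thesis by (auto split: if_splits)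
  qed
  have all: "k < ?n \<Longrightarrow> g k \<in> Z \<longleftrightarrow> g 0 \<in> Z" for k
  proof (induction k)
    case (Suc k)
    then have "s k = Suc k" by (simp add: s_def)
    with Suc step[of k] show ?case by simp
  qed simp
  then show ?thesis using Z ce by (cases "g 0 \<in> Z") auto
qed

text \<open>Triangles are represented by their vertex sets.\<close>

definition incidence :: "'v set set \<Rightarrow> 'v set \<Rightarrow> nat" where
  "incidence S e = card {t \<in> S. e \<subseteq> t}"

text \<open>The boundary of a chain of triangles with coefficients modulo 2, written as the set of
  edges of coefficient 1.\<close>

definition bdry :: "'v set set \<Rightarrow> 'v set set" where
  "bdry S = {e. card e = 2 \<and> odd (incidence S e)}"

definition edges :: "'v set set \<Rightarrow> 'v set set" where
  "edges S = {e. card e = 2 \<and> (\<exists>t\<in>S. e \<subseteq> t)}"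

lemma edges_mono: "S \<subseteq> S' \<Longrightarrow> edges S \<subseteq> edges S'"
  by (auto simp: edges_def)

lemma edges_Un: "edges (S \<union> S') = edges S \<union> edges S'"
  by (auto simp: edges_def)

lemma edges_card2: "e \<in> edges S \<Longrightarrow> card e = 2"
  by (simp add: edges_def)

lemma incidence_pos: "finite S \<Longrightarrow> incidence S e > 0 \<longleftrightarrow> (\<exists>t\<in>S. e \<subseteq> t)"
  by (auto simp: incidence_def card_gt_0_iff)

lemma incidence_Un: "finite S \<Longrightarrow> finite S' \<Longrightarrow> S \<inter> S' = {} \<Longrightarrow> incidence (S \<union> S') e = incidence S e + incidence S' e"
  unfolding incidence_def by (subst card_Un_disjoint[symmetric]) (auto intro!: arg_cong[where f = card])

lemma incidence_mono: "finite S' \<Longrightarrow> S \<subseteq> S' \<Longrightarrow> incidence S e \<le> incidence S' e"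
  unfolding incidence_def by (intro card_mono) auto

lemma bdry_subset_edges: "finite S \<Longrightarrow> bdry S \<subseteq> edges S"
proof
  fix e assume S: "finite S" and e: "e \<in> bdry S"
  then have "incidence S e > 0" by (simp add: bdry_def odd_pos)
  with S e show "e \<in> edges S" by (simp add: incidence_pos bdry_def edges_def)
qed

lemma bdry_empty [simp]: "bdry {} = {}"
  by (simp add: bdry_def incidence_def)

lemma card_two_iff_mem: "card e = 2 \<Longrightarrow> w \<in> e \<Longrightarrow> \<exists>y. y \<noteq> w \<and> e = {w, y}"
  by (auto simp: card_2_iff)

text \<open>The boundary of a boundary vanishes modulo 2. Count the pairs of a triangle and an edge
  of it through \<open>w\<close>: every triangle at \<open>w\<close> contributes two.\<close>

lemma even_bdry:
  assumes "finite R" "\<And>t. t \<in> R \<Longrightarrow> card t = 3"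
  shows "even (card {e \<in> bdry R. w \<in> e})"
proof -
  define N where "N = {e. card e = 2 \<and> w \<in> e \<and> e \<subseteq> \<Union>R}"
  have finR: "finite (\<Union>R)" using assms by (metis card.infinite finite_Union zero_neq_numeral)
  have finN: "finite N" by (rule finite_subset[of _ "Pow (\<Union>R)"]) (use finR in \<open>auto simp: N_def\<close>)
  have "(\<Sum>e\<in>N. card {t \<in> R. e \<subseteq> t}) = (\<Sum>t\<in>R. if w \<in> t then 2 else 0)"
  proof (rule sum_multicount_gen[OF finN assms(1)], rule ballI)
    fix t assume t: "t \<in> R"
    show "card {e \<in> N. e \<subseteq> t} = (if w \<in> t then 2 else 0)"
    proof (cases "w \<in> t")
      case True
      have "finite t" using assms(2)[OF t] by (metis card.infinite zero_neq_numeral)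
      then have "card (t - {w}) = 2" using assms(2)[OF t] True by simp
      then obtain a b where ab: "t - {w} = {a, b}" "a \<noteq> b" by (auto simp: card_2_iff)
      then have t': "t = {w, a, b}" "w \<noteq> a" "w \<noteq> b" using True by auto
      have "{e \<in> N. e \<subseteq> t} = {{w, a}, {w, b}}"
      proof (intro equalityI subsetI)
        fix e assume "e \<in> {e \<in> N. e \<subseteq> t}"
        then obtain y where "y \<noteq> w" "e = {w, y}" "e \<subseteq> t"
          using card_two_iff_mem[of e w] by (auto simp: N_def)
        then show "e \<in> {{w, a}, {w, b}}" using t' by auto
      next
        fix e assume "e \<in> {{w, a}, {w, b}}"
        moreover have "t \<subseteq> \<Union>R" using t by auto
        ultimately show "e \<in> {e \<in> N. e \<subseteq> t}" using t' by (auto simp: N_def)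
      qed
      moreover have "{w, a} \<noteq> {w, b}" using ab t' by (auto simp: doubleton_eq_iff)
      ultimately show ?thesis using True by simp
    next
      case False
      then have "{e \<in> N. e \<subseteq> t} = {}" by (auto simp: N_def)
      then have "card {e \<in> N. e \<subseteq> t} = 0" by (simp only: card.empty)
      then show ?thesis using False by simp
    qed
  qed
  then have "even (\<Sum>e\<in>N. incidence R e)"
    by (simp add: incidence_def) (auto intro: dvd_sum)
  then have "even (card {e \<in> N. odd (incidence R e)})"
    using finN by (simp add: even_sum_iff)
  moreover have "{e \<in> N. odd (incidence R e)} = {e \<in> bdry R. w \<in> e}"
    using bdry_subset_edges[OF assms(1)] unfolding N_def bdry_def edges_def by auto
  ultimately show ?thesis by simp
qed

lemma path_edges_prefix: "path_edges xs \<subseteq> path_edges (xs @ ys)"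
  by (cases "xs = []"; cases "ys = []") (auto simp: path_edges_append)

lemma bdry_single: "bdry {t} = {e. card e = 2 \<and> e \<subseteq> t}"
proof -
  have "{t' \<in> {t}. e \<subseteq> t'} = (if e \<subseteq> t then {t} else {})" for e by auto
  then show ?thesis by (auto simp: bdry_def incidence_def)
qed

lemma bdry_triangle:
  assumes "distinct [x, y, z]"
  shows "bdry {{x, y, z}} = {{x, y}, {x, z}, {y, z}}"
proof -
  have "e \<in> {{x, y}, {x, z}, {y, z}}" if e: "card e = 2" "e \<subseteq> {x, y, z}" for e
  proof -
    obtain p q where "e = {p, q}" "p \<noteq> q" using e(1) by (auto simp: card_2_iff)
    then show ?thesis using e(2) by (auto simp: insert_commute)
  qed
  then show ?thesis using assms by (auto simp: bdry_single)
qed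

lemma edges_triangle_star: "v \<notin> {p, q} \<Longrightarrow> {v, y} \<in> edges {{v, p, q}} \<longleftrightarrow> y = p \<or> y = q"
  by (auto simp: edges_def card_2_iff doubleton_eq_iff)

lemma triangle_third:
  assumes "card t = 3" "{x, y} \<subseteq> t" "x \<noteq> y"
  obtains z where "t = {x, y, z}" "z \<noteq> x" "z \<noteq> y"
proof -
  have "finite t" using assms(1) by (auto intro: card_ge_0_finite)
  then have "card (t - {x, y}) = 1" using assms by (simp add: card_Diff_subset)
  then obtain z where "t - {x, y} = {z}" by (auto simp: card_1_singleton_iff)
  then show thesis using that[of z] assms by auto
qed

lemma hd_last_notin_path_edges:
  assumes "distinct ps" "3 \<le> length ps"
  shows "{hd ps, last ps} \<notin> path_edges ps"
proof
  assume "{hd ps, last ps} \<in> path_edges ps"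
  then obtain k where k: "{hd ps, last ps} = {ps ! k, ps ! Suc k}" "Suc k < length ps"
    by (auto simp: path_edges_nth)
  have "ps \<noteq> []" using assms by auto
  then have "{ps ! 0, ps ! (length ps - 1)} = {ps ! k, ps ! Suc k}"
    using k(1) by (simp add: hd_conv_nth last_conv_nth)
  then have "0 = k \<and> length ps - 1 = Suc k \<or> 0 = Suc k \<and> length ps - 1 = k"
    using assms k(2) \<open>ps \<noteq> []\<close> unfolding doubleton_eq_iff by (auto simp: nth_eq_iff_index_eq)
  then show False using assms(2) by auto
qed

text \<open>Set algebra for removing the last triangle of a fan: its two edges \<open>p\<close> and
  \<open>q\<close> at the apex leave the boundary and its third edge \<open>r\<close>
  enters.\<close>

lemma toggle_closing:
  assumes "\<And>e. e \<in> Z \<longleftrightarrow> (e \<in> insert p (insert q P)) \<noteq> (e \<in> {q, p, r})"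
    and "p \<notin> P" "q \<notin> P" "r \<notin> P" "r \<noteq> p" "r \<noteq> q"
  shows "Z = insert r P"
  using assms by blast

text \<open>The same for a fan with further triangles: only \<open>q\<close> leaves, while
  \<open>s\<close> becomes the new boundary edge at the apex and \<open>r\<close> continues the
  path.\<close>

lemma toggle_opening:
  assumes "\<And>e. e \<in> Z \<longleftrightarrow> (e \<in> insert p (insert q P)) \<noteq> (e \<in> {q, s, r})"
    and "q \<notin> P" "s \<notin> P" "r \<notin> P" "s \<noteq> p" "s \<noteq> q" "p \<noteq> q" "r \<noteq> p" "r \<noteq> q"
  shows "Z = insert p (insert s (insert r P))"
  using assms by blast

section \<open>Complexes of triangles\<close>

text \<open>A combinatorial substitute for the drawing. A near-triangulation with outer cycle
  \<open>C\<close> becomes a subset of \<open>T\<close> with boundary \<open>C\<close>, so cutting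
  along a chord and deleting a vertex are operations on subsets of \<open>T\<close>.\<close>

locale triangle_complex =
  fixes T :: "'v set set"
  assumes finite_T: "finite T"
    and card3: "t \<in> T \<Longrightarrow> card t = 3"
    and incidence_le_2: "card e = 2 \<Longrightarrow> incidence T e \<le> 2"
    and fill: "is_cycle (edges T) vs \<Longrightarrow> \<exists>S\<subseteq>T. bdry S = cycle_edges vs"
    and bdry_eq_empty: "S \<subseteq> T \<Longrightarrow> bdry S = {} \<Longrightarrow> S = {}"
begin

lemma finite_sub: "S \<subseteq> T \<Longrightarrow> finite S"
  using finite_T finite_subset by blast

lemma finite_triangle: "t \<in> T \<Longrightarrow> finite t"
  using card3 by (metis card.infinite zero_neq_numeral)

lemma incidence_le: "S \<subseteq> T \<Longrightarrow> card e = 2 \<Longrightarrow> incidence S e \<le> 2"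
  using incidence_mono[OF finite_T] incidence_le_2 le_trans by blast

lemma incidence_split: "S \<subseteq> T \<Longrightarrow> incidence S e = incidence (S \<inter> R) e + incidence (S - R) e"
  using incidence_Un[of "S \<inter> R" "S - R" e] finite_sub[of S] by (simp add: Int_Diff_Un Int_Diff_disjoint)

lemma mem_bdry: "card e = 2 \<Longrightarrow> e \<in> bdry S \<longleftrightarrow> odd (incidence S e)"
  by (simp add: bdry_def)

lemma mem_edges: "S \<subseteq> T \<Longrightarrow> card e = 2 \<Longrightarrow> e \<in> edges S \<longleftrightarrow> incidence S e > 0"
  using incidence_pos[OF finite_sub] by (simp add: edges_def)

text \<open>Additivity of the boundary modulo 2: triangles in both sets are counted twice and drop
  out.\<close>

lemma bdry_symdiff:
  assumes "S \<subseteq> T" "R \<subseteq> T"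
  shows "e \<in> bdry ((S - R) \<union> (R - S)) \<longleftrightarrow> (e \<in> bdry S) \<noteq> (e \<in> bdry R)"
proof (cases "card e = 2")
  case True
  have "incidence ((S - R) \<union> (R - S)) e = incidence (S - R) e + incidence (R - S) e"
    using assms finite_sub by (intro incidence_Un) auto
  then show ?thesis
    using incidence_split[OF assms(1), of e R] incidence_split[OF assms(2), of e S] True
    by (auto simp: mem_bdry Int_commute)
qed (simp add: bdry_def)

lemma bdry_inject:
  assumes "S \<subseteq> T" "R \<subseteq> T" "bdry S = bdry R"
  shows "S = R"
proof -
  have "bdry ((S - R) \<union> (R - S)) = {}"
    using bdry_symdiff[OF assms(1,2)] assms(3) by auto
  then have "(S - R) \<union> (R - S) = {}"
    by (rule bdry_eq_empty[rotated]) (use assms(1,2) in auto)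
  then show ?thesis by auto
qed

section \<open>Discs: fillings of simple cycles\<close>

definition simple_fill :: "'v set set \<Rightarrow> bool" where
  "simple_fill S \<longleftrightarrow> S \<subseteq> T \<and> (\<exists>vs. distinct vs \<and> 3 \<le> length vs \<and> bdry S = cycle_edges vs)"

lemma simple_fill_subset: "simple_fill S \<Longrightarrow> S \<subseteq> T"
  by (simp add: simple_fill_def)

text \<open>The boundary of \<open>R\<close> is an even subset of a simple cycle, hence nothing or
  the whole cycle, and a boundary determines its chain.\<close>

lemma simple_fill_minimal:
  assumes "simple_fill S" "R \<subseteq> T" "bdry R \<subseteq> bdry S"
  shows "R = {} \<or> R = S"
proof -
  obtain vs where vs: "distinct vs" "3 \<le> length vs" "bdry S = cycle_edges vs"
    using assms(1) by (auto simp: simple_fill_def)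
  have "even (card {e \<in> bdry R. w \<in> e})" for w
    using assms(2) card3 by (intro even_bdry finite_sub) auto
  then have "bdry R = {} \<or> bdry R = bdry S"
    using cycle_even_subset[OF vs(1,2), of "bdry R"] assms(3) vs(3) by simp
  then show ?thesis
    using bdry_eq_empty bdry_inject assms(2) simple_fill_subset[OF assms(1)] by blast
qed

lemma triangle_edge:
  assumes "t \<in> T" "x \<in> t" "y \<in> t" "x \<noteq> y" "t \<in> S"
  shows "{x, y} \<in> edges S"
  using assms by (auto simp: edges_def)

lemma triangle_other:
  assumes "t \<in> T" "w \<in> t"
  obtains z where "z \<in> t" "z \<noteq> w"
proof -
  have "card (t - {w}) = 2" using assms card3 finite_triangle by simp
  then obtain a b where "t - {w} = {a, b}" by (auto simp: card_2_iff)
  then show thesis using that[of a] by blast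
qed

text \<open>Otherwise, a cycle leaving \<open>w\<close> inside \<open>A\<close> and returning outside of it would have a filling that
  contradicts parity inside \<open>A\<close>.\<close>

lemma pinch:
  assumes S: "simple_fill S" and A: "A \<subseteq> {t \<in> S. w \<in> t}" "A \<noteq> {}"
    and closed: "\<And>e. e \<in> edges A \<Longrightarrow> w \<in> e \<Longrightarrow> e \<notin> bdry S \<and> (\<forall>t\<in>S. e \<subseteq> t \<longrightarrow> t \<in> A)"
  shows "A = {t \<in> S. w \<in> t}"
proof (rule ccontr)
  assume "A \<noteq> {t \<in> S. w \<in> t}"
  then obtain t0 where t0: "t0 \<in> S" "w \<in> t0" "t0 \<notin> A" using A by blast
  have ST: "S \<subseteq> T" using S by (rule simple_fill_subset)
  have AS: "A \<subseteq> S" and AT: "A \<subseteq> T" using A(1) ST by auto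
  obtain y where y: "y \<in> t0" "y \<noteq> w" using triangle_other[of t0 w] t0 ST by blast
  obtain t1 where t1: "t1 \<in> A" using A(2) by blast
  then have t1': "t1 \<in> S" "w \<in> t1" using A(1) by auto
  obtain z where z: "z \<in> t1" "z \<noteq> w" using triangle_other[of t1 w] t1' ST by blast
  have wz: "{w, z} \<in> edges A" using t1 t1' z ST by (intro triangle_edge[of t1]) auto
  have wzT: "{w, z} \<in> edges T" using wz edges_mono AT by blast
  have wyS: "{w, y} \<in> edges S" using t0 y ST by (intro triangle_edge[of t0]) auto
  then have wyT: "{w, y} \<in> edges T" using edges_mono ST by blast
  have wy: "{w, y} \<notin> edges A"
    using closed[of "{w, y}"] t0 y by auto
  have zy: "z \<noteq> y" using wz wy by auto
  \<comment> \<open>The vertices that can be reached from \<open>z\<close> inside \<open>S\<close>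
    without passing through \<open>w\<close>.\<close>
  define R where "R = {x. \<exists>p. p \<noteq> [] \<and> hd p = z \<and> last p = x \<and> w \<notin> set p \<and> distinct p \<and> path_edges p \<subseteq> edges S}"
  have zR: "z \<in> R" using z by (auto simp: R_def intro!: exI[of _ "[z]"])
  have Rclosed: "y' \<in> R" if x: "x \<in> R" and e: "{x, y'} \<in> edges S" and "y' \<noteq> w" for x y'
  proof -
    obtain p where p: "p \<noteq> []" "hd p = z" "last p = x" "w \<notin> set p" "distinct p" "path_edges p \<subseteq> edges S"
      using x by (auto simp: R_def)
    show ?thesis
    proof (cases "y' \<in> set p")
      case True
      then obtain p1 p2 where p12: "p = p1 @ y' # p2" by (auto simp: in_set_conv_decomp)
      then have "p = (p1 @ [y']) @ p2" by simp
      then have "path_edges (p1 @ [y']) \<subseteq> edges S" using p(6) path_edges_prefix by (metis subset_trans)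
      moreover have "hd (p1 @ [y']) = z" using p(2) p12 by (cases p1) auto
      ultimately show ?thesis
        using p p12 unfolding R_def by (intro CollectI exI[of _ "p1 @ [y']"]) auto
    next
      case False
      then show ?thesis
        using p e \<open>y' \<noteq> w\<close> unfolding R_def
        by (intro CollectI exI[of _ "p @ [y']"]) (auto simp: path_edges_append)
    qed
  qed
  \<comment> \<open>A triangle of \<open>S\<close> with one reachable vertex has all its vertices
    but \<open>w\<close> reachable. Hence \<open>S1\<close> takes either all or none of the
    triangles on an edge, its boundary is part of \<open>bdry S\<close>, and minimality makes it all
    of \<open>S\<close>. So \<open>y\<close> is reachable.\<close>
  define S1 where "S1 = {t \<in> S. t - {w} \<subseteq> R}"
  have S1T: "S1 \<subseteq> T" using ST by (auto simp: S1_def)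
  have absorb: "t \<in> S1" if t: "t \<in> S" "x \<in> t" "x \<in> R" for t x
  proof -
    have "y' \<in> R" if "y' \<in> t" "y' \<noteq> w" for y'
      using that t ST Rclosed[of x y'] triangle_edge[of t x y' S] by (cases "x = y'") auto
    then show ?thesis using t by (auto simp: S1_def)
  qed
  have "bdry S1 \<subseteq> bdry S"
  proof
    fix e assume e: "e \<in> bdry S1"
    then have c: "card e = 2" "odd (incidence S1 e)" by (auto simp: bdry_def)
    then have "incidence S1 e > 0" by (simp add: odd_pos)
    then obtain t where t: "t \<in> S1" "e \<subseteq> t"
      using incidence_pos[OF finite_sub[OF S1T]] by blast
    obtain x where x: "x \<in> e" "x \<noteq> w" using c(1) by (auto simp: card_2_iff)
    then have "x \<in> R" using t by (auto simp: S1_def)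
    then have "{t \<in> S1. e \<subseteq> t} = {t \<in> S. e \<subseteq> t}"
      using absorb x by (auto simp: S1_def)
    then show "e \<in> bdry S" using c by (simp add: bdry_def incidence_def)
  qed
  moreover have "t1 \<in> S1" using absorb[OF t1'(1) z(1) zR] .
  ultimately have "S1 = S" using simple_fill_minimal[OF S S1T] by blast
  then have "y \<in> R" using t0 y by (auto simp: S1_def)
  then obtain p where p: "p \<noteq> []" "hd p = z" "last p = y" "w \<notin> set p" "distinct p" "path_edges p \<subseteq> edges S"
    by (auto simp: R_def)
  have "path_edges p \<subseteq> edges T" using p(6) edges_mono[OF ST] by blast
  moreover have "length p \<ge> 2" using p(1-3) zy by (cases p; cases "tl p") auto
  ultimately have cyc: "is_cycle (edges T) (w # p)"
    using p wzT wyT by (auto simp: is_cycle_def cycle_edges_Cons)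
  \<comment> \<open>The cycle leaves \<open>w\<close> along \<open>z\<close>, inside
    \<open>A\<close>, and returns along \<open>y\<close>, outside \<open>A\<close>. Intersecting its
    filling with \<open>A\<close> isolates one of its two edges at \<open>w\<close>.\<close>
  obtain Q where Q: "Q \<subseteq> T" "bdry Q = cycle_edges (w # p)" using fill[OF cyc] by blast
  define N where "N = Q \<inter> A"
  have NT: "N \<subseteq> T" using Q by (auto simp: N_def)
  \<comment> \<open>Such an edge lies on two triangles of \<open>S\<close>, both in
    \<open>A\<close>. No edge lies on more than two triangles of \<open>T\<close>, so all triangles
    of \<open>Q\<close> on it are in \<open>A\<close>.\<close>
  have same: "incidence N e = incidence Q e" if e: "e \<in> edges A" "w \<in> e" for e
  proof -
    have c2: "card e = 2" using e edges_card2 by blast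
    have "even (incidence S e)" using closed[OF e] c2 by (simp add: mem_bdry)
    moreover have "incidence S e > 0" using e(1) edges_mono[OF AS] mem_edges[OF ST c2] by blast
    ultimately have "incidence S e = 2" using incidence_le[OF ST c2] by (cases "incidence S e = 1") auto
    then have "card {t \<in> T. e \<subseteq> t} \<le> card {t \<in> S. e \<subseteq> t}"
      using incidence_le_2[OF c2] by (simp add: incidence_def)
    then have "{t \<in> S. e \<subseteq> t} = {t \<in> T. e \<subseteq> t}"
      using ST finite_T by (intro card_seteq) auto
    then have "{t \<in> N. e \<subseteq> t} = {t \<in> Q. e \<subseteq> t}"
      using closed[OF e] Q(1) by (auto simp: N_def)
    then show ?thesis by (simp add: incidence_def)
  qed
  have star: "{e \<in> bdry N. w \<in> e} = {{w, z}}"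
  proof (intro equalityI subsetI)
    fix e assume e: "e \<in> {e \<in> bdry N. w \<in> e}"
    then have eA: "e \<in> edges A"
      using bdry_subset_edges[OF finite_sub[OF NT]] edges_mono[of N A] by (auto simp: N_def)
    have "e \<in> bdry Q" using e same[OF eA] by (simp add: bdry_def)
    then have "e = {w, z} \<or> e = {w, y}"
      using e p Q(2) path_edges_subset[of e p] by (auto simp: cycle_edges_Cons)
    then show "e \<in> {{w, z}}" using eA wy by auto
  next
    fix e assume "e \<in> {{w, z}}"
    moreover have "{w, z} \<in> bdry Q"
      unfolding Q(2) using p(1,2) by (simp add: cycle_edges_Cons)
    then have "{w, z} \<in> bdry N"
      using same[OF wz] by (simp add: bdry_def)
    ultimately show "e \<in> {e \<in> bdry N. w \<in> e}" by auto
  qed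
  moreover have "even (card {e \<in> bdry N. w \<in> e})"
    using NT card3 by (intro even_bdry finite_sub) auto
  ultimately show False by simp
qed

text \<open>If the boundaries of two chains add up to that of a disc, injectivity of the boundary
  makes the disc their symmetric difference. What remains is to exclude an overlap, including one in
  a mere vertex or edge away from the common boundary.\<close>

lemma split:
  assumes S: "simple_fill S" and S1: "S1 \<subseteq> T" and S2: "S2 \<subseteq> T"
    and bdry: "\<And>e. e \<in> bdry S \<longleftrightarrow> (e \<in> bdry S1) \<noteq> (e \<in> bdry S2)"
    and mid: "bdry S1 \<inter> bdry S2 \<subseteq> edges S"
  shows "S1 \<inter> S2 = {}" "S1 \<union> S2 = S" "\<Union>S1 \<inter> \<Union>S2 \<subseteq> \<Union>(bdry S1) \<inter> \<Union>(bdry S2)"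
    "edges S1 \<inter> edges S2 \<subseteq> bdry S1 \<inter> bdry S2"
proof -
  have ST: "S \<subseteq> T" using S by (rule simple_fill_subset)
  define R where "R = S1 \<inter> S2"
  have RT: "R \<subseteq> T" using S1 by (auto simp: R_def)
  have "bdry S = bdry ((S1 - S2) \<union> (S2 - S1))"
    using bdry_symdiff[OF S1 S2] bdry by blast
  then have eqS: "S = (S1 - S2) \<union> (S2 - S1)"
    by (rule bdry_inject[rotated 2]) (use ST S1 S2 in auto)
  \<comment> \<open>A counterexample \<open>e\<close> lies on an odd number of triangles of
    \<open>R\<close> and an even number of \<open>S\<close>, at most two together, hence on one and
    on none. Then \<open>e\<close> is in both boundaries although it is no edge of \<open>S\<close>,
    against \<open>mid\<close>.\<close>
  have "bdry R \<subseteq> bdry S"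
  proof (rule ccontr)
    assume "\<not> bdry R \<subseteq> bdry S"
    then obtain e where e: "e \<in> bdry R" "e \<notin> bdry S" by blast
    then have c2: "card e = 2" by (simp add: bdry_def)
    have sum: "incidence (S \<union> R) e = incidence S e + incidence R e"
      using finite_sub[OF ST] finite_sub[OF RT] by (intro incidence_Un) (auto simp: eqS R_def)
    have "incidence (S \<union> R) e \<le> 2" using ST RT c2 by (intro incidence_le) auto
    moreover have "odd (incidence R e)" "even (incidence S e)" using e c2 by (auto simp: mem_bdry)
    ultimately have "incidence R e = 1" "incidence S e = 0" using sum by presburger+
    then have nS: "e \<notin> edges S" using mem_edges[OF ST c2] by simp
    have "incidence S1 e = incidence R e + incidence (S1 - S2) e" "incidence S2 e = incidence R e + incidence (S2 - S1) e"
      using incidence_split[OF S1, of e S2] incidence_split[OF S2, of e S1] by (simp_all add: R_def Int_commute)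
    moreover have "incidence (S1 - S2) e \<le> incidence S e" "incidence (S2 - S1) e \<le> incidence S e"
      using finite_sub[OF ST] by (auto intro!: incidence_mono simp: eqS)
    ultimately have "e \<in> bdry S1 \<inter> bdry S2"
      using \<open>incidence R e = 1\<close> \<open>incidence S e = 0\<close> c2 by (simp add: mem_bdry)
    then show False using mid nS by blast
  qed
  then have "R = {} \<or> R = S" using simple_fill_minimal[OF S RT] by blast
  then show disj: "S1 \<inter> S2 = {}" using eqS by (auto simp: R_def)
  then show un: "S1 \<union> S2 = S" using eqS by auto
  have sum: "incidence S e = incidence S1 e + incidence S2 e" for e
    using incidence_Un[OF finite_sub[OF S1] finite_sub[OF S2] disj] un by simp
  show "edges S1 \<inter> edges S2 \<subseteq> bdry S1 \<inter> bdry S2"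
  proof
    fix e assume e: "e \<in> edges S1 \<inter> edges S2"
    then have c2: "card e = 2" using edges_card2 by blast
    have "incidence S1 e > 0" "incidence S2 e > 0" using e c2 S1 S2 by (auto simp: mem_edges)
    then have "incidence S1 e = 1" "incidence S2 e = 1" using sum[of e] incidence_le[OF ST c2] by auto
    then show "e \<in> bdry S1 \<inter> bdry S2" using c2 by (simp add: mem_bdry)
  qed
  \<comment> \<open>If no boundary edge of \<open>P2\<close> contains \<open>w\<close>, the
    triangles of \<open>P2\<close> around \<open>w\<close> close up, and by \<open>pinch\<close>
    they are all triangles of \<open>S\<close> at \<open>w\<close>. But \<open>P1\<close> has one
    there too.\<close>
  have half: "w \<in> \<Union>(bdry P2)"
    if P: "P1 \<subseteq> T" "P2 \<subseteq> T" "P1 \<inter> P2 = {}" "P1 \<union> P2 = S" "\<And>e. incidence S e = incidence P1 e + incidence P2 e"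
      and w: "w \<in> \<Union>P1" "w \<in> \<Union>P2" for P1 P2 w
  proof (rule ccontr)
    assume nw: "w \<notin> \<Union>(bdry P2)"
    define A where "A = {t \<in> P2. w \<in> t}"
    have "A = {t \<in> S. w \<in> t}"
    proof (rule pinch[OF S])
      fix e assume e: "e \<in> edges A" "w \<in> e"
      then have c2: "card e = 2" using edges_card2 by blast
      have "e \<in> edges P2" using e edges_mono[of A P2] by (auto simp: A_def)
      then have "incidence P2 e > 0" using mem_edges[OF P(2) c2] by simp
      moreover have "e \<notin> bdry P2" using nw e by blast
      then have "even (incidence P2 e)" using c2 by (simp add: mem_bdry)
      moreover have "incidence S e \<le> 2" using incidence_le[OF ST c2] .
      ultimately have "incidence P2 e = 2" "incidence P1 e = 0" using P(5)[of e] by presburger+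
      then show "e \<notin> bdry S \<and> (\<forall>t\<in>S. e \<subseteq> t \<longrightarrow> t \<in> A)"
        using P(5)[of e] P(4) incidence_pos[OF finite_sub[OF P(1)], of e] c2 e
        by (auto simp: mem_bdry A_def)
    qed (use w P in \<open>auto simp: A_def\<close>)
    then show False using w(1) P(3,4) by (auto simp: A_def)
  qed
  show "\<Union>S1 \<inter> \<Union>S2 \<subseteq> \<Union>(bdry S1) \<inter> \<Union>(bdry S2)"
  proof (intro subsetI IntI)
    fix w assume w: "w \<in> \<Union>S1 \<inter> \<Union>S2"
    then show "w \<in> \<Union>(bdry S2)" using half[OF S1 S2 disj un sum] by blast
    have "S2 \<inter> S1 = {}" "S2 \<union> S1 = S" "\<And>e. incidence S e = incidence S2 e + incidence S1 e"
      using disj un sum by auto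
    from half[OF S2 S1 this] show "w \<in> \<Union>(bdry S1)" using w by blast
  qed
qed

section \<open>Deleting a boundary vertex and cutting along a path\<close>

lemma bdry_remove:
  assumes "S \<subseteq> T" "t \<in> S"
  shows "e \<in> bdry (S - {t}) \<longleftrightarrow> (e \<in> bdry S) \<noteq> (e \<in> bdry {t})"
proof -
  have "S - {t} = (S - {t}) \<union> ({t} - S)" using assms by auto
  then show ?thesis using bdry_symdiff[of S "{t}" e] assms by auto
qed

lemma bdry_incidence_1: "S \<subseteq> T \<Longrightarrow> e \<in> bdry S \<Longrightarrow> incidence S e = 1"
proof -
  assume "S \<subseteq> T" "e \<in> bdry S"
  then have "incidence S e \<le> 2" "odd (incidence S e)" using incidence_le by (auto simp: bdry_def)
  then show ?thesis by presburger
qed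

lemma bdry_unique_triangle:
  assumes "S \<subseteq> T" "e \<in> bdry S"
  obtains t where "t \<in> S" "e \<subseteq> t" "\<And>t'. t' \<in> S \<Longrightarrow> e \<subseteq> t' \<Longrightarrow> t' = t"
proof -
  have "card {t \<in> S. e \<subseteq> t} = 1" using bdry_incidence_1[OF assms] by (simp add: incidence_def)
  then obtain t where "{t \<in> S. e \<subseteq> t} = {t}" by (auto simp: card_1_singleton_iff)
  then show thesis using that[of t] by blast
qed

lemma edges_insert_split: "t \<in> S \<Longrightarrow> edges S = edges (S - {t}) \<union> edges {t}"
  using edges_Un[of "S - {t}" "{t}"] by (simp add: insert_absorb)

text \<open>The induction peels off the triangles at \<open>v\<close> one by one, starting at the edge to \<open>last ps\<close>;
  \<open>pinch\<close> ensures that no triangle at \<open>v\<close> is left when the edge to \<open>hd ps\<close> is reached.\<close>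

lemma fan:
  assumes "S \<subseteq> T" "distinct (v # ps)" "2 \<le> length ps" "bdry S = cycle_edges (v # ps)"
    and "\<And>y. y \<in> set ps \<Longrightarrow> {v, y} \<in> edges S \<Longrightarrow> y = hd ps \<or> y = last ps"
  shows "\<exists>us. distinct us \<and> set us \<inter> set (v # ps) = {} \<and>
      (\<forall>y. {v, y} \<in> edges S \<longleftrightarrow> y \<in> insert (hd ps) (insert (last ps) (set us))) \<and>
      bdry {t \<in> S. v \<notin> t} = (if 3 \<le> length (ps @ us) then cycle_edges (ps @ us) else {})"
  using assms
proof (induction "card S" arbitrary: S ps rule: less_induct)
  case less
  note ST = \<open>S \<subseteq> T\<close> and d = \<open>distinct (v # ps)\<close> and len = \<open>2 \<le> length ps\<close>
    and bdS = \<open>bdry S = cycle_edges (v # ps)\<close> and nochord = less.prems(5)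
  have ne: "ps \<noteq> []" using len by auto
  define a b where "a = hd ps" and "b = last ps"
  have ab: "a \<noteq> b" "a \<noteq> v" "b \<noteq> v" "a \<in> set ps" "b \<in> set ps"
    using d len ne by (cases ps; auto simp: a_def b_def split: if_splits)+
  have ce: "bdry S = insert {v, a} (insert {v, b} (path_edges ps))"
    using bdS ne by (simp add: cycle_edges_Cons a_def b_def)
  have vpath: "{v, y} \<notin> path_edges ps" for y
    using path_edges_subset[of "{v, y}" ps] d by auto
  have "{v, b} \<in> bdry S" unfolding ce by simp
  then obtain t where t: "t \<in> S" "{v, b} \<subseteq> t"
    and tuniq: "\<And>t'. t' \<in> S \<Longrightarrow> {v, b} \<subseteq> t' \<Longrightarrow> t' = t"
    using bdry_unique_triangle[OF ST] by metis
  have tT: "t \<in> T" using t ST by auto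
  obtain x where x: "t = {v, b, x}" "x \<noteq> v" "x \<noteq> b"
    using triangle_third[OF card3[OF tT] t(2)] ab by metis
  have bdt: "bdry {t} = {{v, b}, {v, x}, {b, x}}"
    unfolding x(1) using x ab by (intro bdry_triangle) auto
  define S0 where "S0 = S - {t}"
  have S0T: "S0 \<subseteq> T" using ST by (auto simp: S0_def)
  have card0: "card S0 < card S"
    unfolding S0_def using t(1) finite_sub[OF ST] by (intro card_Diff1_less) auto
  have bd0: "e \<in> bdry S0 \<longleftrightarrow> (e \<in> bdry S) \<noteq> (e \<in> bdry {t})" for e
    unfolding S0_def using bdry_remove[OF ST t(1)] .
  have es0: "{v, y} \<in> edges S \<longleftrightarrow> {v, y} \<in> edges S0 \<or> y = b \<or> y = x" for y
  proof -
    have "v \<notin> {b, x}" using x ab by auto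
    then have "{v, y} \<in> edges {t} \<longleftrightarrow> y = b \<or> y = x"
      unfolding x(1) by (rule edges_triangle_star)
    moreover have "{v, y} \<in> edges S \<longleftrightarrow> {v, y} \<in> edges S0 \<or> {v, y} \<in> edges {t}"
      unfolding S0_def by (subst edges_insert_split[OF t(1)]) (rule Un_iff)
    ultimately show ?thesis by simp
  qed
  have vb0: "{v, b} \<notin> edges S0"
    using tuniq by (auto simp: edges_def S0_def)
  show ?case
  proof (cases "x = a")
    case True
    \<comment> \<open>The triangle \<open>t\<close> already contains both boundary edges at
      \<open>v\<close>. Further triangles at \<open>v\<close> would have only inner edges there, so
      \<open>pinch\<close> would make them all the triangles at \<open>v\<close>, including
      \<open>t\<close>.\<close>
    have "{t' \<in> S0. v \<in> t'} = {}"
    proof (rule ccontr)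
      assume ne0: "{t' \<in> S0. v \<in> t'} \<noteq> {}"
      have va: "{v, a} \<notin> edges S0"
      proof
        assume "{v, a} \<in> edges S0"
        then obtain t' where t': "t' \<in> S" "t' \<noteq> t" "{v, a} \<subseteq> t'" by (auto simp: edges_def S0_def)
        have "{v, a} \<in> bdry S" using ce by auto
        then obtain t'' where "\<And>t'. t' \<in> S \<Longrightarrow> {v, a} \<subseteq> t' \<Longrightarrow> t' = t''"
          using bdry_unique_triangle[OF ST] by metis
        from this[of t'] this[of t] show False using t' t(1) x(1) True by blast
      qed
      have "{t' \<in> S0. v \<in> t'} = {t' \<in> S. v \<in> t'}"
      proof (rule pinch)
        show "simple_fill S"
          unfolding simple_fill_def using ST d len bdS by (intro conjI exI[of _ "v # ps"]) auto
        fix e assume e: "e \<in> edges {t' \<in> S0. v \<in> t'}" "v \<in> e"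
        obtain y where y: "y \<noteq> v" "e = {v, y}"
          using card_two_iff_mem[OF edges_card2[OF e(1)] e(2)] by blast
        have "{t' \<in> S0. v \<in> t'} \<subseteq> S0" by blast
        then have "e \<in> edges S0" using e(1) edges_mono by blast
        then have "y \<noteq> a" "y \<noteq> b" using va vb0 y by auto
        then have "{v, y} \<noteq> {v, a}" "{v, y} \<noteq> {v, b}" by (simp_all add: doubleton_eq_iff)
        then have "e \<notin> bdry S"
          unfolding ce y(2) using vpath[of y] by simp
        moreover have "t' \<in> {t' \<in> S0. v \<in> t'}" if "t' \<in> S" "e \<subseteq> t'" for t'
        proof -
          have "t' \<noteq> t" using that y x(1) True \<open>y \<noteq> a\<close> \<open>y \<noteq> b\<close> by auto
          then show ?thesis using that y by (simp add: S0_def)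
        qed
        ultimately show "e \<notin> bdry S \<and> (\<forall>t\<in>S. e \<subseteq> t \<longrightarrow> t \<in> {t' \<in> S0. v \<in> t'})" by blast
      qed (use ne0 S0_def in auto)
      then show False using t(1) x(1) by (auto simp: S0_def)
    qed
    then have S': "{t' \<in> S. v \<notin> t'} = S0" using x(1) by (auto simp: S0_def)
    have nb: "{v, y} \<in> edges S \<longleftrightarrow> y \<in> {a, b}" for y
      using es0[of y] True \<open>{t' \<in> S0. v \<in> t'} = {}\<close> by (auto simp: edges_def)
    have "bdry S0 = (if 3 \<le> length ps then cycle_edges ps else {})"
    proof (cases "3 \<le> length ps")
      case long: True
      have "cycle_edges ps = insert {b, a} (path_edges ps)"
        using ne by (simp add: cycle_edges_conv a_def b_def)
      moreover have "{b, a} \<notin> path_edges ps"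
        using hd_last_notin_path_edges[of ps] d long by (auto simp: a_def b_def insert_commute)
      moreover have "{b, a} \<noteq> {v, a}" "{b, a} \<noteq> {v, b}" using ab by (auto simp: doubleton_eq_iff)
      moreover have "bdry S0 = insert {b, a} (path_edges ps)"
        by (rule toggle_closing[OF bd0[unfolded bdt ce True]]) (use calculation vpath in auto)
      ultimately show ?thesis using long by auto
    next
      \<comment> \<open>With a single path edge, the third edge of \<open>t\<close> cancels it and
        no boundary is left. This is the origin of the value \<open>{}\<close> in the
        conclusion.\<close>
      case False
      then have "length ps = 2" using len by linarith
      then have "ps = [a, b]" by (auto simp: a_def b_def length_Suc_conv numeral_2_eq_2)
      then have pe: "path_edges ps = {{b, a}}" by (simp add: insert_commute)
      have "e \<notin> bdry S0" for e
        using bd0[of e] unfolding bdt ce True pe by blast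
      then show ?thesis using False by auto
    qed
    then show ?thesis
      using nb S' by (intro exI[of _ "[]"]) (auto simp: a_def b_def)
  next
    case False
    have "{v, x} \<in> edges S" using es0 by blast
    \<comment> \<open>As \<open>v\<close> has no chord, a neighbour other than \<open>a\<close> and
      \<open>b\<close> is a new vertex. It prolongs the path, and the rest of the fan belongs to
      \<open>ps @ [x]\<close>.\<close>
    then have xps: "x \<notin> set ps" using nochord[of x] False x(3) by (auto simp: a_def b_def)
    define ps' where "ps' = ps @ [x]"
    have bx: "{b, x} \<notin> path_edges ps" using xps path_edges_subset[of "{b, x}" ps] by auto
    have "cycle_edges (v # ps') = insert {v, a} (insert {v, x} (insert {b, x} (path_edges ps)))"
      using ne by (auto simp: cycle_edges_Cons path_edges_append ps'_def a_def b_def)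
    moreover have "{v, x} \<noteq> {v, a}" "{v, x} \<noteq> {v, b}" "{v, a} \<noteq> {v, b}" "{b, x} \<noteq> {v, a}" "{b, x} \<noteq> {v, b}"
      using False x ab by (auto simp: doubleton_eq_iff)
    moreover have "bdry S0 = insert {v, a} (insert {v, x} (insert {b, x} (path_edges ps)))"
      by (rule toggle_opening[OF bd0[unfolded bdt ce]]) (use calculation vpath bx in auto)
    ultimately have bd0': "bdry S0 = cycle_edges (v # ps')" by simp
    have "\<exists>us. distinct us \<and> set us \<inter> set (v # ps') = {} \<and>
      (\<forall>y. {v, y} \<in> edges S0 \<longleftrightarrow> y \<in> insert (hd ps') (insert (last ps') (set us))) \<and>
      bdry {t \<in> S0. v \<notin> t} = (if 3 \<le> length (ps' @ us) then cycle_edges (ps' @ us) else {})"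
    proof (rule less.hyps[OF card0 S0T _ _ bd0'])
      fix y assume y: "y \<in> set ps'" "{v, y} \<in> edges S0"
      show "y = hd ps' \<or> y = last ps'"
      proof (cases "y = x")
        case False
        then have "y \<in> set ps" using y by (auto simp: ps'_def)
        moreover have "y \<noteq> b" using y vb0 by auto
        moreover have "{v, y} \<in> edges S" using y es0 by blast
        ultimately show ?thesis using nochord[of y] ne by (auto simp: ps'_def b_def)
      qed (simp add: ps'_def)
    qed (use d xps x len in \<open>auto simp: ps'_def\<close>)
    then obtain us where us: "distinct us" "set us \<inter> set (v # ps') = {}"
      "\<And>y. {v, y} \<in> edges S0 \<longleftrightarrow> y \<in> insert (hd ps') (insert (last ps') (set us))"
      "bdry {t \<in> S0. v \<notin> t} = (if 3 \<le> length (ps' @ us) then cycle_edges (ps' @ us) else {})"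
      by blast
    have "{t \<in> S. v \<notin> t} = {t \<in> S0. v \<notin> t}" using x(1) by (auto simp: S0_def)
    then show ?thesis
      using us es0 xps x ne by (intro exI[of _ "x # us"]) (auto simp: ps'_def a_def b_def)
  qed
qed

text \<open>An edge off \<open>v\<close> that disappears with \<open>v\<close> lies only on the
  triangle that it spans with \<open>v\<close>. It is therefore a boundary edge joining two
  neighbours of \<open>v\<close> on the cycle, which is possible only when \<open>ps\<close> has
  just two vertices.\<close>

lemma fan_reduce:
  assumes S: "S \<subseteq> T" and d: "distinct (v # ps)" and len: "2 \<le> length ps"
    and bdS: "bdry S = cycle_edges (v # ps)"
    and nochord: "\<And>y. y \<in> set ps \<Longrightarrow> {v, y} \<in> edges S \<Longrightarrow> y = hd ps \<or> y = last ps"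
  obtains us where "distinct us" "set us \<inter> set (v # ps) = {}"
    "bdry {t \<in> S. v \<notin> t} = (if 3 \<le> length (ps @ us) then cycle_edges (ps @ us) else {})"
    "edges {t \<in> S. v \<notin> t} \<union> star v (insert (hd ps) (insert (last ps) (set us))) \<subseteq> edges S"
    "edges S \<subseteq> edges {t \<in> S. v \<notin> t} \<union> star v (insert (hd ps) (insert (last ps) (set us))) \<union>
      (if length ps = 2 then {{hd ps, last ps}} else {})"
    "card {t \<in> S. v \<notin> t} < card S"
proof -
  let ?S' = "{t \<in> S. v \<notin> t}"
  obtain us where us: "distinct us" "set us \<inter> set (v # ps) = {}"
    "\<And>y. {v, y} \<in> edges S \<longleftrightarrow> y \<in> insert (hd ps) (insert (last ps) (set us))"
    "bdry ?S' = (if 3 \<le> length (ps @ us) then cycle_edges (ps @ us) else {})"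
    using fan[OF assms] by blast
  let ?N = "insert (hd ps) (insert (last ps) (set us))"
  have S': "?S' \<subseteq> S" by auto
  have "{v, hd ps} \<in> edges S" using us(3) by blast
  then obtain tv where tv: "tv \<in> S" "v \<in> tv" by (auto simp: edges_def)
  then have "?S' \<subset> S" by auto
  then have "card ?S' < card S" using finite_sub[OF S] by (rule psubset_card_mono[rotated])
  moreover have "edges ?S' \<union> star v ?N \<subseteq> edges S"
    using edges_mono[OF S'] us(3) by (auto simp: star_def)
  moreover have "edges S \<subseteq> edges ?S' \<union> star v ?N \<union> (if length ps = 2 then {{hd ps, last ps}} else {})"
  proof
    fix e assume e: "e \<in> edges S"
    then have c2: "card e = 2" by (rule edges_card2)
    show "e \<in> edges ?S' \<union> star v ?N \<union> (if length ps = 2 then {{hd ps, last ps}} else {})"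
    proof (cases "v \<in> e")
      case True
      then obtain y where y: "e = {v, y}" using card_two_iff_mem[OF c2] by blast
      then show ?thesis using e us(3)[of y] by (auto simp: star_def)
    next
      case v: False
      show ?thesis
      proof (cases "e \<in> edges ?S'")
        case e': False
        have all: "v \<in> t" if "t \<in> S" "e \<subseteq> t" for t
          using that e' c2 by (auto simp: edges_def)
        have eq: "t = insert v e" if "t \<in> S" "e \<subseteq> t" for t
        proof -
          have "finite t" using that S finite_triangle by blast
          moreover have "insert v e \<subseteq> t" using all that by auto
          moreover have "card (insert v e) = 3"
            using v c2 by (subst card_insert_disjoint) (auto intro: card_ge_0_finite)
          moreover have "card t = 3" using that S card3 by blast
          ultimately show ?thesis by (metis card_seteq order_refl)
        qed
        obtain t where t: "t \<in> S" "e \<subseteq> t" using e by (auto simp: edges_def)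
        then have "{t \<in> S. e \<subseteq> t} = {insert v e}"
          using eq by (intro set_eqI) (metis mem_Collect_eq singleton_iff)
        then have "incidence S e = 1" by (simp add: incidence_def)
        then have "e \<in> cycle_edges (v # ps)" unfolding bdS[symmetric] using c2 by (simp add: bdry_def)
        moreover have "ps \<noteq> []" using len by auto
        ultimately have ep: "e \<in> path_edges ps" using v by (auto simp: cycle_edges_Cons)
        have "e \<subseteq> ?N"
        proof
          fix y assume y: "y \<in> e"
          have "{v, y} \<in> edges S"
            using t y v all[OF t] S by (intro triangle_edge[of t]) auto
          then show "y \<in> ?N" using us(3) by simp
        qed
        moreover have "e \<subseteq> set ps" using path_edges_subset[OF ep] .
        ultimately have "e \<subseteq> {hd ps, last ps}" using us(2) by auto
        then have "e = {hd ps, last ps}" using c2 by (auto simp: card_2_iff)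
        moreover from this have "\<not> 3 \<le> length ps"
          using hd_last_notin_path_edges[of ps] d ep by auto
        then have "length ps = 2" using len by linarith
        ultimately show ?thesis by simp
      qed simp
    qed
  qed
  ultimately show thesis using that us by blast
qed

text \<open>The outer cycle and the path \<open>x r y\<close> across the disc form a theta curve.
  Its two smaller cycles have fillings, and \<open>split\<close> shows that these partition the
  disc. With \<open>r\<close> empty the path is a chord.\<close>

lemma theta_split:
  assumes S: "S \<subseteq> T" and bdS: "bdry S = cycle_edges (x # p @ y # q)"
    and d: "distinct (x # p @ y # q @ r)" and ne: "p \<noteq> []" "q \<noteq> []"
    and mid: "path_edges (x # r @ [y]) \<subseteq> edges S"
  obtains S1 S2 where "S1 \<subseteq> T" "S2 \<subseteq> T" "bdry S1 = cycle_edges (x # p @ y # rev r)"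
    "bdry S2 = cycle_edges (y # q @ x # r)" "S1 \<inter> S2 = {}" "S1 \<union> S2 = S"
    "\<Union>S1 \<inter> \<Union>S2 \<subseteq> insert x (insert y (set r))" "edges S1 \<inter> edges S2 \<subseteq> path_edges (x # r @ [y])"
proof -
  define P Q M where "P = path_edges (x # p @ [y])" and "Q = path_edges (y # q @ [x])"
    and "M = path_edges (x # r @ [y])"
  have bdPQ: "bdry S = P \<union> Q"
    using ne unfolding bdS P_def Q_def
    by (auto simp: cycle_edges_conv path_edges_append path_edges_Cons insert_commute)
  have "path_edges (rev (x # r @ [y])) = M"
    unfolding M_def by (rule path_edges_rev)
  then have Mrev: "path_edges (y # rev r @ [x]) = M" by simp
  have c1: "cycle_edges (x # p @ y # rev r) = P \<union> M"
    using ne unfolding P_def Mrev[symmetric]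
    by (cases "r = []") (auto simp: cycle_edges_conv path_edges_append path_edges_Cons insert_commute)
  have c2: "cycle_edges (y # q @ x # r) = Q \<union> M"
    using ne unfolding Q_def M_def
    by (cases "r = []") (auto simp: cycle_edges_conv path_edges_append path_edges_Cons insert_commute)
  have xyP: "{x, y} \<notin> P"
    using hd_last_notin_path_edges[of "x # p @ [y]"] d ne by (cases p) (auto simp: P_def)
  have "{y, x} \<notin> Q"
    using hd_last_notin_path_edges[of "y # q @ [x]"] d ne by (cases q) (auto simp: Q_def)
  then have xyQ: "{x, y} \<notin> Q" by (simp add: insert_commute)
  have sub: "e \<subseteq> insert x (insert y (set p))" "card e = 2" if "e \<in> P" for e
    using that path_edges_subset[of e "x # p @ [y]"] path_edges_card2[of "x # p @ [y]" e] d
    unfolding P_def by auto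
  have subQ: "e \<subseteq> insert x (insert y (set q))" "card e = 2" if "e \<in> Q" for e
    using that path_edges_subset[of e "y # q @ [x]"] path_edges_card2[of "y # q @ [x]" e] d
    unfolding Q_def by auto
  have subM: "e \<subseteq> insert x (insert y (set r))" if "e \<in> M" for e
    using that path_edges_subset[of e "x # r @ [y]"] unfolding M_def by auto
  have xy: "e = {x, y}" if "e \<subseteq> {x, y}" "card e = 2" for e
  proof -
    have "card {x, y} = 2" using d by auto
    then show ?thesis using that by (intro card_seteq) auto
  qed
  \<comment> \<open>Two of the three paths share no vertices but \<open>x\<close> and
    \<open>y\<close>, so a common edge would be \<open>xy\<close>, which lies neither on
    \<open>P\<close> nor on \<open>Q\<close>.\<close>
  have PQ: "P \<inter> Q = {}" and PM: "P \<inter> M = {}"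
  proof -
    have "False" if e: "e \<in> P" "e \<in> Q \<or> e \<in> M" for e
    proof -
      have "e \<subseteq> {x, y}" using sub(1)[OF e(1)] subQ(1)[of e] subM[of e] e(2) d by fastforce
      then show False using xy sub(2) e(1) xyP by blast
    qed
    then show "P \<inter> Q = {}" "P \<inter> M = {}" by auto
  qed
  have QM: "Q \<inter> M = {}"
  proof -
    have "False" if e: "e \<in> Q" "e \<in> M" for e
    proof -
      have "e \<subseteq> {x, y}" using subQ(1)[OF e(1)] subM[OF e(2)] d by fastforce
      then show False using xy subQ(2) e(1) xyQ by blast
    qed
    then show ?thesis by auto
  qed
  have "P \<union> Q \<subseteq> edges T" "M \<subseteq> edges T"
    using bdry_subset_edges[OF finite_sub[OF S]] bdPQ edges_mono[OF S] mid M_def by auto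
  then have "is_cycle (edges T) (x # p @ y # rev r)" "is_cycle (edges T) (y # q @ x # r)"
    using d ne by (auto simp: is_cycle_def c1 c2 Suc_le_eq)
  then obtain S1 S2 where S12: "S1 \<subseteq> T" "bdry S1 = P \<union> M" "S2 \<subseteq> T" "bdry S2 = Q \<union> M"
    using fill c1 c2 by metis
  have simple: "simple_fill S"
    unfolding simple_fill_def using S d bdS ne
    by (intro conjI exI[of _ "x # p @ y # q"]) (auto simp: Suc_le_eq)
  have "e \<in> bdry S \<longleftrightarrow> (e \<in> bdry S1) \<noteq> (e \<in> bdry S2)" for e
    unfolding S12 bdPQ using PQ PM QM by blast
  moreover have int: "bdry S1 \<inter> bdry S2 = M" unfolding S12 using PQ PM QM by blast
  then have "bdry S1 \<inter> bdry S2 \<subseteq> edges S" using mid M_def by simp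
  ultimately have sp: "S1 \<inter> S2 = {}" "S1 \<union> S2 = S" "\<Union>S1 \<inter> \<Union>S2 \<subseteq> \<Union>(bdry S1) \<inter> \<Union>(bdry S2)"
      "edges S1 \<inter> edges S2 \<subseteq> bdry S1 \<inter> bdry S2"
    using split[OF simple S12(1,3)] by blast+
  have "\<Union>(bdry S1) \<inter> \<Union>(bdry S2) \<subseteq> insert x (insert y (set r))"
  proof
    fix w assume "w \<in> \<Union>(bdry S1) \<inter> \<Union>(bdry S2)"
    then have "w \<in> insert x (insert y (set p \<union> set r))" "w \<in> insert x (insert y (set q \<union> set r))"
      unfolding S12 using sub(1) subQ(1) subM by blast+
    then show "w \<in> insert x (insert y (set r))" using d by auto
  qed
  with sp(3) have "\<Union>S1 \<inter> \<Union>S2 \<subseteq> insert x (insert y (set r))" by (rule subset_trans)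
  moreover have "edges S1 \<inter> edges S2 \<subseteq> path_edges (x # r @ [y])"
    using sp(4) int M_def by simp
  ultimately show thesis
    using that[OF S12(1,3) _ _ sp(1,2)] S12(2,4) c1 c2 by simp
qed

end

section \<open>Monomials of near-triangulations\<close>

locale oriented_triangle_complex = triangle_complex T
  for T :: "'v set set" +
  fixes lt :: "'v \<Rightarrow> 'v \<Rightarrow> bool"
  assumes orientation_T: "orientation (edges T) lt"
begin

lemma finite_edges: "finite (edges T)"
proof -
  have "edges T \<subseteq> Pow (\<Union>T)" by (auto simp: edges_def)
  moreover have "finite (\<Union>T)" using finite_T finite_triangle by auto
  ultimately show ?thesis using finite_subset by blast
qed

lemma edge_set:
  assumes "F \<subseteq> edges T"
  shows "finite F" "orientation F lt" "\<forall>e\<in>F. card e = 2"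
proof -
  show "finite F" by (rule finite_subset[OF assms finite_edges])
  show "orientation F lt" by (rule orientation_subset[OF orientation_T assms])
  show "\<forall>e\<in>F. card e = 2" using assms by (auto dest: edges_card2)
qed

lemma Union_edges: "S \<subseteq> T \<Longrightarrow> \<Union>(edges S) \<subseteq> \<Union>S"
  by (auto simp: edges_def)

lemma Union_bdry: "S \<subseteq> T \<Longrightarrow> \<Union>(bdry S) \<subseteq> \<Union>S"
  by (rule subset_trans[OF Union_mono[OF bdry_subset_edges[OF finite_sub]] Union_edges])

lemma has_monom_off_vertices:
  assumes "S \<subseteq> T" "F \<subseteq> edges S" "has_monom lt F m" "x \<notin> \<Union>S"
  shows "lookup m x = 0"
proof -
  have "F \<subseteq> edges T" using assms(1,2) edges_mono by blast
  from edge_set[OF this] show ?thesis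
    using assms Union_edges by (intro has_monom_vertices[of F lt]) blast+
qed

text \<open>The pieces share only \<open>v\<close> and \<open>y\<close>, where \<open>m2\<close> is
  0. So \<open>m2\<close> vanishes on all of the first piece, and the sum agrees with
  \<open>m1\<close> there and with \<open>m2\<close> elsewhere.\<close>

lemma glue:
  assumes T12: "S1 \<subseteq> T" "S2 \<subseteq> T" and int: "\<Union>S1 \<inter> \<Union>S2 \<subseteq> {v, y}" "edges S1 \<inter> edges S2 \<subseteq> {{v, y}}"
    and F1: "F1 \<subseteq> edges S1" "has_monom lt F1 m1" and m2: "has_monom lt (edges S2 - {{v, y}}) m2" "lookup m2 v = 0" "lookup m2 y = 0"
  shows "has_monom lt (F1 \<union> (edges S2 - {{v, y}})) (m1 + m2)"
    and "x \<in> \<Union>S1 \<Longrightarrow> lookup (m1 + m2) x = lookup m1 x"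
    and "x \<notin> \<Union>S1 \<Longrightarrow> lookup (m1 + m2) x = lookup m2 x"
proof -
  let ?F2 = "edges S2 - {{v, y}}"
  have F2: "?F2 \<subseteq> edges S2" by blast
  have z: "lookup m2 x = 0" if "x \<in> \<Union>S1" for x
    using that int(1) m2 has_monom_off_vertices[OF T12(2) F2 m2(1), of x] by blast
  have sub: "F1 \<union> ?F2 \<subseteq> edges T" using F1(1) F2 edges_mono T12 by blast
  show "has_monom lt (F1 \<union> ?F2) (m1 + m2)"
  proof (rule has_monom_Un)
    show "F1 \<inter> ?F2 = {}" using F1(1) int(2) by blast
    show "finite F1" "finite ?F2" using edge_set(1)[OF sub] by auto
    fix x assume "x \<in> \<Union>F1"
    then have "x \<in> \<Union>S1" using F1(1) Union_edges[OF T12(1)] by blast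
    then show "lookup m2 x = 0" by (rule z)
  qed (use edge_set[OF sub] F1 m2 in auto)
  show "x \<in> \<Union>S1 \<Longrightarrow> lookup (m1 + m2) x = lookup m1 x" using z by (simp add: lookup_add)
  show "x \<notin> \<Union>S1 \<Longrightarrow> lookup (m1 + m2) x = lookup m2 x"
    using has_monom_off_vertices[OF T12(1) F1] by (simp add: lookup_add)
qed

lemma cycle_vertices: "S \<subseteq> T \<Longrightarrow> bdry S = cycle_edges vs \<Longrightarrow> set vs \<subseteq> \<Union>S"
  using Union_bdry[of S] Union_cycle_edges[of vs] by (cases "vs = []") auto

lemma psubset_card: "S1 \<inter> S2 = {} \<Longrightarrow> S1 \<union> S2 = S \<Longrightarrow> S \<subseteq> T \<Longrightarrow> S2 \<noteq> {} \<Longrightarrow> card S1 < card S"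
  using finite_sub[of S] by (intro psubset_card_mono) auto

lemma cycle_edges_nonempty: "vs \<noteq> [] \<Longrightarrow> cycle_edges vs \<noteq> {}"
  by (simp add: cycle_edges_conv)

text \<open>Exponent 0 at \<open>a\<close> and \<open>b\<close> serves two purposes: it lets a
  second piece be glued on along its edge \<open>ab\<close>, and it lets the cycle neighbour of
  \<open>a\<close> absorb its edge to \<open>a\<close>.\<close>

theorem near_triangulation_monomial:
  assumes "S \<subseteq> T" "distinct (a # b # rs)" "rs \<noteq> []" "bdry S = cycle_edges (a # b # rs)"
  shows "\<exists>m. has_monom lt (edges S - {{a, b}}) m \<and> lookup m a = 0 \<and> lookup m b = 0 \<and>
      (\<forall>x\<in>set rs. lookup m x \<le> 2) \<and> (\<forall>x. lookup m x \<le> 4)"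
  using assms
proof (induction "card S" arbitrary: S a b rs rule: less_induct)
  case less
  note ST = \<open>S \<subseteq> T\<close> and d = \<open>distinct (a # b # rs)\<close> and ne = \<open>rs \<noteq> []\<close>
    and bdS = \<open>bdry S = cycle_edges (a # b # rs)\<close>
  \<comment> \<open>\<open>v\<close> is the cycle neighbour of \<open>a\<close> other than
    \<open>b\<close>; it is the vertex to be deleted unless it has a chord.\<close>
  define v cs where "v = last rs" and "cs = butlast rs"
  have rs: "rs = cs @ [v]" using ne by (simp add: v_def cs_def)
  define ps where "ps = a # b # cs"
  have bdS': "bdry S = cycle_edges (v # ps)"
    using bdS cycle_edges_rotate[of "a # b # cs" "[v]"] by (simp add: rs ps_def)
  have d': "distinct (v # ps)" using d by (auto simp: rs ps_def)
  show ?case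
  proof (cases "\<exists>y\<in>set ps. {v, y} \<in> edges S \<and> y \<noteq> hd ps \<and> y \<noteq> last ps")
    \<comment> \<open>A chord \<open>vy\<close> cuts the disc. The piece containing
      \<open>ab\<close> keeps it as its distinguished edge, and the other piece uses the chord, so
      that its monomial vanishes at \<open>v\<close> and \<open>y\<close>.\<close>
    case True
    then obtain y where y: "y \<in> set ps" "{v, y} \<in> edges S" "y \<noteq> a" "y \<noteq> last ps"
      by (auto simp: ps_def)
    then have "y \<in> set (b # cs)" by (auto simp: ps_def)
    then obtain p q where pq: "b # cs = p @ y # q" by (meson split_list)
    then have ps: "ps = (a # p) @ y # q" by (simp add: ps_def)
    have q: "q \<noteq> []" using y(4) ps by auto
    obtain r where r: "p @ [y] = b # r" using pq by (cases p) auto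
    have "path_edges (v # [] @ [y]) \<subseteq> edges S" using y(2) by simp
    moreover have "distinct (v # (a # p) @ y # q @ [])" using d' ps by simp
    moreover have "bdry S = cycle_edges (v # (a # p) @ y # q)" using bdS' ps by simp
    ultimately obtain S1 S2 where S12: "S1 \<subseteq> T" "S2 \<subseteq> T"
      "bdry S1 = cycle_edges (v # (a # p) @ y # rev [])"
      "bdry S2 = cycle_edges (y # q @ v # [])" "S1 \<inter> S2 = {}" "S1 \<union> S2 = S"
      "\<Union>S1 \<inter> \<Union>S2 \<subseteq> insert v (insert y (set []))" "edges S1 \<inter> edges S2 \<subseteq> path_edges (v # [] @ [y])"
      using theta_split[OF ST, of v "a # p" y q "[]"] q by (metis list.distinct(1))
    have int: "\<Union>S1 \<inter> \<Union>S2 \<subseteq> {v, y}" "edges S1 \<inter> edges S2 \<subseteq> {{v, y}}" using S12(7,8) by auto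
    have bd1: "bdry S1 = cycle_edges (a # b # r @ [v])"
      using S12(3) cycle_edges_rotate[of "[v]" "a # p @ [y]"] r by simp
    have bd2: "bdry S2 = cycle_edges (v # y # q)"
      using S12(4) cycle_edges_rotate[of "y # q" "[v]"] by simp
    have "S1 \<noteq> {}" "S2 \<noteq> {}"
      using bd1 bd2 bdry_empty cycle_edges_nonempty by (metis list.distinct(1))+
    then have c: "card S1 < card S" "card S2 < card S"
      using psubset_card[of S1 S2 S] psubset_card[of S2 S1 S] S12(5,6) ST by (auto simp: Un_commute Int_commute)
    have d12: "distinct (a # b # r @ [v])" "distinct (v # y # q)"
    proof -
      have "distinct (v # a # (p @ [y]) @ q)" using d' ps by simp
      then have "distinct (v # a # b # r @ q)" unfolding r by simp
      then show "distinct (a # b # r @ [v])" by auto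
      show "distinct (v # y # q)" using d' ps by auto
    qed
    obtain m1 where m1: "has_monom lt (edges S1 - {{a, b}}) m1" "lookup m1 a = 0" "lookup m1 b = 0"
      "\<forall>x\<in>set (r @ [v]). lookup m1 x \<le> 2" "\<forall>x. lookup m1 x \<le> 4"
      using less.hyps[OF c(1) S12(1) d12(1) _ bd1] by blast
    obtain m2 where m2: "has_monom lt (edges S2 - {{v, y}}) m2" "lookup m2 v = 0" "lookup m2 y = 0"
      "\<forall>x\<in>set q. lookup m2 x \<le> 2" "\<forall>x. lookup m2 x \<le> 4"
      using less.hyps[OF c(2) S12(2) d12(2) q bd2] by blast
    have sub1: "edges S1 - {{a, b}} \<subseteq> edges S1" by blast
    note g = glue[OF S12(1,2) int sub1 m1(1) m2(1-3)]
    have "{v, y} \<noteq> {a, b}" using d' by (auto simp: ps_def doubleton_eq_iff)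
    have "v \<notin> {a, b}" using d' by (auto simp: ps_def)
    have "{v, y} \<in> bdry S1"
    proof -
      have "bdry S1 = cycle_edges (v # (a # p @ [y]))" using S12(3) by simp
      then show ?thesis by (simp add: cycle_edges_Cons del: path_edges.simps)
    qed
    then have vy1: "{v, y} \<in> edges S1" using bdry_subset_edges[OF finite_sub[OF S12(1)]] by blast
    have ab1: "{a, b} \<in> edges S1"
    proof -
      have "{a, b} \<in> bdry S1" using bd1 by (simp add: cycle_edges_Cons)
      then show ?thesis using bdry_subset_edges[OF finite_sub[OF S12(1)]] by blast
    qed
    then have "{a, b} \<notin> edges S2" using int(2) \<open>{v, y} \<noteq> {a, b}\<close> by blast
    then have "edges S - {{a, b}} = (edges S1 - {{a, b}}) \<union> (edges S2 - {{v, y}})"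
      using edges_Un[of S1 S2] S12(6) vy1 \<open>{v, y} \<noteq> {a, b}\<close> by blast
    then have "has_monom lt (edges S - {{a, b}}) (m1 + m2)" using g(1) by simp
    moreover have in1: "a \<in> \<Union>S1" "b \<in> \<Union>S1" "set (r @ [v]) \<subseteq> \<Union>S1"
      using cycle_vertices[OF S12(1) bd1] by auto
    moreover have "lookup (m1 + m2) x \<le> 4" for x
      using g(2,3)[of x] m1(5) m2(5) by metis
    moreover have "lookup (m1 + m2) x \<le> 2" if x: "x \<in> set rs" for x
    proof (cases "x \<in> set (r @ [v])")
      case True
      then have "x \<in> \<Union>S1" using in1(3) by blast
      moreover have "lookup m1 x \<le> 2" using m1(4) True by blast
      ultimately show ?thesis using g(2) by simp
    next
      case False
      have "b # cs = b # r @ q" using pq r by simp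
      then have "x \<in> set q" using False x by (auto simp: rs)
      then have "x \<in> \<Union>S2" "x \<notin> {v, y}"
        using cycle_vertices[OF S12(2) bd2] d12(2) by auto
      then have "x \<notin> \<Union>S1" using int(1) by blast
      then show ?thesis using g(3)[of x] m2(4) \<open>x \<in> set q\<close> by auto
    qed
    ultimately show ?thesis
      using g(2)[of a] g(2)[of b] m1(2,3) by (intro exI[of _ "m1 + m2"]) auto
  next
    case False
    then have nochord: "\<And>y. y \<in> set ps \<Longrightarrow> {v, y} \<in> edges S \<Longrightarrow> y = hd ps \<or> y = last ps" by blast
    define S' where "S' = {t \<in> S. v \<notin> t}"
    have len: "2 \<le> length ps" by (simp add: ps_def)
    obtain us where us: "distinct us" "set us \<inter> set (v # ps) = {}"
      "bdry S' = (if 3 \<le> length (ps @ us) then cycle_edges (ps @ us) else {})"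
      "edges S' \<union> star v (insert (hd ps) (insert (last ps) (set us))) \<subseteq> edges S"
      "edges S \<subseteq> edges S' \<union> star v (insert (hd ps) (insert (last ps) (set us))) \<union>
      (if length ps = 2 then {{hd ps, last ps}} else {})" "card S' < card S"
      unfolding S'_def by (rule fan_reduce[OF ST d' len bdS' nochord])
    define c where "c = last ps"
    have S'T: "S' \<subseteq> T" using ST by (auto simp: S'_def)
    have hd: "hd ps = a" by (simp add: ps_def)
    have c: "c \<in> set ps" "a \<noteq> c" "v \<noteq> c" "a \<notin> set us" "c \<notin> set us" "v \<notin> set us" "v \<noteq> a"
      using us(2) d' by (auto simp: c_def ps_def split: if_splits)
    \<comment> \<open>If fewer than three vertices remain on the boundary, \<open>S'\<close> is
      empty and the monomial 0 serves.\<close>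
    obtain m' where m': "has_monom lt (edges S' - {{a, b}}) m'" "lookup m' a = 0" "lookup m' b = 0"
      "\<forall>x\<in>set (cs @ us). lookup m' x \<le> 2" "\<forall>x. lookup m' x \<le> 4"
    proof (cases "3 \<le> length (ps @ us)")
      case True
      then have "cs @ us \<noteq> []" by (auto simp: ps_def)
      moreover have "bdry S' = cycle_edges (a # b # cs @ us)" using us(3) True by (simp add: ps_def)
      moreover have "distinct (a # b # cs @ us)" using us(1,2) d' by (auto simp: ps_def)
      ultimately show thesis using less.hyps[OF us(6) S'T] that by blast
    next
      case False
      then have "S' = {}" using us(3) bdry_eq_empty[OF S'T] by simp
      then show thesis using that[of 0] has_monom_empty[of lt] by (simp add: edges_def)
    qed
    have "{a, b} \<notin> star v (insert a (insert c (set us)))"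
      using d' by (auto simp: star_def ps_def doubleton_eq_iff)
    \<comment> \<open>The one edge that may be lost together with \<open>v\<close> is
      \<open>ab\<close>, which is left out of the polynomial anyway.\<close>
    moreover have "(if length ps = 2 then {{hd ps, last ps}} else {}) \<subseteq> {{a, b}}"
      by (auto simp: ps_def split: if_splits)
    ultimately have eq: "edges S - {{a, b}} = (edges S' - {{a, b}}) \<union> star v (insert a (insert c (set us)))"
      using us(4,5) unfolding hd c_def[symmetric] by blast
    have sub: "edges S' - {{a, b}} \<subseteq> edges T" "edges S - {{a, b}} \<subseteq> edges T" using edges_mono S'T ST by blast+
    have "v \<notin> \<Union>(edges S' - {{a, b}})"
      using Union_edges[OF S'T] by (auto simp: S'_def)
    note star_facts = finite_set edge_set(1)[OF sub(1)] edge_set(3)[OF sub(1)] c(6) this c(7,3) c(2,4,5)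
      m'(1,2) edge_set(2)[OF sub(2), unfolded eq]
    \<comment> \<open>Here \<open>a\<close> and \<open>c\<close> take the roles of \<open>a\<close>
      and \<open>b\<close> in \<open>has_monom_star\<close>: \<open>c\<close> may already have
      exponent 2 and must not grow, and the exponent 0 of \<open>a\<close> lets \<open>v\<close>
      absorb the edge to \<open>a\<close>.\<close>
    obtain m where m: "has_monom lt (edges S - {{a, b}}) m" "lookup m v \<le> 2"
      "\<And>x. x \<noteq> v \<Longrightarrow> x \<notin> set us \<Longrightarrow> lookup m x \<le> lookup m' x"
      "\<And>u. u \<in> set us \<Longrightarrow> lookup m u \<le> lookup m' u + 2"
      unfolding eq
      by (rule has_monom_star[OF star_facts]) blast
    have "b \<notin> set us" "b \<noteq> v" "set cs \<inter> set us = {}" "v \<notin> set cs" using us(2) d' by (auto simp: ps_def)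
    then have "lookup m b = 0" "lookup m a = 0"
      using m(3)[of b] m(3)[of a] m' c by auto
    moreover have "lookup m x \<le> 2" if "x \<in> set rs" for x
    proof (cases "x = v")
      case False
      then have "x \<in> set cs" using that by (simp add: rs)
      then have "lookup m x \<le> lookup m' x" "lookup m' x \<le> 2"
        using m(3)[of x] m'(4) \<open>set cs \<inter> set us = {}\<close> False by auto
      then show ?thesis by simp
    qed (use m(2) in simp)
    moreover have "lookup m x \<le> 4" for x
    proof -
      consider "x = v" | "x \<in> set us" | "x \<noteq> v" "x \<notin> set us" by blast
      then show ?thesis
        using m(2) m(3)[of x] m(4)[of x] m'(4,5) by cases (fastforce intro: le_trans)+
    qed
    ultimately show ?thesis using m(1) by blast
  qed
qed

text \<open>Meant for a later outer vertex \<open>v\<close>, when \<open>rs\<close> are the original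
  outer vertices still present and \<open>qs\<close> are interior vertices uncovered before. Chords
  from \<open>v\<close> to \<open>qs\<close> may exist: the part behind the last one is handled by
  the engine, and in the rest every edge at \<open>v\<close> except the one to
  \<open>last rs\<close> is charged to its other end. That edge is omitted since it belongs to the
  original cycle, and \<open>F\<close> stands for the original cycle edges that are still present
  and must be left out too.\<close>

lemma reduction:
  assumes ST: "S \<subseteq> T" and d: "distinct (v # qs @ rs)" and ne: "qs \<noteq> []" "2 \<le> length rs"
    and bdS: "bdry S = cycle_edges (v # qs @ rs)"
    and chord: "\<And>y. y \<in> set rs \<Longrightarrow> {v, y} \<in> edges S \<Longrightarrow> y = last rs"
  obtains z q1 q2 xs S' where "qs = q1 @ z # q2" "{v, z} \<in> edges S" "distinct (z # q2 @ rs @ xs)"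
    "set xs \<inter> set (v # qs @ rs) = {}" "S' \<subseteq> S" "bdry S' = cycle_edges (z # q2 @ rs @ xs)"
    "v \<notin> \<Union>S'" "set q1 \<inter> \<Union>S' = {}"
    "\<And>F m. F \<subseteq> edges S' \<Longrightarrow> has_monom lt (edges S' - F) m \<Longrightarrow>
      \<exists>m'. has_monom lt (edges S - F - {{v, last rs}}) m' \<and> lookup m' v = 0 \<and>
        (\<forall>x\<in>\<Union>S'. lookup m' x = lookup m x + (if x \<in> insert z (set xs) then 1 else 0)) \<and>
        (\<forall>x\<in>set q1. lookup m' x \<le> 2) \<and> (\<forall>x. x \<notin> \<Union>S' \<longrightarrow> lookup m' x \<le> 4)"
proof -
  have rs: "rs \<noteq> []" using ne by auto
  have "{v, hd qs} \<in> bdry S" unfolding bdS using ne by (simp add: cycle_edges_Cons)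
  then have "{v, hd qs} \<in> edges S" using bdry_subset_edges[OF finite_sub[OF ST]] by blast
  then have "\<exists>z\<in>set qs. {v, z} \<in> edges S" using ne(1) hd_in_set by blast
  \<comment> \<open>Choosing the last neighbour in \<open>qs\<close> leaves no chord at
    \<open>v\<close> beyond \<open>vz\<close>; the vertices in \<open>q1\<close> are cut
    off.\<close>
  then obtain q1 z q2 where q: "qs = q1 @ z # q2" and vz: "{v, z} \<in> edges S"
    and q2: "\<forall>y\<in>set q2. {v, y} \<notin> edges S"
    using split_list_last_prop[of qs "\<lambda>z. {v, z} \<in> edges S"] by blast
  have "\<exists>S1 S2 m1. S1 \<subseteq> T \<and> S2 \<subseteq> T \<and> S1 \<union> S2 = S \<and> \<Union>S2 \<inter> \<Union>S1 \<subseteq> {v, z} \<and> edges S2 \<inter> edges S1 \<subseteq> {{v, z}} \<and>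
      bdry S2 = cycle_edges (v # z # q2 @ rs) \<and> has_monom lt (edges S1 - {{v, z}}) m1 \<and> lookup m1 v = 0 \<and>
      lookup m1 z = 0 \<and> (\<forall>x\<in>set q1. lookup m1 x \<le> 2) \<and> (\<forall>x. lookup m1 x \<le> 4) \<and> set q1 \<subseteq> \<Union>S1"
  proof (cases "q1 = []")
    case True
    then show ?thesis
      using ST bdS has_monom_empty[of lt] q by (intro exI[of _ "{}"] exI[of _ S] exI[of _ 0]) (auto simp: edges_def)
  next
    case False
    have "distinct (v # q1 @ z # (q2 @ rs) @ [])" using d q by simp
    moreover have "bdry S = cycle_edges (v # q1 @ z # (q2 @ rs))" using bdS q by simp
    moreover have "path_edges (v # [] @ [z]) \<subseteq> edges S" using vz by simp
    moreover have "q2 @ rs \<noteq> []" using rs by simp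
    ultimately obtain S1 S2 where S12: "S1 \<subseteq> T" "S2 \<subseteq> T"
      "bdry S1 = cycle_edges (v # q1 @ z # rev [])"
      "bdry S2 = cycle_edges (z # (q2 @ rs) @ v # [])" "S1 \<inter> S2 = {}" "S1 \<union> S2 = S"
      "\<Union>S1 \<inter> \<Union>S2 \<subseteq> insert v (insert z (set []))" "edges S1 \<inter> edges S2 \<subseteq> path_edges (v # [] @ [z])"
      using theta_split[OF ST, of v q1 z "q2 @ rs" "[]"] False by metis
    have bd1: "bdry S1 = cycle_edges (z # v # q1)"
      using S12(3) cycle_edges_rotate[of "v # q1" "[z]"] by simp
    have bd2: "bdry S2 = cycle_edges (v # z # q2 @ rs)"
      using S12(4) cycle_edges_rotate[of "z # q2 @ rs" "[v]"] by simp
    have "distinct (z # v # q1)" using d q by auto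
    then obtain m1 where "has_monom lt (edges S1 - {{z, v}}) m1" "lookup m1 z = 0" "lookup m1 v = 0"
      "\<forall>x\<in>set q1. lookup m1 x \<le> 2" "\<forall>x. lookup m1 x \<le> 4"
      using near_triangulation_monomial[OF S12(1) _ False bd1] by blast
    moreover have "set q1 \<subseteq> \<Union>S1" using cycle_vertices[OF S12(1) bd1] by simp
    moreover have "\<Union>S2 \<inter> \<Union>S1 \<subseteq> {v, z}" "edges S2 \<inter> edges S1 \<subseteq> {{v, z}}" using S12(7,8) by auto
    ultimately show ?thesis
      using S12(1,2,6) bd2 by (intro exI[of _ S1] exI[of _ S2] exI[of _ m1]) (simp add: insert_commute)
  qed
  then obtain S1 S2 m1 where S12: "S1 \<subseteq> T" "S2 \<subseteq> T" "S1 \<union> S2 = S" "\<Union>S2 \<inter> \<Union>S1 \<subseteq> {v, z}"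
      "edges S2 \<inter> edges S1 \<subseteq> {{v, z}}" "bdry S2 = cycle_edges (v # z # q2 @ rs)"
    and m1: "has_monom lt (edges S1 - {{v, z}}) m1" "lookup m1 v = 0" "lookup m1 z = 0"
      "\<forall>x\<in>set q1. lookup m1 x \<le> 2" "\<forall>x. lookup m1 x \<le> 4" and q1: "set q1 \<subseteq> \<Union>S1"
    by (elim exE conjE) (rule that; assumption)
  define ps where "ps = z # q2 @ rs"
  have bd2: "bdry S2 = cycle_edges (v # ps)" using S12(6) by (simp add: ps_def)
  have d2: "distinct (v # ps)" using d q by (auto simp: ps_def)
  have len: "2 \<le> length ps" "length ps \<noteq> 2" using ne(2) by (auto simp: ps_def)
  have hl: "hd ps = z" "last ps = last rs" using rs by (auto simp: ps_def)
  have S2S: "edges S2 \<subseteq> edges S" using S12(3) edges_mono by blast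
  have nochord: "y = hd ps \<or> y = last ps" if "y \<in> set ps" "{v, y} \<in> edges S2" for y
    using that q2 chord[of y] S2S unfolding hl by (auto simp: ps_def)
  define S' where "S' = {t \<in> S2. v \<notin> t}"
  obtain xs where xs: "distinct xs" "set xs \<inter> set (v # ps) = {}"
    "bdry S' = (if 3 \<le> length (ps @ xs) then cycle_edges (ps @ xs) else {})"
    "edges S' \<union> star v (insert (hd ps) (insert (last ps) (set xs))) \<subseteq> edges S2"
    "edges S2 \<subseteq> edges S' \<union> star v (insert (hd ps) (insert (last ps) (set xs))) \<union>
      (if length ps = 2 then {{hd ps, last ps}} else {})"
    unfolding S'_def by (rule fan_reduce[OF S12(2) d2 len(1) bd2 nochord])
  let ?w = "last rs" and ?U = "insert z (set xs)"
  have S': "S' \<subseteq> S2" "S' \<subseteq> T" using S12(2) by (auto simp: S'_def)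
  have vS': "v \<notin> \<Union>S'" by (auto simp: S'_def)
  have es2: "edges S2 = edges S' \<union> star v (insert ?w ?U)"
    using xs(4,5) len(2) unfolding hl by (auto simp: insert_commute)
  have wU: "?w \<notin> ?U" "v \<notin> ?U"
    using xs(2) d2 rs by (auto simp: ps_def dest: last_in_set)
  have xs2: "set xs \<subseteq> \<Union>S2"
  proof
    fix x assume "x \<in> set xs"
    then have "{v, x} \<in> edges S2" unfolding es2 by (auto simp: star_def)
    then show "x \<in> \<Union>S2" using Union_edges[OF S12(2)] by blast
  qed
  have q12: "x \<notin> \<Union>S2" if "x \<in> set q1" for x
  proof -
    have "x \<notin> {v, z}" using that d q by auto
    then show ?thesis using that q1 S12(4) by blast
  qed
  have vw1: "{v, ?w} \<notin> edges S1"
  proof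
    assume "{v, ?w} \<in> edges S1"
    moreover have "{v, ?w} \<in> edges S2" unfolding es2 by simp
    ultimately have "{v, ?w} = {v, z}" using S12(5) by blast
    then show False using wU by (auto simp: doubleton_eq_iff)
  qed
  have vS'e: "{v, x} \<notin> edges S'" for x using Union_edges[OF S'(2)] vS' by blast
  show thesis
  proof (rule that[OF q vz, of xs S'])
    show "distinct (z # q2 @ rs @ xs)" using xs(1,2) d2 by (auto simp: ps_def)
    show "set xs \<inter> set (v # qs @ rs) = {}"
      using xs(2) xs2 q12 q by (auto simp: ps_def)
    show "S' \<subseteq> S" using S'(1) S12(3) by blast
    show "bdry S' = cycle_edges (z # q2 @ rs @ xs)" using xs(3) len by (simp add: ps_def)
    show "v \<notin> \<Union>S'" by (rule vS')
    show "set q1 \<inter> \<Union>S' = {}" using q12 S'(1) by blast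
    fix F m assume F: "F \<subseteq> edges S'" and m: "has_monom lt (edges S' - F) m"
    define F1 where "F1 = (edges S' - F) \<union> star v ?U"
    let ?n = "m + (\<Sum>u\<in>?U. X u)"
    have F1: "F1 \<subseteq> edges S2" using es2 unfolding F1_def star_def by blast
    then have F1T: "F1 \<subseteq> edges T" using edges_mono[OF S12(2)] by blast
    have sub: "edges S' - F \<subseteq> edges S'" by blast
    have m0: "lookup m x = 0" if "x \<notin> \<Union>S'" for x
      using has_monom_off_vertices[OF S'(2) sub m that] .
    have nv: "v \<notin> \<Union>(edges S' - F)" using Union_edges[OF S'(2)] vS' by blast
    have nz1: "has_monom lt F1 ?n"
      unfolding F1_def
    proof (rule has_monom_star_zero[OF _ _ wU(2) nv m m0[OF vS']])
      show "finite (edges S' - F)" using edge_set(1)[OF F1T] by (simp add: F1_def)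
      show "orientation (edges S' - F \<union> star v ?U) lt" using edge_set(2)[OF F1T] by (simp add: F1_def)
    qed simp
    have ln: "lookup ?n x = lookup m x + (if x \<in> ?U then 1 else 0)" for x
      using lookup_sum_X[of ?U x] by (simp add: lookup_add)
    note g = glue[OF S12(2,1,4,5) F1 nz1 m1(1-3)]
    have "edges S - F - {{v, ?w}} = F1 \<union> (edges S1 - {{v, z}})"
    proof -
      have "F \<inter> edges S1 \<subseteq> {{v, z}}" using F es2 S12(5) by blast
      then have FS1: "F \<inter> edges S1 = {}" using F vS'e by blast
      have Fst: "F \<inter> star v ?U = {}" using F vS'e unfolding star_def by blast
      have "{v, ?w} \<notin> star v ?U" using edge_in_star_iff[OF wU(2)] wU(1) by blast
      moreover have "{v, z} \<in> star v ?U" by simp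
      moreover have "edges S = edges S1 \<union> edges S' \<union> insert {v, ?w} (star v ?U)"
        using S12(3) edges_Un[of S1 S2] es2 by auto
      ultimately show ?thesis
        using FS1 Fst vw1 vS'e[of ?w] unfolding F1_def by blast
    qed
    then have "has_monom lt (edges S - F - {{v, ?w}}) (?n + m1)" using g(1) by simp
    moreover have "v \<in> \<Union>S2" using cycle_vertices[OF S12(2) bd2] by auto
    then have "lookup (?n + m1) v = 0" using g(2)[of v] ln[of v] wU(2) m0[OF vS'] by simp
    moreover have "lookup (?n + m1) x = lookup m x + (if x \<in> ?U then 1 else 0)" if "x \<in> \<Union>S'" for x
    proof -
      have "x \<in> \<Union>S2" using that S'(1) by blast
      then show ?thesis using g(2) ln by simp
    qed
    moreover have "lookup (?n + m1) x \<le> 2" if "x \<in> set q1" for x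
      using g(3)[OF q12[OF that]] m1(4) that by simp
    moreover have "lookup (?n + m1) x \<le> 4" if "x \<notin> \<Union>S'" for x
      using g(2,3)[of x] ln[of x] m0[OF that] m1(5) by (cases "x \<in> \<Union>S2") auto
    ultimately show "\<exists>m'. has_monom lt (edges S - F - {{v, ?w}}) m' \<and> lookup m' v = 0 \<and>
        (\<forall>x\<in>\<Union>S'. lookup m' x = lookup m x + (if x \<in> ?U then 1 else 0)) \<and>
        (\<forall>x\<in>set q1. lookup m' x \<le> 2) \<and> (\<forall>x. x \<notin> \<Union>S' \<longrightarrow> lookup m' x \<le> 4)"
      by (intro exI[of _ "?n + m1"] conjI ballI allI impI)
  qed
qed

text \<open>The first deleted vertex has no chords, so its edges off the cycle go to the interior
  vertices \<open>us\<close> and each of these gains one unit. This is why they may have exponent at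
  most 3 beforehand.\<close>

lemma remove_first:
  assumes bdT: "bdry T = cycle_edges (v # ps)" and d: "distinct (v # ps)" and len: "2 \<le> length ps"
    and chordless: "chordless (edges T) (v # ps)"
  obtains us S' where "distinct us" "set us \<inter> set (v # ps) = {}" "S' \<subseteq> T" "v \<notin> \<Union>S'"
    "bdry S' = (if 3 \<le> length (ps @ us) then cycle_edges (ps @ us) else {})"
    "\<And>u. u \<in> set us \<Longrightarrow> {v, u} \<in> edges T"
    "\<And>m. has_monom lt (edges S' - path_edges ps) m \<Longrightarrow> \<forall>x\<in>set ps. lookup m x = 0 \<Longrightarrow>
      \<forall>u\<in>set us. lookup m u \<le> 3 \<Longrightarrow> \<forall>x. lookup m x \<le> 4 \<Longrightarrow>
      \<exists>\<beta>. has_monom lt (edges T - cycle_edges (v # ps)) \<beta> \<and> (\<forall>x\<in>set (v # ps). lookup \<beta> x = 0) \<and>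
        (\<forall>x. lookup \<beta> x \<le> 4)"
proof -
  have ne: "ps \<noteq> []" using len by auto
  have ce: "cycle_edges (v # ps) = insert {v, hd ps} (insert {v, last ps} (path_edges ps))"
    using ne by (simp add: cycle_edges_Cons)
  have vp: "{v, y} \<notin> path_edges ps" for y
    using path_edges_subset[of "{v, y}" ps] d by auto
  have nochord: "y = hd ps \<or> y = last ps" if "y \<in> set ps" "{v, y} \<in> edges T" for y
  proof -
    have "{v, y} \<in> cycle_edges (v # ps)" using chordless that by (auto simp: chordless_def)
    then show ?thesis using vp[of y] by (auto simp: ce doubleton_eq_iff)
  qed
  define S' where "S' = {t \<in> T. v \<notin> t}"
  obtain us where us: "distinct us" "set us \<inter> set (v # ps) = {}"
    "bdry S' = (if 3 \<le> length (ps @ us) then cycle_edges (ps @ us) else {})"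
    "edges S' \<union> star v (insert (hd ps) (insert (last ps) (set us))) \<subseteq> edges T"
    "edges T \<subseteq> edges S' \<union> star v (insert (hd ps) (insert (last ps) (set us))) \<union>
      (if length ps = 2 then {{hd ps, last ps}} else {})"
    unfolding S'_def by (rule fan_reduce[OF subset_refl d len bdT nochord])
  have S'T: "S' \<subseteq> T" and vS': "v \<notin> \<Union>S'" by (auto simp: S'_def)
  have vS'e: "{v, x} \<notin> edges S'" for x using Union_edges[OF S'T] vS' by blast
  have v_us: "v \<notin> set us" using us(2) by auto
  have st: "star v (set us) \<inter> cycle_edges (v # ps) = {}"
  proof -
    have "{v, u} \<notin> cycle_edges (v # ps)" if "u \<in> set us" for u
      using that vp[of u] us(2) ne hd_in_set[OF ne] last_in_set[OF ne] by (auto simp: ce doubleton_eq_iff)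
    then show ?thesis by (auto simp: star_def)
  qed
  have "(if length ps = 2 then {{hd ps, last ps}} else {}) \<subseteq> path_edges ps"
    by (auto simp: numeral_2_eq_2 length_Suc_conv)
  then have eq: "edges T - cycle_edges (v # ps) = (edges S' - path_edges ps) \<union> star v (set us)"
    using us(4,5) st vS'e unfolding ce by auto
  show thesis
  proof (rule that[OF us(1,2) S'T vS' us(3)])
    show "{v, u} \<in> edges T" if "u \<in> set us" for u
      using us(4) that by (auto simp: star_def)
    fix m assume m: "has_monom lt (edges S' - path_edges ps) m" "\<forall>x\<in>set ps. lookup m x = 0"
      "\<forall>u\<in>set us. lookup m u \<le> 3" "\<forall>x. lookup m x \<le> 4"
    have sub: "edges S' - path_edges ps \<subseteq> edges S'" by blast
    have mv: "lookup m v = 0" by (rule has_monom_off_vertices[OF S'T sub m(1) vS'])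
    have sT: "edges T - cycle_edges (v # ps) \<subseteq> edges T" by blast
    have "has_monom lt (edges T - cycle_edges (v # ps)) (m + (\<Sum>u\<in>set us. X u))"
      unfolding eq
    proof (rule has_monom_star_zero[OF _ _ v_us _ m(1) mv])
      show "v \<notin> \<Union>(edges S' - path_edges ps)" using Union_edges[OF S'T] vS' by blast
      show "finite (edges S' - path_edges ps)" using edge_set(1)[OF sT] unfolding eq by simp
      show "orientation (edges S' - path_edges ps \<union> star v (set us)) lt" using edge_set(2)[OF sT] unfolding eq .
    qed simp
    then show "\<exists>\<beta>. has_monom lt (edges T - cycle_edges (v # ps)) \<beta> \<and> (\<forall>x\<in>set (v # ps). lookup \<beta> x = 0) \<and>
        (\<forall>x. lookup \<beta> x \<le> 4)"
      using m(2-4) mv v_us us(2)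
      by (intro exI[of _ "m + (\<Sum>u\<in>set us. X u)"]) (fastforce simp: lookup_add lookup_sum_X)
  qed
qed

section \<open>Outer cycles of length three, four and five\<close>

definition interior_monomial :: "'v list \<Rightarrow> bool" where
  "interior_monomial vs \<longleftrightarrow> (\<exists>\<beta>. has_monom lt (edges T - cycle_edges vs) \<beta> \<and> (\<forall>x\<in>set vs. lookup \<beta> x = 0) \<and>
    (\<forall>x. lookup \<beta> x \<le> 4))"

lemma interior_monomial_3:
  assumes "bdry T = cycle_edges [v, a, b]" "distinct [v, a, b]" "chordless (edges T) [v, a, b]"
  shows "interior_monomial [v, a, b]"
proof -
  obtain us S' where us: "distinct us" "set us \<inter> set [v, a, b] = {}" "S' \<subseteq> T" "v \<notin> \<Union>S'"
    "bdry S' = (if 3 \<le> length ([a, b] @ us) then cycle_edges ([a, b] @ us) else {})"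
    and step: "\<And>m. has_monom lt (edges S' - path_edges [a, b]) m \<Longrightarrow> \<forall>x\<in>set [a, b]. lookup m x = 0 \<Longrightarrow>
      \<forall>u\<in>set us. lookup m u \<le> 3 \<Longrightarrow> \<forall>x. lookup m x \<le> 4 \<Longrightarrow>
      \<exists>\<beta>. has_monom lt (edges T - cycle_edges [v, a, b]) \<beta> \<and> (\<forall>x\<in>set [v, a, b]. lookup \<beta> x = 0) \<and>
        (\<forall>x. lookup \<beta> x \<le> 4)"
    by (rule remove_first[OF assms(1,2) _ assms(3)]) auto
  show ?thesis
  proof (cases "us = []")
    case True
    then have "S' = {}" using us(3,5) bdry_eq_empty by simp
    then show ?thesis
      using step[of 0] has_monom_empty[of lt] unfolding interior_monomial_def by (simp add: edges_def)
  next
    case False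
    then have "bdry S' = cycle_edges (a # b # us)" using us(5) by (cases us) auto
    moreover have "distinct (a # b # us)" using us(1,2) assms(2) by auto
    ultimately obtain m where m: "has_monom lt (edges S' - {{a, b}}) m" "lookup m a = 0" "lookup m b = 0"
      "\<forall>x\<in>set us. lookup m x \<le> 2" "\<forall>x. lookup m x \<le> 4"
      using near_triangulation_monomial[OF us(3) _ False] by blast
    have "\<forall>x\<in>set us. lookup m x \<le> 3" using m(4) by (auto intro: le_trans)
    then show ?thesis
      using step[of m] m unfolding interior_monomial_def by simp
  qed
qed

text \<open>If \<open>v\<close> had no interior neighbour, its two cycle neighbours would be joined
  by an edge, a chord of the outer cycle.\<close>

lemma no_chord_fan_nonempty:
  assumes "bdry S' = (if 3 \<le> length (ps @ us) then cycle_edges (ps @ us) else {})" "S' \<subseteq> T"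
    and "3 \<le> length ps" "distinct (v # ps)" "chordless (edges T) (v # ps)"
  shows "us \<noteq> []"
proof
  assume "us = []"
  have ne: "ps \<noteq> []" using assms(3) by auto
  have "{last ps, hd ps} \<in> bdry S'"
    using assms(1,3) \<open>us = []\<close> ne by (simp add: cycle_edges_conv)
  then have "{hd ps, last ps} \<in> edges T"
    using bdry_subset_edges[OF finite_sub[OF assms(2)]] edges_mono[OF assms(2)] by (auto simp: insert_commute)
  then have "{hd ps, last ps} \<in> cycle_edges (v # ps)"
    using assms(5) hd_in_set[OF ne] last_in_set[OF ne] unfolding chordless_def by auto
  moreover have "v \<notin> {hd ps, last ps}"
    using assms(4) hd_in_set[OF ne] last_in_set[OF ne] by auto
  ultimately have "{hd ps, last ps} \<in> path_edges ps"
    using ne by (auto simp: cycle_edges_Cons)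
  then show False using hd_last_notin_path_edges[of ps] assms(3,4) by auto
qed

lemma chordless_rotate: "chordless E (xs @ ys) \<longleftrightarrow> chordless E (ys @ xs)"
  by (simp add: chordless_def cycle_edges_rotate[of xs ys] Un_commute)

lemma chordlessD:
  "chordless E vs \<Longrightarrow> u \<in> set vs \<Longrightarrow> v \<in> set vs \<Longrightarrow> {u, v} \<notin> cycle_edges vs \<Longrightarrow> {u, v} \<notin> E"
  by (auto simp: chordless_def)

text \<open>Delete \<open>v\<close>, then \<open>c\<close>, and apply the engine to the edge
  \<open>ab\<close>. A vertex uncovered on the way starts with at most 2 and gains at most one unit
  from each of the two.\<close>

lemma interior_monomial_4:
  assumes bdT: "bdry T = cycle_edges [v, a, b, c]" and d: "distinct [v, a, b, c]"
    and ch: "chordless (edges T) [v, a, b, c]"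
  shows "interior_monomial [v, a, b, c]"
proof -
  obtain us S' where us: "distinct us" "set us \<inter> set [v, a, b, c] = {}" and S': "S' \<subseteq> T" "v \<notin> \<Union>S'"
    and bdS': "bdry S' = (if 3 \<le> length ([a, b, c] @ us) then cycle_edges ([a, b, c] @ us) else {})"
    and step: "\<And>m. has_monom lt (edges S' - path_edges [a, b, c]) m \<Longrightarrow> \<forall>x\<in>set [a, b, c]. lookup m x = 0 \<Longrightarrow>
      \<forall>u\<in>set us. lookup m u \<le> 3 \<Longrightarrow> \<forall>x. lookup m x \<le> 4 \<Longrightarrow>
      \<exists>\<beta>. has_monom lt (edges T - cycle_edges [v, a, b, c]) \<beta> \<and> (\<forall>x\<in>set [v, a, b, c]. lookup \<beta> x = 0) \<and>
        (\<forall>x. lookup \<beta> x \<le> 4)"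
    by (rule remove_first[OF bdT d _ ch]) auto
  have ne: "us \<noteq> []" using no_chord_fan_nonempty[OF bdS' S'(1) _ d ch] by simp
  have bd1: "bdry S' = cycle_edges (c # us @ [a, b])"
    using bdS' cycle_edges_rotate[of "[a, b]" "c # us"] by simp
  have "{c, a} \<notin> cycle_edges [v, a, b, c]"
    using d by (auto simp: cycle_edges_conv doubleton_eq_iff)
  then have "{c, a} \<notin> edges T" using chordlessD[OF ch] by auto
  then have nch: "y = last [a, b]" if "y \<in> set [a, b]" "{c, y} \<in> edges S'" for y
    using that edges_mono[OF S'(1)] by auto
  have d1: "distinct (c # us @ [a, b])" using us d by auto
  obtain z q1 q2 xs S2 where R: "us = q1 @ z # q2" "{c, z} \<in> edges S'" "distinct (z # q2 @ [a, b] @ xs)"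
    "set xs \<inter> set (c # us @ [a, b]) = {}" "S2 \<subseteq> S'" "bdry S2 = cycle_edges (z # q2 @ [a, b] @ xs)"
    "c \<notin> \<Union>S2" "set q1 \<inter> \<Union>S2 = {}"
    and ext: "\<And>F m. F \<subseteq> edges S2 \<Longrightarrow> has_monom lt (edges S2 - F) m \<Longrightarrow>
      \<exists>m'. has_monom lt (edges S' - F - {{c, last [a, b]}}) m' \<and> lookup m' c = 0 \<and>
        (\<forall>x\<in>\<Union>S2. lookup m' x = lookup m x + (if x \<in> insert z (set xs) then 1 else 0)) \<and>
        (\<forall>x\<in>set q1. lookup m' x \<le> 2) \<and> (\<forall>x. x \<notin> \<Union>S2 \<longrightarrow> lookup m' x \<le> 4)"
    by (rule reduction[OF S'(1) d1 ne _ bd1 nch]) auto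
  have S2: "S2 \<subseteq> T" using R(5) S'(1) by blast
  have bd2: "bdry S2 = cycle_edges (a # b # xs @ z # q2)"
    using R(6) cycle_edges_rotate[of "z # q2" "[a, b] @ xs"] by simp
  have d2: "distinct (a # b # xs @ z # q2)" using R(3) by auto
  obtain m where m: "has_monom lt (edges S2 - {{a, b}}) m" "lookup m a = 0" "lookup m b = 0"
      "\<forall>x\<in>set (xs @ z # q2). lookup m x \<le> 2" "\<forall>x. lookup m x \<le> 4"
    using near_triangulation_monomial[OF S2 d2 _ bd2] by blast
  have "{a, b} \<in> bdry S2" unfolding bd2 by (simp add: cycle_edges_Cons)
  then have "{{a, b}} \<subseteq> edges S2" using bdry_subset_edges[OF finite_sub[OF S2]] by blast
  from ext[OF this m(1)] obtain m' where m': "has_monom lt (edges S' - {{a, b}} - {{c, b}}) m'" "lookup m' c = 0"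
    "\<And>x. x \<in> \<Union>S2 \<Longrightarrow> lookup m' x = lookup m x + (if x \<in> insert z (set xs) then 1 else 0)"
    "\<And>x. x \<in> set q1 \<Longrightarrow> lookup m' x \<le> 2" "\<And>x. x \<notin> \<Union>S2 \<Longrightarrow> lookup m' x \<le> 4"
    by auto
  have in2: "set (a # b # xs @ z # q2) \<subseteq> \<Union>S2" by (rule cycle_vertices[OF S2 bd2])
  have "edges S' - {{a, b}} - {{c, b}} = edges S' - path_edges [a, b, c]"
    by (auto simp: insert_commute)
  then have "has_monom lt (edges S' - path_edges [a, b, c]) m'" using m'(1) by simp
  moreover have "\<forall>x\<in>set [a, b, c]. lookup m' x = 0"
    using m'(2) m'(3)[of a] m'(3)[of b] in2 m(2,3) d2 by auto
  moreover have "\<forall>u\<in>set us. lookup m' u \<le> 3"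
  proof
    fix u assume "u \<in> set us"
    then consider "u \<in> set q1" | "u \<in> set (z # q2)" using R(1) by auto
    then show "lookup m' u \<le> 3"
    proof cases
      case 1
      then show ?thesis using m'(4)[of u] by simp
    next
      case 2
      then have "lookup m u \<le> 2" "u \<in> \<Union>S2" using m(4) in2 by auto
      then show ?thesis using m'(3)[of u] by simp
    qed
  qed
  moreover have "\<forall>x. lookup m' x \<le> 4"
  proof
    fix x
    have "x \<in> insert z (set xs) \<Longrightarrow> lookup m x \<le> 2" using m(4) by auto
    moreover have "lookup m x \<le> 4" using m(5) by blast
    ultimately show "lookup m' x \<le> 4"
    proof (cases "x \<in> \<Union>S2")
      case True
      with \<open>x \<in> insert z (set xs) \<Longrightarrow> lookup m x \<le> 2\<close> show ?thesis
        using m'(3)[OF True] \<open>lookup m x \<le> 4\<close> by (cases "x \<in> insert z (set xs)") simp_all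
    qed (rule m'(5))
  qed
  ultimately show ?thesis using step[of m'] unfolding interior_monomial_def by blast
qed

text \<open>Delete \<open>v\<close>, \<open>d\<close> and \<open>c\<close> in this order. Among the
  neighbours \<open>us\<close> of \<open>v\<close>, only \<open>z\<close> gains from
  \<open>d\<close> and still lies on the remaining cycle, and among the vertices of that cycle only
  \<open>z'\<close> both gains from \<open>c\<close> and survives its deletion. Since
  \<open>no3\<close> forbids a common neighbour of all three, \<open>z\<close> and \<open>z'\<close>
  differ and no vertex collects three units on top of 2.\<close>

lemma interior_monomial_5_aux:
  assumes bdT: "bdry T = cycle_edges [v, a, b, c, d]" and dist: "distinct [v, a, b, c, d]"
    and ch: "chordless (edges T) [v, a, b, c, d]"
    and no3: "\<And>y. y \<notin> {v, a, b, c, d} \<Longrightarrow> {v, y} \<in> edges T \<Longrightarrow> {d, y} \<in> edges T \<Longrightarrow> {c, y} \<in> edges T \<Longrightarrow> False"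
  shows "interior_monomial [v, a, b, c, d]"
proof -
  obtain us S' where us: "distinct us" "set us \<inter> set [v, a, b, c, d] = {}" and S': "S' \<subseteq> T" "v \<notin> \<Union>S'"
    and bdS': "bdry S' = (if 3 \<le> length ([a, b, c, d] @ us) then cycle_edges ([a, b, c, d] @ us) else {})"
    and vus: "\<And>u. u \<in> set us \<Longrightarrow> {v, u} \<in> edges T"
    and step: "\<And>m. has_monom lt (edges S' - path_edges [a, b, c, d]) m \<Longrightarrow> \<forall>x\<in>set [a, b, c, d]. lookup m x = 0 \<Longrightarrow>
      \<forall>u\<in>set us. lookup m u \<le> 3 \<Longrightarrow> \<forall>x. lookup m x \<le> 4 \<Longrightarrow>
      \<exists>\<beta>. has_monom lt (edges T - cycle_edges [v, a, b, c, d]) \<beta> \<and> (\<forall>x\<in>set [v, a, b, c, d]. lookup \<beta> x = 0) \<and>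
        (\<forall>x. lookup \<beta> x \<le> 4)"
    by (rule remove_first[OF bdT dist _ ch]) auto
  have ne: "us \<noteq> []" using no_chord_fan_nonempty[OF bdS' S'(1) _ dist ch] by simp
  have bd1: "bdry S' = cycle_edges (d # us @ [a, b, c])"
    using bdS' cycle_edges_rotate[of "[a, b, c]" "d # us"] by simp
  have "{d, a} \<notin> cycle_edges [v, a, b, c, d]" "{d, b} \<notin> cycle_edges [v, a, b, c, d]"
      "{c, a} \<notin> cycle_edges [v, a, b, c, d]"
    using dist by (auto simp: cycle_edges_conv doubleton_eq_iff)
  then have nonadj: "{d, a} \<notin> edges T" "{d, b} \<notin> edges T" "{c, a} \<notin> edges T" using chordlessD[OF ch] by auto
  have nch: "y = last [a, b, c]" if "y \<in> set [a, b, c]" "{d, y} \<in> edges S'" for y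
    using that edges_mono[OF S'(1)] nonadj by auto
  have d1: "distinct (d # us @ [a, b, c])" using us dist by auto
  obtain z q1 q2 xs S1 where R: "us = q1 @ z # q2" "{d, z} \<in> edges S'" "distinct (z # q2 @ [a, b, c] @ xs)"
    "set xs \<inter> set (d # us @ [a, b, c]) = {}" "S1 \<subseteq> S'" "bdry S1 = cycle_edges (z # q2 @ [a, b, c] @ xs)"
    "d \<notin> \<Union>S1" "set q1 \<inter> \<Union>S1 = {}"
    and ext: "\<And>F m. F \<subseteq> edges S1 \<Longrightarrow> has_monom lt (edges S1 - F) m \<Longrightarrow>
      \<exists>m'. has_monom lt (edges S' - F - {{d, last [a, b, c]}}) m' \<and> lookup m' d = 0 \<and>
        (\<forall>x\<in>\<Union>S1. lookup m' x = lookup m x + (if x \<in> insert z (set xs) then 1 else 0)) \<and>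
        (\<forall>x\<in>set q1. lookup m' x \<le> 2) \<and> (\<forall>x. x \<notin> \<Union>S1 \<longrightarrow> lookup m' x \<le> 4)"
    by (rule reduction[OF S'(1) d1 ne _ bd1 nch]) auto
  have S1: "S1 \<subseteq> T" using R(5) S'(1) by blast
  let ?qs = "xs @ z # q2"
  have bd2: "bdry S1 = cycle_edges (c # ?qs @ [a, b])"
    using R(6) cycle_edges_rotate[of "z # q2 @ [a, b]" "c # xs"] by simp
  have d2: "distinct (c # ?qs @ [a, b])" using R(3) by auto
  have ne2: "?qs \<noteq> []" by simp
  have nch2: "y = last [a, b]" if "y \<in> set [a, b]" "{c, y} \<in> edges S1" for y
    using that edges_mono[OF S1] nonadj by auto
  obtain z' q1' q2' xs' S2 where R': "?qs = q1' @ z' # q2'" "{c, z'} \<in> edges S1"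
    "distinct (z' # q2' @ [a, b] @ xs')"
    "set xs' \<inter> set (c # ?qs @ [a, b]) = {}" "S2 \<subseteq> S1" "bdry S2 = cycle_edges (z' # q2' @ [a, b] @ xs')"
    "c \<notin> \<Union>S2" "set q1' \<inter> \<Union>S2 = {}"
    and ext': "\<And>F m. F \<subseteq> edges S2 \<Longrightarrow> has_monom lt (edges S2 - F) m \<Longrightarrow>
      \<exists>m'. has_monom lt (edges S1 - F - {{c, last [a, b]}}) m' \<and> lookup m' c = 0 \<and>
        (\<forall>x\<in>\<Union>S2. lookup m' x = lookup m x + (if x \<in> insert z' (set xs') then 1 else 0)) \<and>
        (\<forall>x\<in>set q1'. lookup m' x \<le> 2) \<and> (\<forall>x. x \<notin> \<Union>S2 \<longrightarrow> lookup m' x \<le> 4)"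
    by (rule reduction[OF S1 d2 ne2 _ bd2 nch2]) auto
  have S2: "S2 \<subseteq> T" using R'(5) S1 by blast
  have bd3: "bdry S2 = cycle_edges (a # b # xs' @ z' # q2')"
    using R'(6) cycle_edges_rotate[of "z' # q2'" "[a, b] @ xs'"] by simp
  have d3: "distinct (a # b # xs' @ z' # q2')" using R'(3) by auto
  obtain m where m: "has_monom lt (edges S2 - {{a, b}}) m" "lookup m a = 0" "lookup m b = 0"
      "\<forall>x\<in>set (xs' @ z' # q2'). lookup m x \<le> 2" "\<forall>x. lookup m x \<le> 4"
    using near_triangulation_monomial[OF S2 d3 _ bd3] by blast
  have "{a, b} \<in> bdry S2" unfolding bd3 by (simp add: cycle_edges_Cons)
  then have "{{a, b}} \<subseteq> edges S2" using bdry_subset_edges[OF finite_sub[OF S2]] by blast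
  from ext'[OF this m(1)] obtain m1 where m1: "has_monom lt (edges S1 - {{a, b}} - {{c, b}}) m1" "lookup m1 c = 0"
    "\<And>x. x \<in> \<Union>S2 \<Longrightarrow> lookup m1 x = lookup m x + (if x \<in> insert z' (set xs') then 1 else 0)"
    "\<And>x. x \<in> set q1' \<Longrightarrow> lookup m1 x \<le> 2" "\<And>x. x \<notin> \<Union>S2 \<Longrightarrow> lookup m1 x \<le> 4"
    by auto
  have in2: "set (a # b # xs' @ z' # q2') \<subseteq> \<Union>S2" by (rule cycle_vertices[OF S2 bd3])
  have in1: "set (c # ?qs @ [a, b]) \<subseteq> \<Union>S1" by (rule cycle_vertices[OF S1 bd2])
  have "bdry S1 = cycle_edges (a # b # c # xs @ z # q2)"
    using R(6) cycle_edges_rotate[of "z # q2" "[a, b, c] @ xs"] by simp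
  then have "{a, b} \<in> bdry S1" by (simp add: cycle_edges_Cons)
  moreover have "{b, c} \<in> bdry S1" unfolding bd2 by (simp add: cycle_edges_Cons insert_commute)
  ultimately have F: "{{a, b}, {b, c}} \<subseteq> edges S1" using bdry_subset_edges[OF finite_sub[OF S1]] by blast
  have "edges S1 - {{a, b}} - {{c, b}} = edges S1 - {{a, b}, {b, c}}" by (auto simp: insert_commute)
  from ext[OF F, of m1] m1(1)[unfolded this]
  obtain m2 where m2: "has_monom lt (edges S' - {{a, b}, {b, c}} - {{d, c}}) m2" "lookup m2 d = 0"
    "\<And>x. x \<in> \<Union>S1 \<Longrightarrow> lookup m2 x = lookup m1 x + (if x \<in> insert z (set xs) then 1 else 0)"
    "\<And>x. x \<in> set q1 \<Longrightarrow> lookup m2 x \<le> 2" "\<And>x. x \<notin> \<Union>S1 \<Longrightarrow> lookup m2 x \<le> 4"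
    by auto
  have "edges S' - {{a, b}, {b, c}} - {{d, c}} = edges S' - path_edges [a, b, c, d]"
    by (auto simp: insert_commute)
  then have "has_monom lt (edges S' - path_edges [a, b, c, d]) m2" using m2(1) by simp
  moreover have "\<forall>x\<in>set [a, b, c, d]. lookup m2 x = 0"
  proof -
    have "lookup m1 a = 0" "lookup m1 b = 0"
      using m1(3)[of a] m1(3)[of b] in2 m(2,3) d3 by auto
    then show ?thesis
      using m2(2) m2(3)[of a] m2(3)[of b] m2(3)[of c] in1 m1(2) d2 by auto
  qed
  moreover have zz': "z \<noteq> z'"
  proof
    assume "z = z'"
    have "z \<in> set us" using R(1) by simp
    moreover have "{d, z} \<in> edges T" "{c, z} \<in> edges T"
      using R(2) R'(2) \<open>z = z'\<close> edges_mono[OF S'(1)] edges_mono[OF S1] by auto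
    ultimately show False using no3[of z] vus[of z] us(2) by auto
  qed
  \<comment> \<open>The other vertices charged by \<open>c\<close> are in \<open>xs'\<close>, off
    this cycle, and those in \<open>q1'\<close> were settled by the engine.\<close>
  have qs2: "lookup m1 x \<le> (if x = z' then 3 else 2)" if x: "x \<in> set ?qs" for x
  proof -
    consider "x \<in> set q1'" "x \<noteq> z'" | "x = z'" | "x \<in> set q2'" "x \<noteq> z'"
      using x unfolding R'(1) by auto
    then show ?thesis
    proof cases
      case 1
      then show ?thesis using m1(4) by simp
    next
      case 2
      then show ?thesis using m1(3)[of z'] in2 m(4) by auto
    next
      case 3
      then have "x \<notin> insert z' (set xs')" "lookup m x \<le> 2" using d3 m(4) by auto
      moreover have "x \<in> \<Union>S2" by (rule subsetD[OF in2]) (use 3 in simp)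
      ultimately show ?thesis using m1(3)[of x] 3 by simp
    qed
  qed
  moreover have "\<forall>u\<in>set us. lookup m2 u \<le> 3"
  proof
    fix u assume "u \<in> set us"
    then consider "u \<in> set q1" | "u = z" | "u \<in> set q2" using R(1) by auto
    then show "lookup m2 u \<le> 3"
    proof cases
      case 1
      then show ?thesis using m2(4)[of u] by simp
    next
      case 2
      then show ?thesis using m2(3)[of z] in1 qs2[of z] zz' by auto
    next
      case 3
      then have "u \<notin> insert z (set xs)" "u \<in> set ?qs" using d2 by auto
      moreover have "u \<in> \<Union>S1" by (rule subsetD[OF in1]) (use 3 in simp)
      ultimately show ?thesis using m2(3)[of u] qs2[of u] by (simp split: if_splits)
    qed
  qed
  moreover have "\<forall>x. lookup m2 x \<le> 4"
  proof
    fix x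
    have "x \<in> insert z' (set xs') \<Longrightarrow> lookup m x \<le> 2" using m(4) by auto
    moreover have "lookup m x \<le> 4" using m(5) by blast
    ultimately have m14: "lookup m1 x \<le> 4"
    proof (cases "x \<in> \<Union>S2")
      case True
      with \<open>x \<in> insert z' (set xs') \<Longrightarrow> lookup m x \<le> 2\<close> show ?thesis
        using m1(3)[OF True] \<open>lookup m x \<le> 4\<close> by (cases "x \<in> insert z' (set xs')") simp_all
    qed (rule m1(5))
    show "lookup m2 x \<le> 4"
    proof (cases "x \<in> insert z (set xs)")
      \<comment> \<open>Vertices of \<open>xs\<close> can gain from \<open>c\<close> and from
        \<open>d\<close>, but they are not in \<open>us\<close> and gain nothing from
        \<open>v\<close>, so the value 4 is allowed. For \<open>z\<close> the sharper bound 3 was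
        shown above.\<close>
      case True
      then have "x \<in> set ?qs" by auto
      moreover from this have "x \<in> \<Union>S1" by (intro subsetD[OF in1]) auto
      moreover from calculation(1) have "lookup m1 x \<le> 3" using qs2[of x] by (simp split: if_splits)
      ultimately show ?thesis using m2(3)[of x] True by simp
    next
      case False
      then show ?thesis using m2(3,5)[of x] m14 by (cases "x \<in> \<Union>S1") auto
    qed
  qed
  ultimately show ?thesis using step[of m2] unfolding interior_monomial_def by blast
qed

text \<open>The path \<open>c y v\<close> separates \<open>d\<close> from \<open>a\<close> and
  \<open>b\<close>. A vertex adjacent to both sides lies in both pieces, so it is on this path, and
  \<open>y\<close> is the only interior vertex of the path.\<close>

lemma separating_vertex:
  assumes bdT: "bdry T = cycle_edges [v, a, b, c, d]" and dist: "distinct [v, a, b, c, d]"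
    and y: "y \<notin> {v, a, b, c, d}" "{v, y} \<in> edges T" "{c, y} \<in> edges T"
    and z: "z \<notin> {v, a, b, c, d}" "{d, z} \<in> edges T" "{a, z} \<in> edges T \<or> {b, z} \<in> edges T"
  shows "z = y"
proof -
  have bd': "bdry T = cycle_edges (c # [d] @ v # [a, b])"
    using bdT cycle_edges_rotate[of "[v, a, b]" "[c, d]"] by simp
  have D: "distinct (c # [d] @ v # [a, b] @ [y])" using dist y by auto
  have M: "path_edges (c # [y] @ [v]) \<subseteq> edges T" using y by (simp add: insert_commute)
  obtain S1 S2 where S: "S1 \<subseteq> T" "S2 \<subseteq> T" "bdry S1 = cycle_edges (c # [d] @ v # rev [y])"
    "bdry S2 = cycle_edges (v # [a, b] @ c # [y])" "S1 \<inter> S2 = {}" "S1 \<union> S2 = T"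
    "\<Union>S1 \<inter> \<Union>S2 \<subseteq> insert c (insert v (set [y]))" "edges S1 \<inter> edges S2 \<subseteq> path_edges (c # [y] @ [v])"
    by (rule theta_split[OF subset_refl bd' D list.distinct(2) list.distinct(2) M])
  have in1: "d \<in> \<Union>S1" using cycle_vertices[OF S(1,3)] by simp
  have in2: "a \<in> \<Union>S2" "b \<in> \<Union>S2" using cycle_vertices[OF S(2,4)] by auto
  have eT: "edges T = edges S1 \<union> edges S2" using S(6) edges_Un by metis
  have "d \<notin> \<Union>S2" "a \<notin> \<Union>S1" "b \<notin> \<Union>S1" using in1 in2 S(7) dist y(1) by auto
  moreover have "p \<in> \<Union>S1 \<and> q \<in> \<Union>S1 \<or> p \<in> \<Union>S2 \<and> q \<in> \<Union>S2" if "{p, q} \<in> edges T" for p q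
    using that unfolding eT by (auto simp: edges_def)
  ultimately have "z \<in> \<Union>S1" "z \<in> \<Union>S2"
    using z(2,3) by metis+
  then show ?thesis using S(7) z(1) by auto
qed

text \<open>If some \<open>y\<close> is adjacent to \<open>c\<close>, \<open>d\<close> and
  \<open>v\<close>, then it misses \<open>a\<close> or \<open>b\<close>. The cycle is rotated so
  that the deleted triple contains the missed vertex: \<open>d\<close>, \<open>v\<close>,
  \<open>a\<close> or \<open>b\<close>, \<open>c\<close>, \<open>d\<close>. Any vertex obstructing
  the new triple equals \<open>y\<close> by \<open>separating_vertex\<close>, a
  contradiction.\<close>

lemma interior_monomial_5:
  assumes bdT: "bdry T = cycle_edges [v, a, b, c, d]" and dist: "distinct [v, a, b, c, d]"
    and ch: "chordless (edges T) [v, a, b, c, d]"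
    and no5: "\<And>y. y \<notin> {v, a, b, c, d} \<Longrightarrow> \<not> (\<forall>x\<in>{v, a, b, c, d}. {x, y} \<in> edges T)"
  shows "interior_monomial [v, a, b, c, d]"
proof (cases "\<exists>y. y \<notin> {v, a, b, c, d} \<and> {v, y} \<in> edges T \<and> {d, y} \<in> edges T \<and> {c, y} \<in> edges T")
  case True
  then obtain y where y: "y \<notin> {v, a, b, c, d}" "{v, y} \<in> edges T" "{d, y} \<in> edges T" "{c, y} \<in> edges T" by blast
  note sep = separating_vertex[OF bdT dist y(1,2,4)]
  from no5[OF y(1)] y have "{a, y} \<notin> edges T \<or> {b, y} \<notin> edges T" by auto
  then show ?thesis
  proof
    assume ay: "{a, y} \<notin> edges T"
    have rot: "cycle_edges [a, b, c, d, v] = cycle_edges [v, a, b, c, d]"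
      using cycle_edges_rotate[of "[a, b, c, d]" "[v]"] by simp
    have ch': "chordless (edges T) [a, b, c, d, v]"
      using ch chordless_rotate[of "edges T" "[a, b, c, d]" "[v]"] by simp
    have d': "distinct [a, b, c, d, v]" using dist by auto
    have "interior_monomial [a, b, c, d, v]"
    proof (rule interior_monomial_5_aux[OF bdT[folded rot] d' ch'])
      fix z assume z: "z \<notin> {a, b, c, d, v}" "{a, z} \<in> edges T" "{v, z} \<in> edges T" "{d, z} \<in> edges T"
      then have "z = y" using sep[of z] by auto
      then show False using z ay by simp
    qed
    then show ?thesis using rot by (simp add: interior_monomial_def conj_ac)
  next
    assume byn: "{b, y} \<notin> edges T"
    have rot: "cycle_edges [d, v, a, b, c] = cycle_edges [v, a, b, c, d]"
      using cycle_edges_rotate[of "[d]" "[v, a, b, c]"] by simp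
    have ch': "chordless (edges T) [d, v, a, b, c]"
      using ch chordless_rotate[of "edges T" "[d]" "[v, a, b, c]"] by simp
    have d': "distinct [d, v, a, b, c]" using dist by auto
    have "interior_monomial [d, v, a, b, c]"
    proof (rule interior_monomial_5_aux[OF bdT[folded rot] d' ch'])
      fix z assume z: "z \<notin> {d, v, a, b, c}" "{d, z} \<in> edges T" "{c, z} \<in> edges T" "{b, z} \<in> edges T"
      then have "z = y" using sep[of z] by auto
      then show False using z byn by simp
    qed
    then show ?thesis using rot by (simp add: interior_monomial_def conj_ac)
  qed
next
  case False
  then show ?thesis by (intro interior_monomial_5_aux[OF bdT dist ch]) blast
qed

end

section \<open>The faces of a plane near-triangulation\<close>

definition jordan :: "complex set \<Rightarrow> bool" where
  "jordan J \<longleftrightarrow> (\<exists>g. simple_path g \<and> pathfinish g = pathstart g \<and> path_image g = J)"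

lemma jordan_facts:
  assumes "jordan J"
  shows "inside J \<noteq> {}" "open (inside J)" "connected (inside J)" "bounded (inside J)"
    "outside J \<noteq> {}" "open (outside J)" "connected (outside J)" "\<not> bounded (outside J)"
    "inside J \<inter> outside J = {}" "inside J \<union> outside J = - J"
    "frontier (inside J) = J" "frontier (outside J) = J"
  using assms Jordan_inside_outside unfolding jordan_def by blast+

text \<open>\<open>F\<close> misses its frontier \<open>J\<close>, and a connected set off
  \<open>J\<close> that meets \<open>F\<close> cannot leave it. So \<open>F\<close> contains each
  side of \<open>J\<close> that it meets, and being connected it meets only one.\<close>

lemma jordan_component:
  assumes J: "jordan J" and F: "open F" "connected F" "F \<noteq> {}" "frontier F = J"
  shows "F = inside J \<or> F = outside J"
proof -
  note jf = jordan_facts[OF J]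
  have "F \<inter> J = {}" using F(1,4) by (simp add: frontier_def interior_open) blast
  then have sub: "F \<subseteq> inside J \<union> outside J" using jf(10) by auto
  have full: "U \<subseteq> F" if "connected U" "U \<inter> J = {}" "U \<inter> F \<noteq> {}" for U
    using connected_Int_frontier[OF that(1,3)] that(2) F(4) by blast
  have dis: "inside J \<inter> J = {}" "outside J \<inter> J = {}" using jf(10) by auto
  have "inside J \<inter> F = {} \<or> outside J \<inter> F = {}"
    using connectedD[OF F(2) jf(2,6)] jf(9) sub by (auto simp: Int_commute)
  moreover have "inside J \<inter> F \<noteq> {} \<or> outside J \<inter> F \<noteq> {}" using sub F(3) by blast
  moreover have "inside J \<inter> F \<noteq> {} \<Longrightarrow> inside J \<subseteq> F" using full[OF jf(3) dis(1)] by blast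
  moreover have "outside J \<inter> F \<noteq> {} \<Longrightarrow> outside J \<subseteq> F" using full[OF jf(7) dis(2)] by blast
  ultimately show ?thesis using sub by blast
qed

text \<open>Expresses the inside of a curve by a quantity that is additive when paths are
  joined.\<close>

lemma jordan_winding:
  fixes g :: "real \<Rightarrow> complex"
  assumes "simple_path g" "pathfinish g = pathstart g" "z \<notin> path_image g"
  shows "winding_number g z \<noteq> 0 \<longleftrightarrow> z \<in> inside (path_image g)"
proof -
  have "z \<in> inside (path_image g) \<Longrightarrow> winding_number g z \<noteq> 0"
    using simple_closed_path_winding_number_inside[OF assms(1)] by (metis neg_equal_0_iff_equal zero_neq_one)
  moreover have "z \<in> outside (path_image g) \<Longrightarrow> winding_number g z = 0"
    using winding_number_zero_in_outside[OF simple_path_imp_path[OF assms(1)] assms(2)] .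
  moreover have "z \<in> inside (path_image g) \<union> outside (path_image g)"
    using assms(3) by (simp add: inside_Un_outside)
  ultimately show ?thesis by blast
qed

text \<open>The winding numbers around the three cycles of a theta curve add up.\<close>

lemma theta_inside:
  fixes g1 g2 g :: "real \<Rightarrow> complex"
  assumes arcs: "arc g1" "arc g2" "arc g"
    and ends: "pathstart g1 = a" "pathfinish g1 = b" "pathstart g2 = a" "pathfinish g2 = b"
      "pathstart g = a" "pathfinish g = b"
    and int: "path_image g1 \<inter> path_image g2 \<subseteq> {a, b}" "path_image g1 \<inter> path_image g \<subseteq> {a, b}"
      "path_image g2 \<inter> path_image g \<subseteq> {a, b}"
    and z: "z \<notin> path_image g1 \<union> path_image g2 \<union> path_image g"
  shows "z \<in> inside (path_image g1 \<union> path_image g2) \<Longrightarrow>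
      z \<in> inside (path_image g1 \<union> path_image g) \<or> z \<in> inside (path_image g2 \<union> path_image g)"
    and "z \<in> inside (path_image g1 \<union> path_image g) \<Longrightarrow> z \<notin> inside (path_image g2 \<union> path_image g) \<Longrightarrow>
      z \<in> inside (path_image g1 \<union> path_image g2)"
proof -
  \<comment> \<open>Each of the three insides thus says that two of three numbers, attached to the
    single arcs, differ. The two claims become statements about equality among three
    numbers.\<close>
  have loop: "winding_number p z \<noteq> winding_number q z \<longleftrightarrow> z \<in> inside (path_image p \<union> path_image q)"
    if "arc p" "arc q" "pathstart p = a" "pathfinish p = b" "pathstart q = a" "pathfinish q = b"
      "path_image p \<inter> path_image q \<subseteq> {a, b}" "z \<notin> path_image p" "z \<notin> path_image q" for p q
  proof -
    let ?l = "p +++ reversepath q"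
    have "simple_path ?l" using that by (intro simple_path_join_loop) (auto simp: arc_reversepath)
    moreover have "pathfinish ?l = pathstart ?l" using that by simp
    moreover have pi: "path_image ?l = path_image p \<union> path_image q"
      using that by (simp add: path_image_join)
    moreover have "winding_number ?l z = winding_number p z - winding_number q z"
      using that by (simp add: winding_number_join winding_number_reversepath arc_imp_path)
    ultimately show ?thesis using jordan_winding[of ?l z] that(8,9) by auto
  qed
  have "winding_number g1 z \<noteq> winding_number g2 z \<longleftrightarrow> z \<in> inside (path_image g1 \<union> path_image g2)"
    "winding_number g1 z \<noteq> winding_number g z \<longleftrightarrow> z \<in> inside (path_image g1 \<union> path_image g)"
    "winding_number g2 z \<noteq> winding_number g z \<longleftrightarrow> z \<in> inside (path_image g2 \<union> path_image g)"
    using z arcs ends int by (intro loop; simp)+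
  then show "z \<in> inside (path_image g1 \<union> path_image g2) \<Longrightarrow>
      z \<in> inside (path_image g1 \<union> path_image g) \<or> z \<in> inside (path_image g2 \<union> path_image g)"
    and "z \<in> inside (path_image g1 \<union> path_image g) \<Longrightarrow> z \<notin> inside (path_image g2 \<union> path_image g) \<Longrightarrow>
      z \<in> inside (path_image g1 \<union> path_image g2)"
    by metis+
qed

text \<open>An arc is homeomorphic to an interval, so a nonempty open subset of the plane inside it
  would embed into the line, against invariance of dimension.\<close>

lemma open_not_subset_arc:
  fixes g :: "real \<Rightarrow> complex"
  assumes "arc g" "open U" "U \<noteq> {}"
  shows "\<not> U \<subseteq> path_image g"
proof
  assume U: "U \<subseteq> path_image g"
  obtain h where h: "homeomorphism {0..1} (path_image g) g h" using homeomorphism_arc[OF assms(1)] by blast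
  have "continuous_on U h" using h U by (metis homeomorphism_def continuous_on_subset)
  moreover have "inj_on h U"
  proof (rule inj_onI)
    fix x y assume "x \<in> U" "y \<in> U" "h x = h y"
    then show "x = y" using h U unfolding homeomorphism_def by (metis subsetD)
  qed
  ultimately have "DIM(complex) \<le> DIM(real)" using assms(2,3) by (intro invariance_of_dimension)
  then show False by simp
qed

section \<open>Drawings of edges, paths and cycles\<close>

locale plane_drawing =
  fixes V :: "'v set" and E :: "'v set set" and pos :: "'v \<Rightarrow> complex"
    and \<gamma> :: "'v set \<Rightarrow> real \<Rightarrow> complex"
  assumes plane: "plane_graph V E pos \<gamma>"
begin

lemma finite_V: "finite V"
  and edge: "e \<in> E \<Longrightarrow> e \<subseteq> V" "e \<in> E \<Longrightarrow> card e = 2"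
  using plane unfolding plane_graph_def simple_graph_def by simp_all

lemma arc_edge: "e \<in> E \<Longrightarrow> arc (\<gamma> e)"
  and ends_edge: "e \<in> E \<Longrightarrow> {pathstart (\<gamma> e), pathfinish (\<gamma> e)} = pos ` e"
  and edge_vertices: "e \<in> E \<Longrightarrow> path_image (\<gamma> e) \<inter> pos ` V = pos ` e"
  and edge_int: "e \<in> E \<Longrightarrow> f \<in> E \<Longrightarrow> e \<noteq> f \<Longrightarrow> path_image (\<gamma> e) \<inter> path_image (\<gamma> f) = pos ` (e \<inter> f)"
  using plane unfolding plane_graph_def by simp_all

lemma finite_E: "finite E"
  by (rule finite_subset[of _ "Pow V"]) (use edge finite_V in auto)

abbreviation im :: "'v set set \<Rightarrow> complex set" where
  "im D \<equiv> edges_image \<gamma> D"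

lemma im_insert: "im (insert e D) = path_image (\<gamma> e) \<union> im D"
  and im_mono: "D \<subseteq> D' \<Longrightarrow> im D \<subseteq> im D'"
  by (auto simp: edges_image_def)

lemma closed_im: "D \<subseteq> E \<Longrightarrow> closed (im D)" and bounded_im: "D \<subseteq> E \<Longrightarrow> bounded (im D)"
  unfolding edges_image_def
  using finite_E finite_subset arc_edge
  by (auto intro!: closed_UN bounded_UN closed_path_image bounded_path_image arc_imp_path)

lemma edge_arc:
  assumes "{x, y} \<in> E"
  obtains g where "arc g" "pathstart g = pos x" "pathfinish g = pos y" "path_image g = path_image (\<gamma> {x, y})"
proof -
  let ?g = "\<gamma> {x, y}"
  have "{pathstart ?g, pathfinish ?g} = {pos x, pos y}" using ends_edge[OF assms] by simp
  then consider "pathstart ?g = pos x" "pathfinish ?g = pos y" | "pathstart ?g = pos y" "pathfinish ?g = pos x"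
    by (auto simp: doubleton_eq_iff)
  then show thesis
    using that[of ?g] that[of "reversepath ?g"] arc_edge[OF assms] by cases (auto simp: arc_reversepath)
qed

lemma path_arc:
  assumes "distinct p" "2 \<le> length p" "path_edges p \<subseteq> E"
  shows "\<exists>g. arc g \<and> pathstart g = pos (hd p) \<and> pathfinish g = pos (last p) \<and> path_image g = im (path_edges p)"
  using assms
proof (induction p rule: path_edges.induct)
  case (1 x y zs)
  obtain g where g: "arc g" "pathstart g = pos x" "pathfinish g = pos y" "path_image g = path_image (\<gamma> {x, y})"
    using edge_arc[of x y] 1 by auto
  show ?case
  proof (cases "zs = []")
    case True
    then show ?thesis using g by (auto simp: edges_image_def)
  next
    case False
    then have "2 \<le> length (y # zs)" by (cases zs) auto
    then obtain h where h: "arc h" "pathstart h = pos y" "pathfinish h = pos (last (y # zs))"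
      "path_image h = im (path_edges (y # zs))"
      using 1 by auto
    have "path_image (\<gamma> {x, y}) \<inter> path_image (\<gamma> f) \<subseteq> {pos y}" if "f \<in> path_edges (y # zs)" for f
    proof -
      have "f \<subseteq> set (y # zs)" using that by (rule path_edges_subset)
      then have "x \<notin> f" using 1(2) by auto
      then have "{x, y} \<noteq> f" by auto
      moreover have "f \<in> E" "{x, y} \<in> E" using that 1(4) by auto
      ultimately show ?thesis using edge_int[of "{x, y}" f] \<open>x \<notin> f\<close> by auto
    qed
    then have "path_image g \<inter> path_image h \<subseteq> {pos y}"
      unfolding g(4) h(4) edges_image_def by blast
    then have "arc (g +++ h)" using g h by (intro arc_join) auto
    moreover have "path_image (g +++ h) = im (path_edges (x # y # zs))"
      using g h by (simp add: path_image_join im_insert)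
    ultimately show ?thesis using g h by (intro exI[of _ "g +++ h"]) auto
  qed
qed auto

lemma cycle_jordan:
  assumes "is_cycle E vs"
  shows "jordan (im (cycle_edges vs))"
proof -
  have vs: "3 \<le> length vs" "distinct vs" "cycle_edges vs \<subseteq> E" using assms by (auto simp: is_cycle_def)
  then have ne: "vs \<noteq> []" by auto
  have ce: "cycle_edges vs = insert {last vs, hd vs} (path_edges vs)" using ne by (rule cycle_edges_conv)
  obtain g where g: "arc g" "pathstart g = pos (hd vs)" "pathfinish g = pos (last vs)"
    "path_image g = im (path_edges vs)"
    using path_arc[of vs] vs ce by auto
  have eE: "{last vs, hd vs} \<in> E" using vs ce by auto
  obtain h where h: "arc h" "pathstart h = pos (last vs)" "pathfinish h = pos (hd vs)"
    "path_image h = path_image (\<gamma> {last vs, hd vs})"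
    using edge_arc[OF eE] by blast
  have "path_image (\<gamma> {last vs, hd vs}) \<inter> path_image (\<gamma> f) \<subseteq> {pos (hd vs), pos (last vs)}"
    if "f \<in> path_edges vs" for f
  proof -
    have "{last vs, hd vs} \<noteq> f"
      using that hd_last_notin_path_edges[OF vs(2,1)] by (auto simp: insert_commute)
    moreover have "f \<in> E" using that vs(3) ce by auto
    ultimately show ?thesis using edge_int[OF eE, of f] by auto
  qed
  then have "path_image g \<inter> path_image h \<subseteq> {pathstart g, pathstart h}"
    unfolding g h edges_image_def by blast
  then have "simple_path (g +++ h)" using g h by (intro simple_path_join_loop) auto
  moreover have "path_image (g +++ h) = im (cycle_edges vs)"
    using g h by (simp add: path_image_join ce im_insert Un_commute)
  ultimately show ?thesis unfolding jordan_def using g h by (intro exI[of _ "g +++ h"]) auto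
qed

definition inner_points :: "'v set \<Rightarrow> complex set" where
  "inner_points e = path_image (\<gamma> e) - pos ` V"

lemma inner_points_nonempty: "e \<in> E \<Longrightarrow> inner_points e \<noteq> {}"
proof -
  assume e: "e \<in> E"
  have "\<gamma> e (1/2) \<in> path_image (\<gamma> e)" by (auto simp: path_image_def)
  moreover have inj: "inj_on (\<gamma> e) {0..1}" using arc_edge[OF e] by (rule arc_imp_inj_on)
  then have "\<gamma> e (1/2) \<noteq> pathstart (\<gamma> e)" "\<gamma> e (1/2) \<noteq> pathfinish (\<gamma> e)"
    by (auto simp: pathstart_def pathfinish_def dest: inj_onD[OF inj])
  ultimately have "\<gamma> e (1/2) \<in> inner_points e"
    using ends_edge[OF e] edge_vertices[OF e] unfolding inner_points_def by blast
  then show ?thesis by blast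
qed

text \<open>Distinct edges meet only in vertices, so a single inner point of an edge decides whether
  the edge belongs to \<open>D\<close>.\<close>

lemma inner_points_im:
  assumes "e \<in> E" "D \<subseteq> E" "p \<in> inner_points e"
  shows "p \<in> im D \<longleftrightarrow> e \<in> D"
proof
  assume "p \<in> im D"
  then obtain f where f: "f \<in> D" "p \<in> path_image (\<gamma> f)" by (auto simp: edges_image_def)
  have "e = f"
  proof (rule ccontr)
    assume "e \<noteq> f"
    then have "p \<in> pos ` (e \<inter> f)" using f assms edge_int[of e f] by (auto simp: inner_points_def)
    then show False using assms edge(1)[OF assms(1)] by (auto simp: inner_points_def)
  qed
  then show "e \<in> D" using f by simp
next
  assume "e \<in> D" then show "p \<in> im D" using assms by (auto simp: inner_points_def edges_image_def)
qed

text \<open>Faces know their bounding cycle only as a point set; this recovers the edges.\<close>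

lemma im_inject: "D \<subseteq> E \<Longrightarrow> D' \<subseteq> E \<Longrightarrow> im D = im D' \<Longrightarrow> D = D'"
proof -
  have "e \<in> D'" if "D \<subseteq> E" "D' \<subseteq> E" "im D = im D'" "e \<in> D" for D D' e
  proof -
    have e: "e \<in> E" using that by blast
    obtain p where p: "p \<in> inner_points e" using inner_points_nonempty[OF e] by blast
    show ?thesis
      using inner_points_im[OF e that(1) p] inner_points_im[OF e that(2) p] that(3,4) by simp
  qed
  then show "D \<subseteq> E \<Longrightarrow> D' \<subseteq> E \<Longrightarrow> im D = im D' \<Longrightarrow> D = D'" by blast
qed

definition drawing :: "complex set" where
  "drawing = pos ` V \<union> im E"

lemma closed_drawing: "closed drawing" and bounded_drawing: "bounded drawing"
  unfolding drawing_def using closed_im[OF subset_refl] bounded_im[OF subset_refl] finite_V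
  by (simp_all add: closed_Un finite_imp_closed finite_imp_bounded)

lemma faces_eq: "faces V E pos \<gamma> = components (- drawing)"
  by (simp add: faces_def drawing_def)

lemma face:
  assumes "F \<in> faces V E pos \<gamma>"
  shows "open F" "connected F" "F \<noteq> {}" "F \<inter> drawing = {}"
  using assms closed_drawing unfolding faces_eq
  by (auto dest: in_components_connected in_components_nonempty in_components_subset
      intro: open_components open_Compl)

lemma faces_disjoint:
  "F \<in> faces V E pos \<gamma> \<Longrightarrow> F' \<in> faces V E pos \<gamma> \<Longrightarrow> F \<noteq> F' \<Longrightarrow> F \<inter> F' = {}"
  unfolding faces_eq using components_nonoverlap by blast

lemma Union_faces: "\<Union>(faces V E pos \<gamma>) = - drawing"
  unfolding faces_eq by simp

end

section \<open>Bounded faces as triangles\<close>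

locale near_triangulation =
  fixes V :: "'v set" and E :: "'v set set" and pos :: "'v \<Rightarrow> complex"
    and \<gamma> :: "'v set \<Rightarrow> real \<Rightarrow> complex" and vs :: "'v list"
  assumes near_triangulation: "plane_near_triangulation V E pos \<gamma> vs"

sublocale near_triangulation \<subseteq> plane_drawing V E pos \<gamma>
  using near_triangulation by unfold_locales (simp add: plane_near_triangulation_def)

context near_triangulation
begin

abbreviation "\<F> \<equiv> faces V E pos \<gamma>"

text \<open>Only 3-cycles that bound a face are taken; separating 3-cycles of the graph are
  excluded.\<close>

definition triangles :: "'v set set" where
  "triangles = {t. card t = 3 \<and> bdry {t} \<subseteq> E \<and> (\<exists>F\<in>\<F>. bounded F \<and> frontier F = im (bdry {t}))}"

text \<open>Given as the inside of the drawn cycle, which makes sense without choosing a face;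
  \<open>triangleD\<close> identifies it with the face.\<close>

definition tri_face :: "'v set \<Rightarrow> complex set" where
  "tri_face t = inside (im (bdry {t}))"

definition outer_face :: "complex set" where
  "outer_face = outside (im (cycle_edges vs))"

lemma outer_cycle: "is_cycle E vs" "cycle_edges vs \<subseteq> E" "jordan (im (cycle_edges vs))"
proof -
  show c: "is_cycle E vs" using near_triangulation by (simp add: plane_near_triangulation_def)
  then show "cycle_edges vs \<subseteq> E" by (simp add: is_cycle_def)
  show "jordan (im (cycle_edges vs))" using c by (rule cycle_jordan)
qed

lemma card3_cycle:
  assumes "card t = 3"
  obtains ts where "set ts = t" "distinct ts" "length ts = 3" "cycle_edges ts = bdry {t}"
proof -
  obtain x y z where t: "t = {x, y, z}" "distinct [x, y, z]" using assms by (auto simp: card_3_iff)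
  then have "cycle_edges [x, y, z] = bdry {t}"
    by (auto simp: bdry_triangle cycle_edges_conv insert_commute)
  then show thesis using that[of "[x, y, z]"] t by auto
qed

lemma triangle_jordan: "card t = 3 \<Longrightarrow> bdry {t} \<subseteq> E \<Longrightarrow> jordan (im (bdry {t}))"
  by (metis card3_cycle cycle_jordan is_cycle_def order_refl)

lemma cycle3_bdry:
  assumes "is_cycle E ts" "length ts = 3"
  shows "card (set ts) = 3" "cycle_edges ts = bdry {set ts}"
proof -
  obtain x y z where ts: "ts = [x, y, z]" using assms(2) by (auto simp: length_Suc_conv numeral_3_eq_3)
  have d: "distinct [x, y, z]" using assms(1) ts by (simp add: is_cycle_def)
  then show "card (set ts) = 3" using ts by simp
  show "cycle_edges ts = bdry {set ts}"
    using bdry_triangle[OF d] ts by (auto simp: cycle_edges_conv insert_commute)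
qed

lemma unbounded_face:
  assumes "F \<in> \<F>" "\<not> bounded F"
  shows "F = outer_face"
proof -
  have "frontier F = im (cycle_edges vs)"
    using near_triangulation assms by (simp add: plane_near_triangulation_def)
  then have "F = inside (im (cycle_edges vs)) \<or> F = outer_face"
    unfolding outer_face_def using face[OF assms(1)] outer_cycle(3) by (intro jordan_component) auto
  then show ?thesis using jordan_facts(4)[OF outer_cycle(3)] assms(2) by auto
qed

lemma outer_face: "outer_face \<in> \<F>" "\<not> bounded outer_face" "frontier outer_face = im (cycle_edges vs)"
proof -
  have "bounded (- (- drawing))" using bounded_drawing by simp
  then obtain F where F: "F \<in> \<F>" "\<not> bounded F"
    using cobounded_unbounded_components unfolding faces_eq by blast
  then show "outer_face \<in> \<F>" using unbounded_face by auto
  show "\<not> bounded outer_face" "frontier outer_face = im (cycle_edges vs)"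
    unfolding outer_face_def using jordan_facts[OF outer_cycle(3)] by auto
qed

lemma triangleD:
  assumes "t \<in> triangles"
  shows "card t = 3" "bdry {t} \<subseteq> E" "jordan (im (bdry {t}))" "tri_face t \<in> \<F>" "bounded (tri_face t)"
    "frontier (tri_face t) = im (bdry {t})"
proof -
  show t: "card t = 3" "bdry {t} \<subseteq> E" using assms by (auto simp: triangles_def)
  then show J: "jordan (im (bdry {t}))" by (rule triangle_jordan)
  obtain F where F: "F \<in> \<F>" "bounded F" "frontier F = im (bdry {t})"
    using assms by (auto simp: triangles_def)
  then have "F = tri_face t \<or> F = outside (im (bdry {t}))"
    unfolding tri_face_def using face[OF F(1)] J by (intro jordan_component) auto
  then have "F = tri_face t" using jordan_facts(8)[OF J] F(2) by auto
  then show "tri_face t \<in> \<F>" "bounded (tri_face t)" "frontier (tri_face t) = im (bdry {t})" using F by auto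
qed

lemma bounded_face:
  assumes "F \<in> \<F>" "bounded F"
  obtains t where "t \<in> triangles" "F = tri_face t"
proof -
  obtain ts where ts: "is_cycle E ts" "length ts = 3" "frontier F = im (cycle_edges ts)"
    using near_triangulation assms by (auto simp: plane_near_triangulation_def)
  let ?t = "set ts"
  have t: "?t \<in> triangles"
    using cycle3_bdry[OF ts(1,2)] ts assms by (auto simp: triangles_def is_cycle_def)
  have "frontier F = im (bdry {?t})" using ts(3) cycle3_bdry[OF ts(1,2)] by simp
  then have "F = tri_face ?t \<or> F = outside (im (bdry {?t}))"
    unfolding tri_face_def using face[OF assms(1)] triangleD(3)[OF t] by (intro jordan_component) auto
  then have "F = tri_face ?t" using jordan_facts(8)[OF triangleD(3)[OF t]] assms(2) by auto
  then show thesis using that t by blast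
qed

lemma Union_bdry_single: "card t = 3 \<Longrightarrow> \<Union>(bdry {t}) = t"
  by (auto simp: card_3_iff bdry_triangle)

lemma inj_tri_face: "inj_on tri_face triangles"
proof (rule inj_onI)
  fix t t' assume t: "t \<in> triangles" "t' \<in> triangles" "tri_face t = tri_face t'"
  then have "im (bdry {t}) = im (bdry {t'})" using triangleD(6) by metis
  then have "bdry {t} = bdry {t'}" using im_inject triangleD(2) t by blast
  then show "t = t'" using Union_bdry_single triangleD(1) t by metis
qed

lemma finite_triangles: "finite triangles"
proof (rule finite_subset)
  show "triangles \<subseteq> Pow V"
  proof
    fix t assume t: "t \<in> triangles"
    have "\<Union>(bdry {t}) \<subseteq> V" using triangleD(2)[OF t] edge(1) by blast
    then show "t \<in> Pow V" using Union_bdry_single[OF triangleD(1)[OF t]] by simp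
  qed
qed (use finite_V in simp)

lemma faces_conv: "\<F> = insert outer_face (tri_face ` triangles)"
proof (intro equalityI subsetI)
  fix F assume F: "F \<in> \<F>"
  show "F \<in> insert outer_face (tri_face ` triangles)"
  proof (cases "bounded F")
    case True
    then obtain t where "t \<in> triangles" "F = tri_face t" using bounded_face[OF F] by blast
    then show ?thesis by simp
  qed (use unbounded_face[OF F] in simp)
qed (use outer_face(1) triangleD(4) in auto)

lemma finite_faces: "finite \<F>"
  unfolding faces_conv using finite_triangles by simp

lemma face_frontier:
  assumes "F \<in> \<F>"
  obtains D where "D \<subseteq> E" "frontier F = im D" "jordan (im D)" "F = inside (im D) \<or> F = outside (im D)"
proof (cases "bounded F")
  case True
  then obtain t where "t \<in> triangles" "F = tri_face t" using bounded_face assms by blast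
  then show thesis using that[of "bdry {t}"] triangleD[of t] by (auto simp: tri_face_def)
next
  case False
  then have "F = outer_face" using unbounded_face assms by blast
  then show thesis using that[of "cycle_edges vs"] outer_cycle outer_face by (auto simp: outer_face_def)
qed

section \<open>The two faces along an edge\<close>

definition adj :: "'v set \<Rightarrow> complex set set" where
  "adj e = {F \<in> \<F>. inner_points e \<subseteq> frontier F}"

text \<open>The frontier of a face is a union of whole drawn edges, so one inner point of
  \<open>e\<close> on it brings all of them.\<close>

lemma adj_iff:
  assumes "e \<in> E" "p \<in> inner_points e" "F \<in> \<F>"
  shows "p \<in> frontier F \<longleftrightarrow> F \<in> adj e"
proof -
  obtain D where D: "D \<subseteq> E" "frontier F = im D" by (rule face_frontier[OF assms(3)])
  have "e \<in> D \<Longrightarrow> inner_points e \<subseteq> im D" by (auto simp: inner_points_def edges_image_def)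
  then show ?thesis using inner_points_im[OF assms(1) D(1) assms(2)] assms D(2) by (auto simp: adj_def)
qed

lemma adj_triangle: "e \<in> E \<Longrightarrow> t \<in> triangles \<Longrightarrow> tri_face t \<in> adj e \<longleftrightarrow> e \<subseteq> t"
proof -
  assume e: "e \<in> E" and t: "t \<in> triangles"
  obtain p where p: "p \<in> inner_points e" using inner_points_nonempty[OF e] by blast
  have "tri_face t \<in> adj e \<longleftrightarrow> e \<in> bdry {t}"
    using adj_iff[OF e p triangleD(4)[OF t]] inner_points_im[OF e triangleD(2)[OF t] p] triangleD(6)[OF t]
    by simp
  then show ?thesis using edge(2)[OF e] by (simp add: bdry_single)
qed

lemma adj_outer: "e \<in> E \<Longrightarrow> outer_face \<in> adj e \<longleftrightarrow> e \<in> cycle_edges vs"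
proof -
  assume e: "e \<in> E"
  obtain p where p: "p \<in> inner_points e" using inner_points_nonempty[OF e] by blast
  show ?thesis
    using adj_iff[OF e p outer_face(1)] inner_points_im[OF e outer_cycle(2) p] outer_face(3) by simp
qed

lemma finite_adj: "finite (adj e)"
  using finite_faces by (simp add: adj_def)

text \<open>There are finitely many vertices, edges and faces. Hence the vertices, the other edges
  and the closures of the faces not adjacent to \<open>e\<close> form a closed set, and it misses
  \<open>p\<close>.\<close>

lemma neighbourhood:
  assumes "e \<in> E" "p \<in> inner_points e"
  obtains r where "r > 0" "ball p r \<subseteq> inner_points e \<union> \<Union>(adj e)"
proof -
  define K where "K = pos ` V \<union> im (E - {e}) \<union> (\<Union>F\<in>\<F> - adj e. closure F)"
  have "closed K" unfolding K_def using finite_V finite_faces closed_im[of "E - {e}"]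
    by (intro closed_Un closed_UN) (auto intro: finite_imp_closed)
  moreover have "p \<notin> K"
  proof -
    have "p \<notin> pos ` V" using assms by (simp add: inner_points_def)
    moreover have "p \<notin> im (E - {e})" using inner_points_im[OF assms(1) _ assms(2), of "E - {e}"] by simp
    moreover have "p \<notin> closure F" if "F \<in> \<F> - adj e" for F
    proof -
      have "p \<in> drawing" using assms by (auto simp: drawing_def inner_points_def edges_image_def)
      then have "p \<notin> F" using that face(4) by blast
      moreover have "p \<notin> frontier F" using adj_iff[OF assms] that by blast
      ultimately show ?thesis by (simp add: closure_Un_frontier)
    qed
    ultimately show ?thesis by (auto simp: K_def)
  qed
  ultimately obtain r where r: "r > 0" "ball p r \<subseteq> - K"
    using openE[of "- K" p] by (auto simp: open_Compl)
  have "ball p r \<subseteq> inner_points e \<union> \<Union>(adj e)"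
  proof
    fix q assume "q \<in> ball p r"
    then have q: "q \<notin> K" using r by blast
    show "q \<in> inner_points e \<union> \<Union>(adj e)"
    proof (cases "q \<in> drawing")
      case True
      then have "q \<in> im E" "q \<notin> pos ` V" using q by (auto simp: drawing_def K_def)
      then obtain f where f: "f \<in> E" "q \<in> path_image (\<gamma> f)" by (auto simp: edges_image_def)
      have "f = e" using f q by (auto simp: K_def edges_image_def)
      then show ?thesis using f \<open>q \<notin> pos ` V\<close> by (simp add: inner_points_def)
    next
      case False
      then obtain F where F: "F \<in> \<F>" "q \<in> F" using Union_faces by blast
      then have "F \<in> adj e" using q closure_subset[of F] by (auto simp: K_def)
      then show ?thesis using F by blast
    qed
  qed
  then show thesis using that r by blast
qed

lemma meets_adj:
  assumes "e \<in> E" "p \<in> inner_points e" "p \<in> closure U" "U \<inter> inner_points e = {}"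
  obtains F where "F \<in> adj e" "F \<inter> U \<noteq> {}"
proof -
  obtain r where r: "r > 0" "ball p r \<subseteq> inner_points e \<union> \<Union>(adj e)"
    using neighbourhood[OF assms(1,2)] by blast
  obtain q where q: "q \<in> U" "dist q p < r" using r(1) assms(3) unfolding closure_approachable by blast
  then have "q \<in> ball p r" by (simp add: dist_commute)
  then show thesis using r(2) q(1) assms(4) that by blast
qed

text \<open>The frontier of \<open>F\<close> is a Jordan curve and is also the frontier of its other
  side. Points of that side accumulate at \<open>e\<close>, so an adjacent face meets it, and this
  face cannot be \<open>F\<close>.\<close>

lemma adj_other:
  assumes "e \<in> E" "F \<in> adj e"
  obtains F' where "F' \<in> adj e" "F' \<noteq> F"
proof -
  obtain p where p: "p \<in> inner_points e" using inner_points_nonempty[OF assms(1)] by blast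
  have F: "F \<in> \<F>" "inner_points e \<subseteq> frontier F" using assms by (auto simp: adj_def)
  obtain D where D: "frontier F = im D" "jordan (im D)" "F = inside (im D) \<or> F = outside (im D)"
    by (rule face_frontier[OF F(1)])
  note jf = jordan_facts[OF D(2)]
  obtain G where G: "frontier G = im D" "G \<inter> F = {}" "G \<inter> im D = {}"
  proof (cases "F = inside (im D)")
    case True
    then show thesis using that[of "outside (im D)"] jf(9,10,12) by blast
  next
    case False
    then show thesis using D(3) that[of "inside (im D)"] jf(9,10,11) by blast
  qed
  have "p \<in> closure G" using p F(2) D(1) G(1) by (auto simp: frontier_def)
  moreover have "G \<inter> inner_points e = {}" using G(3) F(2) unfolding D(1) by blast
  ultimately obtain F' where "F' \<in> adj e" "F' \<inter> G \<noteq> {}" using meets_adj[OF assms(1) p] by metis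
  then show thesis using that[of F'] G(2) by blast
qed

text \<open>Otherwise a small disc around an inner point would be contained in the arc of the
  edge.\<close>

lemma adj_nonempty: "e \<in> E \<Longrightarrow> adj e \<noteq> {}"
proof
  assume e: "e \<in> E" "adj e = {}"
  obtain p where p: "p \<in> inner_points e" using inner_points_nonempty[OF e(1)] by blast
  obtain r where r: "r > 0" "ball p r \<subseteq> inner_points e \<union> \<Union>(adj e)" using neighbourhood[OF e(1) p] by blast
  then have "ball p r \<subseteq> path_image (\<gamma> e)" using e(2) by (auto simp: inner_points_def)
  then show False using open_not_subset_arc[OF arc_edge[OF e(1)], of "ball p r"] r(1) by simp
qed

text \<open>The two triangles form a theta curve with \<open>e\<close> as middle arc, so an inner
  point of \<open>e\<close> lies inside the outer curve \<open>?J\<close>. Every adjacent face then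
  has points inside \<open>?J\<close>, and off the drawing that region is covered by the two
  triangular faces.\<close>

lemma adj_third:
  assumes e: "e \<in> E" and t: "t1 \<in> triangles" "t2 \<in> triangles" "t1 \<noteq> t2" "e \<subseteq> t1" "e \<subseteq> t2" and F: "F \<in> adj e"
  shows "F = tri_face t1 \<or> F = tri_face t2"
proof -
  obtain a b where ab: "e = {a, b}" "a \<noteq> b" using edge(2)[OF e] by (auto simp: card_2_iff)
  obtain c1 where c1: "t1 = {a, b, c1}" "c1 \<noteq> a" "c1 \<noteq> b" using triangle_third[OF triangleD(1)[OF t(1)] _ ab(2)] t(4) ab(1) by metis
  obtain c2 where c2: "t2 = {a, b, c2}" "c2 \<noteq> a" "c2 \<noteq> b" using triangle_third[OF triangleD(1)[OF t(2)] _ ab(2)] t(5) ab(1) by metis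
  have cc: "c1 \<noteq> c2" using c1 c2 t(3) by auto
  define P where "P c = path_edges [a, c, b]" for c
  have P: "P c = {{a, c}, {c, b}}" for c by (simp add: P_def)
  have bdP: "bdry {{a, b, c}} = insert e (P c)" if "c \<noteq> a" "c \<noteq> b" for c
    using bdry_triangle[of a b c] that ab by (auto simp: P insert_commute)
  have PE: "P c1 \<subseteq> E" "P c2 \<subseteq> E"
    using triangleD(2)[OF t(1)] triangleD(2)[OF t(2)] bdP c1 c2 by auto
  have Pe: "e \<notin> P c1" "e \<notin> P c2" using ab c1 c2 by (auto simp: P doubleton_eq_iff)
  have eg: "\<exists>g. arc g \<and> pathstart g = pos a \<and> pathfinish g = pos b \<and> path_image g = im (P c)"
    if "c \<noteq> a" "c \<noteq> b" "P c \<subseteq> E" for c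
    using path_arc[of "[a, c, b]"] that ab by (simp add: P_def)
  obtain g1 where g1: "arc g1" "pathstart g1 = pos a" "pathfinish g1 = pos b" "path_image g1 = im (P c1)"
    using eg[of c1] c1 PE by blast
  obtain g2 where g2: "arc g2" "pathstart g2 = pos a" "pathfinish g2 = pos b" "path_image g2 = im (P c2)"
    using eg[of c2] c2 PE by blast
  obtain g where g: "arc g" "pathstart g = pos a" "pathfinish g = pos b" "path_image g = path_image (\<gamma> e)"
    using edge_arc[of a b] e ab by auto
  have meet: "path_image (\<gamma> f) \<inter> path_image (\<gamma> f') \<subseteq> {pos a, pos b}"
    if "f \<in> E" "f' \<in> E" "f \<noteq> f'" "f \<inter> f' \<subseteq> {a, b}" for f f'
    using edge_int[OF that(1-3)] that(4) by auto
  have i1: "im (P c) \<inter> path_image (\<gamma> e) \<subseteq> {pos a, pos b}" if "P c \<subseteq> E" "e \<notin> P c" for c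
  proof -
    have "path_image (\<gamma> f) \<inter> path_image (\<gamma> e) \<subseteq> {pos a, pos b}" if f: "f \<in> P c" for f
    proof (rule meet)
      show "f \<in> E" using f \<open>P c \<subseteq> E\<close> by blast
      show "f \<noteq> e" using f \<open>e \<notin> P c\<close> by blast
    qed (use ab e in auto)
    then show ?thesis unfolding edges_image_def by blast
  qed
  have i2: "im (P c1) \<inter> im (P c2) \<subseteq> {pos a, pos b}"
  proof -
    have "path_image (\<gamma> f) \<inter> path_image (\<gamma> f') \<subseteq> {pos a, pos b}" if f: "f \<in> P c1" "f' \<in> P c2" for f f'
    proof (rule meet)
      show "f \<in> E" "f' \<in> E" using f PE by blast+
      have "c1 \<in> f" "c1 \<notin> f'" using f c1 cc by (auto simp: P)
      then show "f \<noteq> f'" by blast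
      show "f \<inter> f' \<subseteq> {a, b}" using f c1 c2 cc by (auto simp: P)
    qed
    then show ?thesis unfolding edges_image_def by blast
  qed
  have J: "path_image g1 \<union> path_image g = im (bdry {t1})" "path_image g2 \<union> path_image g = im (bdry {t2})"
    using bdP c1 c2 g1(4) g2(4) g(4) by (auto simp: im_insert)
  have imE: "im (P c1) \<subseteq> drawing" "im (P c2) \<subseteq> drawing" "path_image (\<gamma> e) \<subseteq> drawing"
    using im_mono[OF PE(1)] im_mono[OF PE(2)] e by (auto simp: drawing_def edges_image_def)
  have int: "path_image g1 \<inter> path_image g2 \<subseteq> {pos a, pos b}" "path_image g1 \<inter> path_image g \<subseteq> {pos a, pos b}"
      "path_image g2 \<inter> path_image g \<subseteq> {pos a, pos b}"
    using i1[OF PE(1) Pe(1)] i1[OF PE(2) Pe(2)] i2 unfolding g1(4) g2(4) g(4) by auto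
  let ?J = "path_image g1 \<union> path_image g2"
  note theta = theta_inside[OF g1(1) g2(1) g(1) g1(2,3) g2(2,3) g(2,3) int, unfolded J, folded tri_face_def]
  have off: "z \<notin> path_image g1 \<union> path_image g2 \<union> path_image g" if "z \<notin> drawing" for z
    using that imE g1(4) g2(4) g(4) by auto
  have tri_face_ne: "tri_face t1 \<noteq> tri_face t2" using inj_tri_face t by (auto dest: inj_onD)
  \<comment> \<open>A point of the first face lies inside one small cycle of the theta curve and
    outside the other, so the outer curve surrounds it.\<close>
  have "tri_face t1 \<subseteq> inside ?J"
  proof
    fix z assume z: "z \<in> tri_face t1"
    then have "z \<notin> drawing" using face(4)[OF triangleD(4)[OF t(1)]] by blast
    moreover have "z \<notin> tri_face t2" using faces_disjoint[OF triangleD(4)[OF t(1)] triangleD(4)[OF t(2)] tri_face_ne] z by blast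
    ultimately show "z \<in> inside ?J" using theta(2)[OF off] z by blast
  qed
  have closedJ: "closed ?J" using g1(1) g2(1) by (intro closed_Un closed_path_image arc_imp_path)
  obtain p where p: "p \<in> inner_points e" using inner_points_nonempty[OF e] by blast
  have "p \<in> closure (tri_face t1)"
    using adj_triangle[OF e t(1)] t(4) p by (auto simp: adj_def frontier_def)
  then have "p \<in> closure (inside ?J)" using closure_mono[OF \<open>tri_face t1 \<subseteq> inside ?J\<close>] by blast
  then have "p \<in> ?J \<union> inside ?J" using closure_inside_subset[OF closedJ] by blast
  moreover have "p \<notin> ?J" using inner_points_im[OF e PE(1) p] inner_points_im[OF e PE(2) p] Pe g1(4) g2(4) by simp
  ultimately have pin: "p \<in> inside ?J" by blast
  have F': "F \<in> \<F>" "p \<in> closure F" using F p by (auto simp: adj_def frontier_def)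
  have "open (inside ?J)" using closedJ by (rule open_inside)
  then obtain z where z: "z \<in> F" "z \<in> inside ?J" using pin F'(2) by (meson closure_iff_nhds_not_empty order_refl disjoint_iff)
  have "z \<notin> drawing" using z face(4)[OF F'(1)] by blast
  then have "z \<in> tri_face t1 \<or> z \<in> tri_face t2" using theta(1)[OF off] z by blast
  then show ?thesis
    using faces_disjoint[OF F'(1)] triangleD(4)[OF t(1)] triangleD(4)[OF t(2)] z by blast
qed

text \<open>Of three adjacent faces at least two differ from the outer face and are triangles; then
  \<open>adj_third\<close> leaves no room for the third.\<close>

lemma card_adj:
  assumes e: "e \<in> E"
  shows "card (adj e) = 2"
proof -
  obtain F where F: "F \<in> adj e" using adj_nonempty[OF e] by blast
  obtain F' where F': "F' \<in> adj e" "F' \<noteq> F" using adj_other[OF e F] by blast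
  have conv: "G = outer_face \<or> (\<exists>t\<in>triangles. G = tri_face t \<and> e \<subseteq> t)" if "G \<in> adj e" for G
  proof -
    have "G \<in> insert outer_face (tri_face ` triangles)" using that by (simp add: adj_def faces_conv)
    then show ?thesis using adj_triangle[OF e] that by auto
  qed
  have "G = F \<or> G = F'" if G: "G \<in> adj e" for G
  proof (rule ccontr)
    assume n: "\<not> (G = F \<or> G = F')"
    have two: "\<exists>A B. {A, B} \<subseteq> {F, F', G} \<and> A \<noteq> B \<and> A \<noteq> outer_face \<and> B \<noteq> outer_face"
      using n F'(2) by blast
    then obtain A B where AB: "{A, B} \<subseteq> {F, F', G}" "A \<noteq> B" "A \<noteq> outer_face" "B \<noteq> outer_face" by blast
    then have "A \<in> adj e" "B \<in> adj e" using F F' G by auto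
    then obtain t1 t2 where t: "t1 \<in> triangles" "A = tri_face t1" "e \<subseteq> t1" "t2 \<in> triangles" "B = tri_face t2" "e \<subseteq> t2"
      using conv AB by metis
    then have "t1 \<noteq> t2" using AB by auto
    then have "H = A \<or> H = B" if "H \<in> adj e" for H
      using adj_third[OF e t(1,4) _ t(3,6) that] t by blast
    then have "F \<in> {A, B}" "F' \<in> {A, B}" "G \<in> {A, B}" using F F' G by auto
    then show False using n F'(2) by auto
  qed
  then have "adj e = {F, F'}" using F F' by blast
  then show ?thesis using F'(2) by simp
qed

text \<open>Translates incidences of triangles into counts of adjacent faces. The predicate
  \<open>P\<close> covers all triangles, those inside a cycle and those of a given set
  alike.\<close>

lemma card_triangles_adj:
  assumes e: "e \<in> E"
  shows "card {t \<in> triangles. e \<subseteq> t \<and> P (tri_face t)} = card {F \<in> adj e. F \<noteq> outer_face \<and> P F}"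
proof (rule bij_betw_same_card)
  have "tri_face ` {t \<in> triangles. e \<subseteq> t \<and> P (tri_face t)} = {F \<in> adj e. F \<noteq> outer_face \<and> P F}"
  proof (intro equalityI subsetI)
    fix F assume "F \<in> tri_face ` {t \<in> triangles. e \<subseteq> t \<and> P (tri_face t)}"
    then obtain t where t: "t \<in> triangles" "e \<subseteq> t" "P (tri_face t)" "F = tri_face t" by blast
    then have "F \<noteq> outer_face" using triangleD(5)[OF t(1)] outer_face(2) by auto
    then show "F \<in> {F \<in> adj e. F \<noteq> outer_face \<and> P F}" using adj_triangle[OF e t(1)] t by simp
  next
    fix F assume F: "F \<in> {F \<in> adj e. F \<noteq> outer_face \<and> P F}"
    then have "F \<in> insert outer_face (tri_face ` triangles)" by (auto simp: adj_def faces_conv)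
    then obtain t where "t \<in> triangles" "F = tri_face t" using F by blast
    then show "F \<in> tri_face ` {t \<in> triangles. e \<subseteq> t \<and> P (tri_face t)}"
      using adj_triangle[OF e, of t] F by blast
  qed
  moreover have "inj_on tri_face {t \<in> triangles. e \<subseteq> t \<and> P (tri_face t)}"
    using inj_tri_face by (rule inj_on_subset) blast
  ultimately show "bij_betw tri_face {t \<in> triangles. e \<subseteq> t \<and> P (tri_face t)} {F \<in> adj e. F \<noteq> outer_face \<and> P F}"
    by (simp add: bij_betw_def)
qed

section \<open>Boundaries and fillings read off from the faces\<close>

lemma even_subset_adj:
  assumes "e \<in> E"
  shows "even (card {F \<in> adj e. P F}) \<longleftrightarrow> (\<forall>F\<in>adj e. P F) \<or> (\<forall>F\<in>adj e. \<not> P F)"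
proof -
  obtain F G where FG: "adj e = {F, G}" "F \<noteq> G" using card_adj[OF assms] by (auto simp: card_2_iff)
  have "{H \<in> {F, G}. P H} = (if P F then {F} else {}) \<union> (if P G then {G} else {})" by auto
  then show ?thesis using FG by auto
qed

lemma mem_E_if_triangle: "t \<in> triangles \<Longrightarrow> card e = 2 \<Longrightarrow> e \<subseteq> t \<Longrightarrow> e \<in> E"
  using triangleD(2) by (auto simp: bdry_single)

lemma edges_triangles: "edges triangles = E"
proof (intro equalityI subsetI)
  fix e assume "e \<in> edges triangles"
  then show "e \<in> E" using mem_E_if_triangle by (auto simp: edges_def)
next
  fix e assume e: "e \<in> E"
  have "\<exists>F\<in>adj e. F \<noteq> outer_face"
  proof (rule ccontr)
    assume "\<not> ?thesis"
    then have "adj e \<subseteq> {outer_face}" by blast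
    then have "card (adj e) \<le> 1" using card_mono[of "{outer_face}"] by simp
    then show False using card_adj[OF e] by simp
  qed
  then obtain F where F: "F \<in> adj e" "F \<noteq> outer_face" by blast
  then have "F \<in> insert outer_face (tri_face ` triangles)" by (simp add: adj_def faces_conv)
  then obtain t where "t \<in> triangles" "F = tri_face t" using F by blast
  then show "e \<in> edges triangles" using adj_triangle[OF e] F edge(2)[OF e] by (auto simp: edges_def)
qed

lemma incidence_triangles: "e \<in> E \<Longrightarrow> incidence triangles e = card {F \<in> adj e. F \<noteq> outer_face}"
  using card_triangles_adj[of e "\<lambda>_. True"] by (simp add: incidence_def)

text \<open>Of the two faces along an edge, the number that are bounded is odd exactly when the
  other one is the outer face.\<close>

lemma bdry_triangles: "bdry triangles = cycle_edges vs"
proof -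
  have "e \<in> bdry triangles \<longleftrightarrow> e \<in> cycle_edges vs" if e: "e \<in> E" for e
  proof -
    have "e \<in> bdry triangles \<longleftrightarrow> odd (card {F \<in> adj e. F \<noteq> outer_face})"
      using edge(2)[OF e] incidence_triangles[OF e] by (simp add: bdry_def)
    also have "\<dots> \<longleftrightarrow> outer_face \<in> adj e"
    proof -
      obtain F G where FG: "adj e = {F, G}" "F \<noteq> G" using card_adj[OF e] by (auto simp: card_2_iff)
      have "{H \<in> {F, G}. H \<noteq> outer_face} =
          (if F \<noteq> outer_face then {F} else {}) \<union> (if G \<noteq> outer_face then {G} else {})" by auto
      then show ?thesis using FG by auto
    qed
    finally show ?thesis using adj_outer[OF e] by simp
  qed
  moreover have "bdry triangles \<subseteq> E" using bdry_subset_edges[OF finite_triangles] edges_triangles by simp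
  ultimately show ?thesis using outer_cycle(2) by blast
qed

lemma face_side:
  assumes "F \<in> \<F>" "D \<subseteq> E" "jordan (im D)"
  shows "F \<subseteq> inside (im D) \<or> F \<subseteq> outside (im D)"
proof -
  note jf = jordan_facts[OF assms(3)]
  have "F \<inter> im D = {}" using face(4)[OF assms(1)] im_mono[OF assms(2)] by (auto simp: drawing_def)
  then have sub: "F \<subseteq> inside (im D) \<union> outside (im D)" using jf(10) by auto
  have "inside (im D) \<inter> F = {} \<or> outside (im D) \<inter> F = {}"
    using connectedD[OF face(2)[OF assms(1)] jf(2,6)] jf(9) sub by (auto simp: Int_commute)
  then show ?thesis using sub by blast
qed

text \<open>The filling consists of the triangles whose faces lie inside the cycle. An edge of the
  cycle has one adjacent face on each side; for any other edge both adjacent faces lie on the same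
  side.\<close>

lemma cycle_fill:
  assumes "is_cycle E ds"
  shows "\<exists>S\<subseteq>triangles. bdry S = cycle_edges ds"
proof -
  define D where "D = cycle_edges ds"
  have DE: "D \<subseteq> E" using assms by (simp add: is_cycle_def D_def)
  have J: "jordan (im D)" unfolding D_def using assms by (rule cycle_jordan)
  note jf = jordan_facts[OF J]
  define S where "S = {t \<in> triangles. tri_face t \<subseteq> inside (im D)}"
  have ST: "S \<subseteq> triangles" by (auto simp: S_def)
  have incidence: "incidence S e = card {F \<in> adj e. F \<subseteq> inside (im D)}" if e: "e \<in> E" for e
  proof -
    have "{t \<in> S. e \<subseteq> t} = {t \<in> triangles. e \<subseteq> t \<and> tri_face t \<subseteq> inside (im D)}" by (auto simp: S_def)
    moreover have "\<not> outer_face \<subseteq> inside (im D)" using outer_face(2) jf(4) bounded_subset by blast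
    then have "{F \<in> adj e. F \<noteq> outer_face \<and> F \<subseteq> inside (im D)} = {F \<in> adj e. F \<subseteq> inside (im D)}" by blast
    ultimately show ?thesis
      using card_triangles_adj[OF e, of "\<lambda>F. F \<subseteq> inside (im D)"] by (simp add: incidence_def)
  qed
  have side: "F \<subseteq> U" if "F \<in> \<F>" "F \<inter> U \<noteq> {}" "U = inside (im D) \<or> U = outside (im D)" for F U
    using face_side[OF that(1) DE J] that(2,3) jf(9) by blast
  have odd: "odd (incidence S e) \<longleftrightarrow> e \<in> D" if e: "e \<in> E" for e
  proof -
    obtain p where p: "p \<in> inner_points e" using inner_points_nonempty[OF e] by blast
    have adjF: "F \<in> \<F>" "p \<in> closure F" if "F \<in> adj e" for F
      using that p by (auto simp: adj_def frontier_def)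
    have ne: "F \<noteq> {}" if "F \<in> adj e" for F using face(3) adjF that by blast
    show ?thesis
    proof (cases "e \<in> D")
      case True
      have inn: "inner_points e \<subseteq> im D" using True by (auto simp: inner_points_def edges_image_def)
      have "p \<in> closure (inside (im D))" "p \<in> closure (outside (im D))"
        using jf(11,12) p inn by (auto simp: frontier_def)
      moreover have "inside (im D) \<inter> inner_points e = {}" "outside (im D) \<inter> inner_points e = {}"
        using inn jf(10) by blast+
      ultimately obtain F G where FG: "F \<in> adj e" "F \<inter> inside (im D) \<noteq> {}" "G \<in> adj e" "G \<inter> outside (im D) \<noteq> {}"
        using meets_adj[OF e p] by metis
      have "F \<subseteq> inside (im D)" using side[OF adjF(1)[OF FG(1)] FG(2)] by blast
      moreover have "\<not> G \<subseteq> inside (im D)" using FG(4) jf(9) by blast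
      ultimately show ?thesis
        using incidence[OF e] even_subset_adj[OF e, of "\<lambda>F. F \<subseteq> inside (im D)"] FG True by auto
    next
      case False
      then have "p \<notin> im D" using inner_points_im[OF e DE p] by simp
      then have pio: "p \<in> inside (im D) \<or> p \<in> outside (im D)" using jf(10) by blast
      \<comment> \<open>\<open>p\<close> is a limit of every adjacent face, so a face along
        \<open>e\<close> meets the open side containing \<open>p\<close> and then lies within
        it.\<close>
      have sub: "F \<subseteq> U" if "F \<in> adj e" "p \<in> U" "U = inside (im D) \<or> U = outside (im D)" for F U
      proof -
        have "open U" using that(3) jf(2,6) by blast
        moreover have "U \<inter> closure F \<noteq> {}" using adjF(2)[OF that(1)] that(2) by blast
        ultimately have "U \<inter> F \<noteq> {}" by (simp add: open_Int_closure_eq_empty)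
        then have "F \<inter> U \<noteq> {}" by blast
        then show ?thesis by (rule side[OF adjF(1)[OF that(1)] _ that(3)])
      qed
      have "(\<forall>F\<in>adj e. F \<subseteq> inside (im D)) \<or> (\<forall>F\<in>adj e. F \<subseteq> outside (im D))"
        using pio sub by blast
      then have "(\<forall>F\<in>adj e. F \<subseteq> inside (im D)) \<or> (\<forall>F\<in>adj e. \<not> F \<subseteq> inside (im D))"
      proof (elim disjE)
        assume out: "\<forall>F\<in>adj e. F \<subseteq> outside (im D)"
        have "\<not> F \<subseteq> inside (im D)" if "F \<in> adj e" for F
          using ne[OF that] bspec[OF out that] jf(9) by blast
        then show ?thesis by blast
      qed blast
      then show ?thesis
        using incidence[OF e] even_subset_adj[OF e, of "\<lambda>F. F \<subseteq> inside (im D)"] False by simp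
    qed
  qed
  have "bdry S = D"
  proof (intro equalityI subsetI)
    fix e assume e: "e \<in> bdry S"
    then have "e \<in> edges triangles"
      using bdry_subset_edges[OF finite_subset[OF ST finite_triangles]] edges_mono[OF ST] by blast
    then show "e \<in> D" using e odd edges_triangles by (auto simp: bdry_def)
  next
    fix e assume e: "e \<in> D"
    then have "e \<in> E" using DE by blast
    then show "e \<in> bdry S" using odd e edge(2) by (simp add: bdry_def)
  qed
  then show ?thesis using ST by (auto simp: D_def)
qed

lemma inner_points_disjoint: "e \<in> E \<Longrightarrow> f \<in> E \<Longrightarrow> p \<in> inner_points e \<Longrightarrow> p \<in> inner_points f \<Longrightarrow> e = f"
  using inner_points_im[of e "{f}" p] inner_points_im[of f "{f}" p] by simp

text \<open>With empty boundary, \<open>S\<close> contains the faces along each edge either all or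
  not at all. Faces and open edges therefore fall into two disjoint open parts covering the plane
  without the vertices. That set is connected and the outer face is in the second part, so the first
  part is empty.\<close>

lemma bdry_eq_empty_triangles:
  assumes ST: "S \<subseteq> triangles" and bdry: "bdry S = {}"
  shows "S = {}"
proof -
  have dich: "adj e \<subseteq> tri_face ` S \<or> adj e \<inter> tri_face ` S = {}" if e: "e \<in> E" for e
  proof -
    have "t \<in> S" if "tri_face t \<in> tri_face ` S" "t \<in> triangles" for t
      using that inj_tri_face ST by (meson inj_on_image_mem_iff)
    then have "{t \<in> triangles. e \<subseteq> t \<and> tri_face t \<in> tri_face ` S} = {t \<in> S. e \<subseteq> t}" using ST by blast
    moreover have "outer_face \<notin> tri_face ` S" using ST triangleD(5) outer_face(2) by fastforce
    then have "{F \<in> adj e. F \<noteq> outer_face \<and> F \<in> tri_face ` S} = {F \<in> adj e. F \<in> tri_face ` S}" by blast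
    ultimately have "incidence S e = card {F \<in> adj e. F \<in> tri_face ` S}"
      using card_triangles_adj[OF e, of "\<lambda>F. F \<in> tri_face ` S"] by (simp add: incidence_def)
    moreover have "even (incidence S e)" using bdry edge(2)[OF e] by (auto simp: bdry_def)
    ultimately show ?thesis using even_subset_adj[OF e, of "\<lambda>F. F \<in> tri_face ` S"] by auto
  qed
  \<comment> \<open>The faces in \<open>Q\<close> together with the open edges whose adjacent faces
    all belong to \<open>Q\<close>; these edges are what makes neighbouring faces hang
    together.\<close>
  define part where "part Q = \<Union>{F \<in> \<F>. F \<in> Q} \<union> \<Union>{inner_points e | e. e \<in> E \<and> adj e \<subseteq> Q}" for Q
  have part_open: "open (part Q)" for Q
  proof (subst open_subopen, intro ballI)
    fix x assume "x \<in> part Q"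
    then consider F where "F \<in> \<F>" "F \<in> Q" "x \<in> F" | e where "e \<in> E" "adj e \<subseteq> Q" "x \<in> inner_points e"
      unfolding part_def by blast
    then show "\<exists>T. open T \<and> x \<in> T \<and> T \<subseteq> part Q"
    proof cases
      case 1
      then have "F \<subseteq> part Q" unfolding part_def by blast
      then show ?thesis using face(1)[OF 1(1)] 1(3) by blast
    next
      case 2
      obtain r where r: "r > 0" "ball x r \<subseteq> inner_points e \<union> \<Union>(adj e)"
        using neighbourhood[OF 2(1,3)] by blast
      have "adj e \<subseteq> {F \<in> \<F>. F \<in> Q}" using 2(2) by (auto simp: adj_def)
      then have "\<Union>(adj e) \<subseteq> part Q" unfolding part_def by blast
      moreover have "inner_points e \<subseteq> part Q" using 2(1,2) unfolding part_def by blast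
      ultimately have "ball x r \<subseteq> part Q" using r(2) by blast
      then show ?thesis using r(1) by (intro exI[of _ "ball x r"] conjI) simp_all
    qed
  qed
  have inner_drawing: "inner_points e \<subseteq> drawing" if "e \<in> E" for e
    using that by (auto simp: inner_points_def drawing_def edges_image_def)
  have cover: "- (pos ` V) \<subseteq> part (tri_face ` S) \<union> part (- tri_face ` S)"
  proof
    fix x assume x: "x \<in> - (pos ` V)"
    show "x \<in> part (tri_face ` S) \<union> part (- tri_face ` S)"
    proof (cases "x \<in> drawing")
      case True
      then obtain e where e: "e \<in> E" "x \<in> inner_points e"
        using x by (auto simp: drawing_def edges_image_def inner_points_def)
      have "adj e \<subseteq> tri_face ` S \<or> adj e \<subseteq> - tri_face ` S" using dich[OF e(1)] by blast
      then show ?thesis using e unfolding part_def by blast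
    next
      case False
      then obtain F where "F \<in> \<F>" "x \<in> F" using Union_faces by blast
      then show ?thesis unfolding part_def by blast
    qed
  qed
  have disj: "part (tri_face ` S) \<inter> part (- tri_face ` S) = {}"
  proof (rule ccontr)
    assume "\<not> ?thesis"
    then obtain x where x: "x \<in> part (tri_face ` S)" "x \<in> part (- tri_face ` S)" by blast
    show False
    proof (cases "x \<in> drawing")
      case True
      then have "x \<notin> F" if "F \<in> \<F>" for F using face(4)[OF that] by blast
      then obtain e f where ef: "e \<in> E" "x \<in> inner_points e" "adj e \<subseteq> tri_face ` S"
          "f \<in> E" "x \<in> inner_points f" "adj f \<subseteq> - tri_face ` S"
        using x unfolding part_def by blast
      then show False using inner_points_disjoint[OF ef(1,4,2,5)] adj_nonempty[OF ef(1)] by blast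
    next
      case False
      then have "x \<in> \<Union>{F \<in> \<F>. F \<in> Q}" if "x \<in> part Q" for Q
        using that inner_drawing unfolding part_def by blast
      from this[OF x(1)] this[OF x(2)] show False using faces_disjoint by blast
    qed
  qed
  \<comment> \<open>Removing finitely many points does not disconnect the plane, so the arrangement
    of faces around a vertex need not be analysed.\<close>
  have "connected (- (pos ` V))"
    using finite_V by (intro path_connected_imp_connected path_connected_complement_countable countable_finite) auto
  from connectedD[OF this part_open part_open _ cover] disj
  have "part (tri_face ` S) \<inter> - (pos ` V) = {} \<or> part (- tri_face ` S) \<inter> - (pos ` V) = {}" by blast
  moreover have face_off: "F \<subseteq> - (pos ` V)" if "F \<in> \<F>" for F
    using face(4)[OF that] by (auto simp: drawing_def)
  moreover have "outer_face \<notin> tri_face ` S" using ST triangleD(5) outer_face(2) by fastforce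
  then have "outer_face \<subseteq> part (- tri_face ` S)" using outer_face(1) by (auto simp: part_def)
  ultimately have empty: "part (tri_face ` S) \<inter> - (pos ` V) = {}"
    using face(3)[OF outer_face(1)] face_off[OF outer_face(1)] by blast
  show "S = {}"
  proof (rule ccontr)
    assume "S \<noteq> {}"
    then obtain t where t: "t \<in> S" by blast
    then have F: "tri_face t \<in> \<F>" using triangleD(4) ST by blast
    then have "tri_face t \<subseteq> part (tri_face ` S)" using t by (auto simp: part_def)
    then show False using empty face(3)[OF F] face_off[OF F] by blast
  qed
qed

section \<open>Transfer to the drawn graph\<close>

lemma triangle_complex_triangles: "triangle_complex triangles"
proof
  fix e :: "'v set" assume "card e = 2"
  show "incidence triangles e \<le> 2"
  proof (cases "e \<in> E")
    case True
    have "card {F \<in> adj e. F \<noteq> outer_face} \<le> card (adj e)" using finite_adj by (intro card_mono) auto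
    then show ?thesis using incidence_triangles[OF True] card_adj[OF True] by simp
  next
    case False
    then have "{t \<in> triangles. e \<subseteq> t} = {}" using mem_E_if_triangle \<open>card e = 2\<close> by blast
    then have "card {t \<in> triangles. e \<subseteq> t} = 0" by (simp only: card.empty)
    then show ?thesis by (simp add: incidence_def)
  qed
qed (use finite_triangles triangleD(1) cycle_fill bdry_eq_empty_triangles edges_triangles in auto)

end

theorem theorem3p1:
  fixes V :: "'v set" and E :: "'v set set"
    and pos :: "'v \<Rightarrow> complex" and \<gamma> :: "'v set \<Rightarrow> real \<Rightarrow> complex"
    and vs :: "'v list" and lt :: "'v \<Rightarrow> 'v \<Rightarrow> bool"
    and \<alpha> :: "'v \<Rightarrow>\<^sub>0 nat"
  assumes "plane_near_triangulation V E pos \<gamma> vs"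
    and "chordless E vs"
    and "length vs \<in> {3, 4, 5}"
    and "length vs = 5 \<Longrightarrow> \<not> (\<exists>u\<in>V - set vs. \<forall>v\<in>set vs. {u, v} \<in> E)"
    and "orientation E lt"
    and "Poly_Mapping.keys \<alpha> \<subseteq> set vs"
    and "Poly_Mapping.lookup (graph_poly lt (cycle_edges vs)) \<alpha> \<noteq> 0"
  shows "\<exists>\<beta> :: 'v \<Rightarrow>\<^sub>0 nat. Poly_Mapping.keys \<beta> \<subseteq> V - set vs \<and>
           Poly_Mapping.lookup (graph_poly lt E) (\<alpha> + \<beta>) \<noteq> 0 \<and>
           (\<forall>u\<in>V - set vs. Poly_Mapping.lookup \<beta> u \<le> 4)"
proof -
  interpret near_triangulation V E pos \<gamma> vs by unfold_locales (rule assms(1))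
  interpret triangle_complex triangles by (rule triangle_complex_triangles)
  interpret oriented_triangle_complex triangles lt
    by unfold_locales (simp add: edges_triangles assms(5))
  let ?C = "cycle_edges vs"
  have ch: "chordless (edges triangles) vs" using assms(2) edges_triangles by simp
  have dist: "distinct vs" using outer_cycle(1) by (simp add: is_cycle_def)
  consider "length vs = 3" | "length vs = 4" | "length vs = 5" using assms(3) by auto
  then have "interior_monomial vs"
  proof cases
    case 1
    then obtain v a b where vs: "vs = [v, a, b]" by (auto simp: length_Suc_conv numeral_3_eq_3)
    show ?thesis using bdry_triangles dist ch unfolding vs by (rule interior_monomial_3)
  next
    case 2
    then obtain v a b c where vs: "vs = [v, a, b, c]" by (auto simp: length_Suc_conv eval_nat_numeral)
    show ?thesis using bdry_triangles dist ch unfolding vs by (rule interior_monomial_4)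
  next
    case 3
    then obtain v a b c d where vs: "vs = [v, a, b, c, d]" by (auto simp: length_Suc_conv eval_nat_numeral)
    have no5: "\<not> (\<forall>x\<in>{v, a, b, c, d}. {x, y} \<in> edges triangles)" if y: "y \<notin> {v, a, b, c, d}" for y
    proof
      assume all: "\<forall>x\<in>{v, a, b, c, d}. {x, y} \<in> edges triangles"
      then have "{v, y} \<in> E" using edges_triangles by blast
      then have "y \<in> V - set vs" using edge(1) y vs by auto
      moreover have "\<forall>x\<in>set vs. {y, x} \<in> E" using all edges_triangles vs by (simp add: insert_commute)
      ultimately show False using assms(4) 3 by blast
    qed
    show ?thesis using bdry_triangles dist ch no5 unfolding vs by (rule interior_monomial_5)
  qed
  then obtain \<beta> where \<beta>: "has_monom lt (E - ?C) \<beta>" "\<And>x. x \<in> set vs \<Longrightarrow> lookup \<beta> x = 0" "\<And>x. lookup \<beta> x \<le> 4"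
    unfolding interior_monomial_def edges_triangles by blast
  have EC: "?C \<union> (E - ?C) = E" using outer_cycle(2) by blast
  \<comment> \<open>\<open>has_monom_Un\<close> with \<alpha> for the cycle and \<beta> for the
    remaining edges: the factors share only outer vertices, where \<beta> is 0.\<close>
  have "has_monom lt (?C \<union> (E - ?C)) (\<alpha> + \<beta>)"
  proof (rule has_monom_Un)
    show "finite ?C" "finite (E - ?C)" using finite_E outer_cycle(2) finite_subset by auto
    show "orientation (?C \<union> (E - ?C)) lt" using assms(5) EC by simp
    show "\<forall>e\<in>?C \<union> (E - ?C). card e = 2" using EC edge(2) by simp
    show "has_monom lt ?C \<alpha>" using assms(7) by (simp add: has_monom_def)
    show "has_monom lt (E - ?C) \<beta>" by (rule \<beta>(1))
    fix x assume "x \<in> \<Union>?C"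
    then have "x \<in> set vs" using cycle_edges_subset[of _ vs] by blast
    then show "lookup \<beta> x = 0" by (rule \<beta>(2))
  qed auto
  then have "lookup (graph_poly lt E) (\<alpha> + \<beta>) \<noteq> 0" unfolding EC has_monom_def .
  moreover have "Poly_Mapping.keys \<beta> \<subseteq> V - set vs"
  proof -
    have "Poly_Mapping.keys \<beta> \<subseteq> \<Union>(E - ?C)"
      using \<beta>(1) finite_E orientation_subset[OF assms(5)] edge(2) by (intro has_monom_homogeneous(1)[of _ lt]) auto
    moreover have "\<Union>(E - ?C) \<subseteq> V" using edge(1) by blast
    moreover have "x \<notin> set vs" if "x \<in> Poly_Mapping.keys \<beta>" for x
      using that \<beta>(2)[of x] by (auto simp: in_keys_iff)
    ultimately show ?thesis by blast
  qed
  ultimately show ?thesis using \<beta>(3) by blast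
qed

end
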